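(* Let $s\in\mathbb R$ and $p,q\in(0,+\infty]$. If the wavelet system $\{\psi^{(i)}_{j,k}\}$ satisfies the dyadic covering property, then the set of sequences $\mathcal C\in b^{s,q}_p$ whose wavelet series is maximally divergent in $\mathbb R^d$ is prevalent in $b^{s,q}_p$.
   Context: Setting: integers $d,N\ge1$, bounded fast-decaying $\psi^{(1)},\dots,\psi^{(N)}:\mathbb R^d\to\mathbb C$ (for all $n$, $|\psi^{(i)}(x)|\le C_n(1+|x|)^{-n}$), wavelets $\psi^{(i)}_{j,k}(x)=\psi^{(i)}(2^jx-k)$, $j\ge0$, $k\in\mathbb Z^d$; dyadic cubes $\lambda_{j,k}=\prod_{m=1}^d[k_m2^{-j},(k_m+1)2^{-j})$ of scale $j$; coefficients indexed by $(i,\lambda)$; $\Lambda_j$ = pairs $(i,\lambda)$ with $\lambda$ of scale $j$. $b^{s,q}_p$: sequences $(c^{(i)}_\lambda)$ with $\big(\big(\sum_{(i,\lambda)\in\Lambda_j}|c^{(i)}_\lambda2^{(s-d/p)j}|^p\big)^{1/p}\big)_{j\ge0}\in\ell^q$ (supremum if $p=\infty$), a complete metric vector space for the corresponding $\ell^q$ (quasi-)norm. Divergence exponent $\delta_{\mathcal C}(x)$: supremum of $\gamma$ such that there exist $C>0$ and $(i_n,j_n,k_n)$ with $j_n\to\infty$ and $|c^{(i_n)}_{j_n,k_n}\psi^{(i_n)}_{j_n,k_n}(x)|\ge C2^{\gamma j_n}$. Maximal divergence in a nonempty open $A\subset\mathbb R^d$: (i) $\delta_{\mathcal C}(x)\in[-s,d/p-s]$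 for all $x\in A$; (ii) $\delta_{\mathcal C}=-s$ Lebesgue-a.e. on $A$; (iii) for every nonempty open $B\subset A$ and $\gamma\in[-s,d/p-s]$, $\dim_H\{x\in B:\delta_{\mathcal C}(x)=\gamma\}=d-sp-\gamma p$ (for $p=\infty$: $\delta_{\mathcal C}=-s$ on $A$). Dyadic covering property: there exist $C_0>0$ and finitely many triplets $(i_l,j_l,k_l)$ with $j_l\ge1$ such that every $x\in[0,1)^d$ has some $l$ with $|\psi^{(i_l)}(2^{j_l}x-k_l)|\ge C_0$. Prevalence: in a complete metric vector space $E$, a Borel set $A$ is Haar-null if there is a compactly supported Borel probability measure $\mu$ on $E$ with $\mu(x+A)=0$ for all $x\in E$; a set is Haar-null if contained in a Haar-null Borel set; a set is prevalent if its complement is Haar-null. *)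

theory Defs
  imports "HOL-Analysis.Analysis" "HOL-Probability.Probability" "HOL-Library.Function_Algebras"
begin

definition vec_of_int :: "int ^ 'd \<Rightarrow> real ^ 'd" where
  "vec_of_int k = (\<chi> m. real_of_int (k $ m))"

definition wavelet :: "('i \<Rightarrow> real ^ 'd \<Rightarrow> complex) \<Rightarrow> 'i \<Rightarrow> nat \<Rightarrow> int ^ 'd \<Rightarrow> real ^ 'd \<Rightarrow> complex" where
  "wavelet \<psi> i j k x = \<psi> i ((2::real) ^ j *\<^sub>R x - vec_of_int k)"

definition fast_decaying :: "(real ^ 'd \<Rightarrow> complex) \<Rightarrow> bool" where
  "fast_decaying f \<longleftrightarrow> (\<forall>n::nat. \<exists>C. \<forall>x. norm (f x) \<le> C * (1 + norm x) powr (- real n))"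

definition dyadic_covering :: "('i::finite \<Rightarrow> real ^ 'd \<Rightarrow> complex) \<Rightarrow> bool" where
  "dyadic_covering \<psi> \<longleftrightarrow>
     (\<exists>C0 > 0. \<exists>L :: ('i \<times> nat \<times> (int ^ 'd)) set. finite L \<and> (\<forall>(i,j,k)\<in>L. j \<ge> 1) \<and>
        (\<forall>x :: real ^ 'd. (\<forall>m. 0 \<le> x $ m \<and> x $ m < 1) \<longrightarrow>
            (\<exists>(i,j,k)\<in>L. norm (\<psi> i ((2::real) ^ j *\<^sub>R x - vec_of_int k)) \<ge> C0)))"

text \<open>Exponents p, q are extended reals in (0, +infinity]; d/p is read as 0 when p = infinity.\<close>

definition d_over_p :: "'d::finite itself \<Rightarrow> ereal \<Rightarrow> real" where
  "d_over_p _ p = (if p = \<infinity> then 0 else real CARD('d) / real_of_ereal p)"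

definition layer :: "ereal \<Rightarrow> real \<Rightarrow> ('i::finite \<Rightarrow> nat \<Rightarrow> int ^ 'd::finite \<Rightarrow> complex) \<Rightarrow> nat \<Rightarrow> real" where
  "layer p s c j =
     (if p = \<infinity> then (SUP ik \<in> (UNIV :: ('i \<times> (int ^ 'd)) set). norm (c (fst ik) j (snd ik) * 2 powr (s * real j)))
      else (infsum (\<lambda>ik :: 'i \<times> (int ^ 'd).
               norm (c (fst ik) j (snd ik) * 2 powr ((s - d_over_p TYPE('d) p) * real j)) powr real_of_ereal p) UNIV)
             powr (1 / real_of_ereal p))"

definition in_besov_seq :: "ereal \<Rightarrow> ereal \<Rightarrow> real \<Rightarrow> ('i::finite \<Rightarrow> nat \<Rightarrow> int ^ 'd::finite \<Rightarrow> complex) \<Rightarrow> bool" where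
  "in_besov_seq p q s c \<longleftrightarrow>
     (\<forall>j. if p = \<infinity> then bdd_above ((\<lambda>ik :: 'i \<times> (int ^ 'd). norm (c (fst ik) j (snd ik))) ` UNIV)
          else (\<lambda>ik :: 'i \<times> (int ^ 'd). norm (c (fst ik) j (snd ik)) powr real_of_ereal p) summable_on UNIV) \<and>
     (if q = \<infinity> then bdd_above (range (layer p s c))
      else summable (\<lambda>j. layer p s c j powr real_of_ereal q))"

definition besov_seq :: "ereal \<Rightarrow> ereal \<Rightarrow> real \<Rightarrow> ('i::finite \<Rightarrow> nat \<Rightarrow> int ^ 'd::finite \<Rightarrow> complex) set" where
  "besov_seq p q s = {c. in_besov_seq p q s c}"

definition besov_norm :: "ereal \<Rightarrow> ereal \<Rightarrow> real \<Rightarrow> ('i::finite \<Rightarrow> nat \<Rightarrow> int ^ 'd::finite \<Rightarrow> complex) \<Rightarrow> real" where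
  "besov_norm p q s c =
     (if q = \<infinity> then (SUP j. layer p s c j)
      else (\<Sum>j. layer p s c j powr real_of_ereal q) powr (1 / real_of_ereal q))"

definition besov_topology :: "ereal \<Rightarrow> ereal \<Rightarrow> real \<Rightarrow> ('i::finite \<Rightarrow> nat \<Rightarrow> int ^ 'd::finite \<Rightarrow> complex) topology" where
  "besov_topology p q s = topology (\<lambda>U. U \<subseteq> besov_seq p q s \<and>
      (\<forall>x\<in>U. \<exists>e>0. \<forall>y\<in>besov_seq p q s. besov_norm p q s (y - x) < e \<longrightarrow> y \<in> U))"

definition borel_sets_of :: "'a topology \<Rightarrow> 'a set set" where
  "borel_sets_of T = sigma_sets (topspace T) (Collect (openin T))"

definition haar_null_borel :: "('a::plus) topology \<Rightarrow> 'a set \<Rightarrow> bool" where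
  "haar_null_borel T A \<longleftrightarrow> A \<in> borel_sets_of T \<and>
     (\<exists>\<mu> :: 'a measure. prob_space \<mu> \<and> space \<mu> = topspace T \<and> sets \<mu> = borel_sets_of T \<and>
        (\<exists>K. compactin T K \<and> K \<in> sets \<mu> \<and> emeasure \<mu> K = 1) \<and>
        (\<forall>x\<in>topspace T. emeasure \<mu> ((\<lambda>a. x + a) ` A) = 0))"

definition haar_null :: "('a::plus) topology \<Rightarrow> 'a set \<Rightarrow> bool" where
  "haar_null T A \<longleftrightarrow> (\<exists>E. A \<subseteq> E \<and> haar_null_borel T E)"

definition prevalent :: "('a::plus) topology \<Rightarrow> 'a set \<Rightarrow> bool" where
  "prevalent T S \<longleftrightarrow> haar_null T (topspace T - S)"

definition hausdorff_premeasure :: "real \<Rightarrow> real \<Rightarrow> ('a::metric_space) set \<Rightarrow> ennreal" where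
  "hausdorff_premeasure \<alpha> \<delta> E =
     (INF U \<in> {U :: nat \<Rightarrow> 'a set. E \<subseteq> (\<Union>n. U n) \<and> (\<forall>n. bounded (U n) \<and> diameter (U n) \<le> \<delta>)}.
        (\<Sum>n. ennreal (if U n = {} then 0 else if \<alpha> = 0 then 1 else diameter (U n) powr \<alpha>)))"

definition hausdorff_measure :: "real \<Rightarrow> ('a::metric_space) set \<Rightarrow> ennreal" where
  "hausdorff_measure \<alpha> E = (SUP \<delta> \<in> {0<..}. hausdorff_premeasure \<alpha> \<delta> E)"

definition hausdorff_dim :: "('a::metric_space) set \<Rightarrow> ereal" where
  "hausdorff_dim E = (if E = {} then - \<infinity>
      else Inf (ereal ` {\<alpha>. 0 \<le> \<alpha> \<and> hausdorff_measure \<alpha> E = 0}))"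

definition divergence_exponent ::
  "('i \<Rightarrow> real ^ 'd \<Rightarrow> complex) \<Rightarrow> ('i \<Rightarrow> nat \<Rightarrow> int ^ 'd \<Rightarrow> complex) \<Rightarrow> real ^ 'd \<Rightarrow> ereal" where
  "divergence_exponent \<psi> c x = Sup (ereal ` {\<gamma>. \<exists>C>0. \<exists>(i :: nat \<Rightarrow> 'i) (j :: nat \<Rightarrow> nat) (k :: nat \<Rightarrow> (int ^ 'd)).
      filterlim j at_top sequentially \<and>
      (\<forall>n. norm (c (i n) (j n) (k n) * wavelet \<psi> (i n) (j n) (k n) x) \<ge> C * 2 powr (\<gamma> * real (j n)))})"

definition maximally_divergent ::
  "('i::finite \<Rightarrow> real ^ 'd::finite \<Rightarrow> complex) \<Rightarrow> ereal \<Rightarrow> real \<Rightarrow> ('i \<Rightarrow> nat \<Rightarrow> int ^ 'd \<Rightarrow> complex)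
     \<Rightarrow> (real ^ 'd) set \<Rightarrow> bool" where
  "maximally_divergent \<psi> p s c A \<longleftrightarrow>
     (\<forall>x\<in>A. ereal (- s) \<le> divergence_exponent \<psi> c x \<and>
             divergence_exponent \<psi> c x \<le> ereal (d_over_p TYPE('d) p - s)) \<and>
     (AE x in lborel. x \<in> A \<longrightarrow> divergence_exponent \<psi> c x = ereal (- s)) \<and>
     (p \<noteq> \<infinity> \<longrightarrow> (\<forall>B. open B \<and> B \<noteq> {} \<and> B \<subseteq> A \<longrightarrow>
        (\<forall>\<gamma>. - s \<le> \<gamma> \<and> \<gamma> \<le> d_over_p TYPE('d) p - s \<longrightarrow>
           hausdorff_dim {x\<in>B. divergence_exponent \<psi> c x = ereal \<gamma>}
             = ereal (real CARD('d) - s * real_of_ereal p - \<gamma> * real_of_ereal p))))"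

end

theory Submission
  imports Defs "HOL-Real_Asymp.Real_Asymp"
begin

text \<open>
  The bounds \<open>\<delta> \<le> d/p - s\<close> and \<open>dim {\<delta> \<ge> \<gamma>} \<le> d - s p - \<gamma> p\<close> hold for every sequence, by counting the
  large coefficients. For the reverse bounds the probe is \<open>\<omega> \<mapsto> (\<omega>_m g_n)\<close> with one uniform variable
  \<open>\<omega>_m\<close> for each coarse scale \<open>T m\<close>, where \<open>T\<close> exceeds the scales of the covering triplets and \<open>g\<close> is a
  saturating sequence: up to a subexponential factor, \<open>g_n\<close> is \<open>2^((d/p - s) j - (d/p) v)\<close> if \<open>n\<close> is a
  coefficient of scale \<open>j\<close> attached by the covering to a cube with corner in \<open>2^(-v) Z^d\<close>.

  Whatever the fixed sequence \<open>x\<close> is, \<open>\<bar>\<omega>_m g_n - x_n\<bar> < \<epsilon> g_n\<close> has probability at most \<open>2 \<epsilon>\<close>. The \<open>J\<close>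
  scales \<open>T m\<close> with \<open>J\<^sup>2 \<le> m < J\<^sup>2 + J\<close> are independent, so the chance that a given cube of scale
  \<open>T (J\<^sup>2 + J)\<close> has no ancestor in this range with all its attached coefficients large decays like
  \<open>(C 2^(-A J))^J\<close>, which beats the number \<open>2^(d T (J\<^sup>2 + J))\<close> of cubes once \<open>A > d T\<close>, although the loss
  \<open>2^(-A J)\<close> is subexponential in the scale. By Borel-Cantelli almost every \<open>\<omega> g - x\<close> is therefore as
  divergent as \<open>g\<close> at every point simultaneously.

  A point lying, along a lacunary sequence of scales \<open>j\<close>, in a cube of scale \<open>j\<close> with corner in
  \<open>2^(-\<tau> j) Z^d\<close> then satisfies \<open>\<delta> \<ge> (d/p - s) - \<tau> d/p\<close>. Inserting blocks of zeros into the binary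
  digits maps the unit cube onto a set of such points by a map whose inverse is Hoelder with
  exponent \<open>\<tau>\<close>; hence this set is not null for the Hausdorff measure of dimension \<open>d \<tau>\<close>, whereas the part
  of it where \<open>\<delta>\<close> is larger is null.
\<close>

section \<open>Hausdorff null sets\<close>

text \<open>Maximal divergence constrains all points and all level sets, and is not visibly a Borel
  condition. It is replaced by \<open>eventually_robust\<close>, which involves countably many
  coefficients: it is Borel and implies every clause of maximal divergence, for all \<gamma> and all
  open sets together, so that a single Haar-null complement suffices and no intersection over
  \<gamma> is taken. One scale alone cannot beat the number of cubes, because a subexponential
  threshold gives only a subexponential failure probability. In a block near J^2, J independent
  factors 2^(-A J) multiply to 2^(-A J^2), the order of the number of cubes, while each coefficient
  of scale j loses only 2^(-O(sqrt j)). The price is that the good scale in a block is not under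
  control. A point must therefore be close to dyadic corners throughout the block; this fixes where
  the zeros are inserted, and factorial J make all earlier blocks negligible. The lower bound for
  the dimension works with null sets at exactly the critical exponent: points of larger \<delta>
  have to be removed, and the dimension of that removed part may come arbitrarily close to the
  critical one.\<close>

definition hausdorff_cost :: "real \<Rightarrow> 'a::metric_space set \<Rightarrow> ennreal" where
  "hausdorff_cost \<alpha> U = ennreal (if U = {} then 0 else if \<alpha> = 0 then 1 else diameter U powr \<alpha>)"

lemma hausdorff_cost_empty [simp]: "hausdorff_cost \<alpha> {} = 0"
  by (simp add: hausdorff_cost_def)

lemma hausdorff_measure_zeroD:
  assumes "hausdorff_measure \<alpha> E = 0" "0 < \<delta>" "0 < \<epsilon>"
  obtains U :: "nat \<Rightarrow> 'a::metric_space set" where "E \<subseteq> (\<Union>n. U n)"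
    "\<And>n. bounded (U n)" "\<And>n. diameter (U n) \<le> \<delta>" "(\<Sum>n. hausdorff_cost \<alpha> (U n)) < ennreal \<epsilon>"
proof -
  have "hausdorff_premeasure \<alpha> \<delta> E \<le> hausdorff_measure \<alpha> E"
    unfolding hausdorff_measure_def using assms(2) by (intro SUP_upper) auto
  then have "hausdorff_premeasure \<alpha> \<delta> E < ennreal \<epsilon>"
    using assms by auto
  then show thesis
    unfolding hausdorff_premeasure_def INF_less_iff hausdorff_cost_def[symmetric] using that by blast
qed

text \<open>Covers may be double sequences because countable unions (one cover per member) and
  limsup sets (one finite family per scale) produce them in that form. \<open>prod_decode\<close>
  flattens them without changing the total cost.\<close>

lemma hausdorff_measure_zeroI:
  fixes E :: "'a::metric_space set"
  assumes "\<And>\<delta> \<epsilon>::real. 0 < \<delta> \<Longrightarrow> 0 < \<epsilon> \<Longrightarrow> \<exists>U::nat \<Rightarrow> nat \<Rightarrow> 'a set. E \<subseteq> (\<Union>m n. U m n) \<and>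
     (\<forall>m n. bounded (U m n) \<and> diameter (U m n) \<le> \<delta>) \<and> (\<Sum>m n. hausdorff_cost \<alpha> (U m n)) \<le> ennreal \<epsilon>"
  shows "hausdorff_measure \<alpha> E = 0"
proof -
  have "hausdorff_premeasure \<alpha> \<delta> E \<le> 0" if "0 < \<delta>" for \<delta>
  proof (rule ennreal_le_epsilon)
    fix \<epsilon> :: real assume "0 < \<epsilon>"
    from assms[OF that this] obtain U :: "nat \<Rightarrow> nat \<Rightarrow> 'a set" where U: "E \<subseteq> (\<Union>m n. U m n)"
      "\<And>m n. bounded (U m n)" "\<And>m n. diameter (U m n) \<le> \<delta>" "(\<Sum>m n. hausdorff_cost \<alpha> (U m n)) \<le> ennreal \<epsilon>"
      by blast
    define V where "V n = case_prod U (prod_decode n)" for n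
    have "E \<subseteq> (\<Union>n. V n)"
    proof
      fix x assume "x \<in> E"
      then obtain m n where "x \<in> U m n" using U(1) by blast
      then have "x \<in> V (prod_encode (m,n))" by (simp add: V_def)
      then show "x \<in> (\<Union>n. V n)" by blast
    qed
    moreover have "bounded (V n) \<and> diameter (V n) \<le> \<delta>" for n
      using U by (simp add: V_def split: prod.split)
    moreover have "(\<Sum>n. hausdorff_cost \<alpha> (V n)) = (\<Sum>m n. hausdorff_cost \<alpha> (U m n))"
      unfolding V_def using suminf_ennreal_2dimen[of "\<lambda>m. \<Sum>n. hausdorff_cost \<alpha> (U m n)" "\<lambda>(m,n). hausdorff_cost \<alpha> (U m n)"]
      by (simp add: case_prod_beta)
    ultimately have "hausdorff_premeasure \<alpha> \<delta> E \<le> (\<Sum>m n. hausdorff_cost \<alpha> (U m n))"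
      unfolding hausdorff_premeasure_def hausdorff_cost_def[symmetric]
      by (intro INF_lower2[where i=V]) auto
    with U(4) show "hausdorff_premeasure \<alpha> \<delta> E \<le> 0 + ennreal \<epsilon>" by simp
  qed
  then show ?thesis
    unfolding hausdorff_measure_def by (intro antisym SUP_least) auto
qed

lemma hausdorff_measure_zero_subset:
  assumes "hausdorff_measure \<alpha> F = 0" "E \<subseteq> F"
  shows "hausdorff_measure \<alpha> E = 0"
proof (rule hausdorff_measure_zeroI)
  fix \<delta> \<epsilon> :: real assume "0 < \<delta>" "0 < \<epsilon>"
  from hausdorff_measure_zeroD[OF assms(1) this] obtain U where U: "F \<subseteq> (\<Union>n. U n)"
    "\<And>n. bounded (U n)" "\<And>n. diameter (U n) \<le> \<delta>" "(\<Sum>n. hausdorff_cost \<alpha> (U n)) < ennreal \<epsilon>" by blast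
  define V :: "nat \<Rightarrow> nat \<Rightarrow> 'a set" where "V m n = (if m = 0 then U n else {})" for m n
  have "(\<Sum>m n. hausdorff_cost \<alpha> (V m n)) = (\<Sum>m\<in>{0}. \<Sum>n. hausdorff_cost \<alpha> (V m n))"
    by (rule suminf_finite) (auto simp: V_def)
  also have "\<dots> = (\<Sum>n. hausdorff_cost \<alpha> (U n))" by (simp add: V_def)
  finally have "(\<Sum>m n. hausdorff_cost \<alpha> (V m n)) \<le> ennreal \<epsilon>" using U(4) by simp
  moreover have "E \<subseteq> (\<Union>m n. V m n)"
    using assms(2) U(1) by (force simp: V_def)
  moreover have "bounded (V m n) \<and> diameter (V m n) \<le> \<delta>" for m n
    using U \<open>0 < \<delta>\<close> by (simp add: V_def)
  ultimately show "\<exists>U::nat \<Rightarrow> nat \<Rightarrow> 'a set. E \<subseteq> (\<Union>m n. U m n) \<and>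
     (\<forall>m n. bounded (U m n) \<and> diameter (U m n) \<le> \<delta>) \<and> (\<Sum>m n. hausdorff_cost \<alpha> (U m n)) \<le> ennreal \<epsilon>"
    by blast
qed

lemma hausdorff_measure_zero_UN:
  fixes E :: "nat \<Rightarrow> 'a::metric_space set"
  assumes "\<And>m. hausdorff_measure \<alpha> (E m) = 0"
  shows "hausdorff_measure \<alpha> (\<Union>m. E m) = 0"
proof (rule hausdorff_measure_zeroI)
  fix \<delta> \<epsilon> :: real assume "0 < \<delta>" "0 < \<epsilon>"
  have "\<exists>U. E m \<subseteq> (\<Union>n. U n) \<and> (\<forall>n. bounded (U n) \<and> diameter (U n) \<le> \<delta>) \<and>
      (\<Sum>n. hausdorff_cost \<alpha> (U n)) \<le> ennreal (\<epsilon> * (1/2)^Suc m)" for m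
  proof -
    have "0 < \<epsilon> * (1/2)^Suc m" using \<open>0 < \<epsilon>\<close> by simp
    from hausdorff_measure_zeroD[OF assms[of m] \<open>0 < \<delta>\<close> this] obtain U where "E m \<subseteq> (\<Union>n. U n)"
      "\<And>n. bounded (U n)" "\<And>n. diameter (U n) \<le> \<delta>" "(\<Sum>n. hausdorff_cost \<alpha> (U n)) < ennreal (\<epsilon> * (1/2)^Suc m)"
      by metis
    then show ?thesis by (intro exI[of _ U]) auto
  qed
  then obtain U where U: "\<And>m. E m \<subseteq> (\<Union>n. U m n)" "\<And>m n. bounded (U m n)" "\<And>m n. diameter (U m n) \<le> \<delta>"
     "\<And>m. (\<Sum>n. hausdorff_cost \<alpha> (U m n)) \<le> ennreal (\<epsilon> * (1/2)^Suc m)" by metis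
  have "(\<Sum>m n. hausdorff_cost \<alpha> (U m n)) \<le> (\<Sum>m. ennreal (\<epsilon> * (1/2)^Suc m))"
    by (intro suminf_le U) auto
  also have "\<dots> = ennreal \<epsilon>"
    using sums_mult[OF power_half_series, of \<epsilon>] \<open>0 < \<epsilon>\<close> by (intro suminf_ennreal_eq) auto
  finally show "\<exists>U::nat \<Rightarrow> nat \<Rightarrow> 'a set. (\<Union>m. E m) \<subseteq> (\<Union>m n. U m n) \<and>
     (\<forall>m n. bounded (U m n) \<and> diameter (U m n) \<le> \<delta>) \<and> (\<Sum>m n. hausdorff_cost \<alpha> (U m n)) \<le> ennreal \<epsilon>"
    using U by (intro exI[of _ U]) (auto dest!: subsetD[OF U(1)])
qed

lemma hausdorff_measure_zero_mono_exponent: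
  fixes E :: "'a::metric_space set"
  assumes "hausdorff_measure \<alpha> E = 0" "0 \<le> \<alpha>" "\<alpha> \<le> \<beta>"
  shows "hausdorff_measure \<beta> E = 0"
proof (rule hausdorff_measure_zeroI)
  fix \<delta> \<epsilon> :: real assume "0 < \<delta>" "0 < \<epsilon>"
  \<comment> \<open>Only for diameters at most 1 is the cost nonincreasing in the exponent, so the
    mesh is cut down to 1.\<close>
  then have "0 < min \<delta> 1" by simp
  from hausdorff_measure_zeroD[OF assms(1) this \<open>0 < \<epsilon>\<close>] obtain U where U: "E \<subseteq> (\<Union>n. U n)"
    "\<And>n. bounded (U n)" "\<And>n. diameter (U n) \<le> min \<delta> 1" "(\<Sum>n. hausdorff_cost \<alpha> (U n)) < ennreal \<epsilon>" by blast
  have le: "hausdorff_cost \<beta> (U n) \<le> hausdorff_cost \<alpha> (U n)" for n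
  proof -
    have d: "0 \<le> diameter (U n)" "diameter (U n) \<le> 1"
      using U(2,3)[of n] diameter_ge_0 by auto
    then have "diameter (U n) powr \<beta> \<le> diameter (U n) powr \<alpha>"
      using assms(3) by (metis powr_mono')
    moreover have "diameter (U n) powr \<beta> \<le> 1"
      using d assms by (simp add: powr_le1)
    ultimately show ?thesis
      using assms by (auto simp: hausdorff_cost_def intro!: ennreal_leI)
  qed
  define V :: "nat \<Rightarrow> nat \<Rightarrow> 'a set" where "V m n = (if m = 0 then U n else {})" for m n
  have "(\<Sum>m n. hausdorff_cost \<beta> (V m n)) = (\<Sum>m\<in>{0}. \<Sum>n. hausdorff_cost \<beta> (V m n))"
    by (rule suminf_finite) (auto simp: V_def)
  also have "\<dots> = (\<Sum>n. hausdorff_cost \<beta> (U n))" by (simp add: V_def)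
  also have "\<dots> \<le> (\<Sum>n. hausdorff_cost \<alpha> (U n))" by (intro suminf_le le) auto
  finally have "(\<Sum>m n. hausdorff_cost \<beta> (V m n)) \<le> ennreal \<epsilon>" using U(4) by simp
  moreover have "E \<subseteq> (\<Union>m n. V m n)"
    using U(1) by (force simp: V_def)
  moreover have "bounded (V m n) \<and> diameter (V m n) \<le> \<delta>" for m n
    using U \<open>0 < \<delta>\<close> by (simp add: V_def)
  ultimately show "\<exists>U::nat \<Rightarrow> nat \<Rightarrow> 'a set. E \<subseteq> (\<Union>m n. U m n) \<and>
     (\<forall>m n. bounded (U m n) \<and> diameter (U m n) \<le> \<delta>) \<and> (\<Sum>m n. hausdorff_cost \<beta> (U m n)) \<le> ennreal \<epsilon>"
    by blast
qed

text \<open>The Hausdorff-Cantelli argument: for every N the balls of scales from N on cover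
  \<open>E\<close>, and their cost is a tail of a convergent series times 2^\<alpha>, the factor
  coming from diameter against radius.\<close>

lemma hausdorff_measure_limsup_balls:
  fixes ctr :: "nat \<Rightarrow> 'b \<Rightarrow> 'a::euclidean_space"
  assumes fin: "\<And>j. finite (F j)" and \<rho>: "\<And>j. 0 \<le> \<rho> j" "\<rho> \<longlonglongrightarrow> 0" and \<alpha>: "0 < \<alpha>"
    and sum: "summable (\<lambda>j. real (card (F j)) * \<rho> j powr \<alpha>)"
    and E: "\<And>x. x \<in> E \<Longrightarrow> \<exists>\<^sub>F j in sequentially. \<exists>b\<in>F j. x \<in> cball (ctr j b) (\<rho> j)"
  shows "hausdorff_measure \<alpha> E = 0"
proof (rule hausdorff_measure_zeroI)
  fix \<delta> \<epsilon> :: real assume "0 < \<delta>" "0 < \<epsilon>"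
  let ?f = "\<lambda>j. real (card (F j)) * \<rho> j powr \<alpha>"
  have "\<forall>\<^sub>F j in sequentially. \<rho> j < \<delta>/2"
    using \<open>0 < \<delta>\<close> by (intro order_tendstoD(2)[OF \<rho>(2)]) auto
  moreover have "(\<lambda>n. \<Sum>i. ?f (i + n)) \<longlonglongrightarrow> 0"
    by (rule suminf_exist_split2[OF sum])
  then have "\<forall>\<^sub>F n in sequentially. (\<Sum>i. ?f (i + n)) < \<epsilon> / 2 powr \<alpha>"
    using \<open>0 < \<epsilon>\<close> by (intro order_tendstoD(2)) auto
  moreover note eventually_all_ge_at_top[OF calculation(1)]
  ultimately have "\<forall>\<^sub>F n in sequentially. (\<forall>j\<ge>n. \<rho> j < \<delta>/2) \<and> (\<Sum>i. ?f (i + n)) < \<epsilon> / 2 powr \<alpha>"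
    by (intro eventually_conj)
  then obtain N where N: "\<And>j. j \<ge> N \<Longrightarrow> \<rho> j < \<delta>/2" "(\<Sum>i. ?f (i + N)) < \<epsilon> / 2 powr \<alpha>"
    unfolding eventually_sequentially by blast
  define e where "e j = (SOME e. bij_betw e {0..<card (F j)} (F j))" for j
  have e: "bij_betw (e j) {0..<card (F j)} (F j)" for j
    unfolding e_def using someI_ex[OF ex_bij_betw_nat_finite[OF fin[of j]]] .
  define U where "U m n = (if n < card (F (m + N)) then cball (ctr (m + N) (e (m + N) n)) (\<rho> (m + N)) else {})" for m n
  have "E \<subseteq> (\<Union>m n. U m n)"
  proof
    fix x assume "x \<in> E"
    then obtain j b where j: "j \<ge> N" "b \<in> F j" "x \<in> cball (ctr j b) (\<rho> j)"
      using E[of x] unfolding frequently_sequentially by blast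
    then obtain n where "n < card (F j)" "e j n = b"
      using e[of j] unfolding bij_betw_def by (metis atLeastLessThan_iff imageE)
    then have "x \<in> U (j - N) n" using j by (simp add: U_def)
    then show "x \<in> (\<Union>m n. U m n)" by blast
  qed
  moreover have "bounded (U m n) \<and> diameter (U m n) \<le> \<delta>" for m n
    using N(1)[of "m + N"] \<rho>(1)[of "m + N"] \<open>0 < \<delta>\<close> by (auto simp: U_def)
  moreover have "(\<Sum>m n. hausdorff_cost \<alpha> (U m n)) \<le> ennreal \<epsilon>"
  proof -
    have "(\<Sum>n. hausdorff_cost \<alpha> (U m n)) = ennreal (2 powr \<alpha> * ?f (m + N))" for m
    proof -
      have "(\<Sum>n. hausdorff_cost \<alpha> (U m n)) = (\<Sum>n<card (F (m + N)). hausdorff_cost \<alpha> (U m n))"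
        by (rule suminf_finite) (auto simp: U_def)
      also have "\<dots> = (\<Sum>n<card (F (m + N)). ennreal ((2 * \<rho> (m + N)) powr \<alpha>))"
        using \<rho>(1)[of "m + N"] \<alpha> by (intro sum.cong) (auto simp: U_def hausdorff_cost_def)
      also have "\<dots> = ennreal (2 powr \<alpha> * ?f (m + N))"
        using \<rho>(1)[of "m + N"] by (simp add: powr_mult ennreal_of_nat_eq_real_of_nat ennreal_mult'[symmetric] algebra_simps)
      finally show ?thesis .
    qed
    then have "(\<Sum>m n. hausdorff_cost \<alpha> (U m n)) = (\<Sum>m. ennreal (2 powr \<alpha> * ?f (m + N)))"
      by simp
    also have "\<dots> = ennreal (\<Sum>m. 2 powr \<alpha> * ?f (m + N))"
      using summable_ignore_initial_segment[OF sum, of N] by (intro suminf_ennreal2 summable_mult) auto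
    also have "(\<Sum>m. 2 powr \<alpha> * ?f (m + N)) = 2 powr \<alpha> * (\<Sum>m. ?f (m + N))"
      using summable_ignore_initial_segment[OF sum, of N] by (intro suminf_mult)
    finally show ?thesis
      using N(2) by (auto simp: field_simps intro!: ennreal_leI)
  qed
  ultimately show "\<exists>U::nat \<Rightarrow> nat \<Rightarrow> 'a set. E \<subseteq> (\<Union>m n. U m n) \<and>
     (\<forall>m n. bounded (U m n) \<and> diameter (U m n) \<le> \<delta>) \<and> (\<Sum>m n. hausdorff_cost \<alpha> (U m n)) \<le> ennreal \<epsilon>"
    by blast
qed

text \<open>Pull a cover of \<open>S\<close> back along \<open>\<phi>\<close>: the preimage of a
  piece of diameter r lies in a box with sides 2 C r^\<tau>, and its volume (2 C)^d r^(d \<tau>) is,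
  up to the constant, the cost of the piece at exponent d \<tau>. The bound on \<open>\<phi>\<close>
  is stated for positive \<tau> only; at \<tau> = 0 nullity already forces \<open>S\<close> to be
  empty.\<close>

lemma negligible_inverse_Hoelder_preimage:
  fixes \<phi> :: "real ^ 'd::finite \<Rightarrow> 'b::metric_space"
  assumes \<phi>: "\<And>x y c. 0 < \<tau> \<Longrightarrow> x \<in> Q \<Longrightarrow> y \<in> Q \<Longrightarrow> \<bar>x $ c - y $ c\<bar> \<le> C * dist (\<phi> x) (\<phi> y) powr \<tau>"
    and \<tau>: "0 \<le> \<tau>" "0 \<le> C" and H: "hausdorff_measure (real CARD('d) * \<tau>) S = 0"
  shows "negligible {x \<in> Q. \<phi> x \<in> S}"
proof (cases "\<tau> = 0")
  case True \<comment> \<open>Here the Hausdorff measure is the counting measure.\<close>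
  have "S = {}"
  proof (rule ccontr)
    assume "S \<noteq> {}"
    from hausdorff_measure_zeroD[OF H zero_less_one zero_less_one] obtain U where U: "S \<subseteq> (\<Union>n. U n)"
      "(\<Sum>n. hausdorff_cost (real CARD('d) * \<tau>) (U n)) < ennreal 1" by metis
    then obtain n where "U n \<noteq> {}" using \<open>S \<noteq> {}\<close> by blast
    then have "hausdorff_cost (real CARD('d) * \<tau>) (U n) = 1" by (simp add: hausdorff_cost_def True)
    moreover have "hausdorff_cost (real CARD('d) * \<tau>) (U n) \<le> (\<Sum>n. hausdorff_cost (real CARD('d) * \<tau>) (U n))"
      using sum_le_suminf[of "\<lambda>n. hausdorff_cost (real CARD('d) * \<tau>) (U n)" "{n}"] by simp
    ultimately show False using U(2) by simp
  qed
  then show ?thesis by simp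
next
  case False
  define D where "D = real CARD('d) * \<tau>"
  have D: "0 < D" using False \<tau> by (simp add: D_def)
  \<comment> \<open>The added 1 keeps \<open>C'\<close> positive when \<open>C = 0\<close>, so that
    \<open>e / C'\<close> is an admissible cost.\<close>
  define C' where "C' = (2 * C) ^ CARD('d) + 1"
  have C': "0 < C'" using \<tau> by (simp add: C'_def add_nonneg_pos)
  show ?thesis unfolding negligible_outer_le
  proof (intro allI impI)
    fix e :: real assume "0 < e"
    then have "0 < e / C'" using C' by simp
    from hausdorff_measure_zeroD[OF H zero_less_one this] obtain U where U: "S \<subseteq> (\<Union>n. U n)" "\<And>n. bounded (U n)"
      "(\<Sum>n. hausdorff_cost D (U n)) < ennreal (e / C')" unfolding D_def by metis
    define P where "P n = {x \<in> Q. \<phi> x \<in> U n}" for n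
    \<comment> \<open>The Hoelder bound compares two points of \<open>Q\<close>, so each box is
      centred at a chosen point of the preimage itself.\<close>
    define z where "z n = (SOME z. z \<in> P n)" for n
    have z: "z n \<in> P n" if "P n \<noteq> {}" for n
      unfolding z_def using that by (simp add: some_in_eq)
    define w :: "nat \<Rightarrow> real ^ 'd" where "w n = (\<chi> c. C * diameter (U n) powr \<tau>)" for n
    define X where "X n = (if P n = {} then {} else cbox (z n - w n) (z n + w n))" for n
    have PX: "P n \<subseteq> X n" for n
    proof
      fix x assume x: "x \<in> P n"
      then have zn: "z n \<in> P n" using z by blast
      have "\<bar>x $ c - z n $ c\<bar> \<le> C * diameter (U n) powr \<tau>" for c
      proof -
        have "\<bar>x $ c - z n $ c\<bar> \<le> C * dist (\<phi> x) (\<phi> (z n)) powr \<tau>"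
          using x zn \<tau> \<open>\<tau> \<noteq> 0\<close> by (intro \<phi>) (auto simp: P_def)
        also have "\<dots> \<le> C * diameter (U n) powr \<tau>"
          using x zn \<tau> U(2) diameter_bounded_bound[of "U n" "\<phi> x" "\<phi> (z n)"]
          by (intro mult_left_mono powr_mono2) (auto simp: P_def)
        finally show ?thesis .
      qed
      then have "- (C * diameter (U n) powr \<tau>) \<le> x $ c - z n $ c \<and> x $ c - z n $ c \<le> C * diameter (U n) powr \<tau>" for c
        by (metis abs_le_D1 abs_le_D2 minus_le_iff)
      then have "x \<in> cbox (z n - w n) (z n + w n)"
        by (auto simp: mem_box_cart w_def algebra_simps)
      then show "x \<in> X n" using x by (auto simp: X_def)
    qed
    have mX: "emeasure lebesgue (X n) \<le> ennreal C' * hausdorff_cost D (U n)" for n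
    proof (cases "P n = {}")
      case False
      then have ne: "U n \<noteq> {}" by (auto simp: P_def)
      have d: "0 \<le> diameter (U n)" using U(2) by (rule diameter_ge_0)
      have wn: "0 \<le> w n $ c" for c using \<tau> by (simp add: w_def)
      have "emeasure lebesgue (X n) = emeasure lborel (cbox (z n - w n) (z n + w n))"
        using False by (simp add: X_def)
      also have "\<dots> = ennreal (\<Prod>b\<in>Basis. ((z n + w n) - (z n - w n)) \<bullet> b)"
        using wn by (subst emeasure_lborel_cbox_eq) (auto simp: Basis_vec_def inner_axis algebra_simps)
      also have "(\<Prod>b\<in>Basis. ((z n + w n) - (z n - w n)) \<bullet> b) = (2 * (C * diameter (U n) powr \<tau>)) ^ CARD('d)"
      proof -
        have "(\<Prod>b\<in>Basis. ((z n + w n) - (z n - w n)) \<bullet> b) = (\<Prod>b\<in>(Basis::(real^'d) set). 2 * (C * diameter (U n) powr \<tau>))"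
          by (intro prod.cong) (auto simp: Basis_vec_def inner_axis w_def)
        then show ?thesis by simp
      qed
      also have "\<dots> = (2 * C) ^ CARD('d) * diameter (U n) powr D"
        using d \<tau> \<open>\<tau> \<noteq> 0\<close> by (cases "diameter (U n) = 0") (simp_all add: power_mult_distrib D_def powr_power mult.commute)
      also have "ennreal \<dots> \<le> ennreal (C' * diameter (U n) powr D)"
        by (intro ennreal_leI mult_right_mono) (auto simp: C'_def)
      also have "\<dots> = ennreal C' * hausdorff_cost D (U n)"
        using ne D C' by (simp add: hausdorff_cost_def ennreal_mult')
      finally show ?thesis .
    qed (simp add: X_def)
    have Xm: "X n \<in> sets lebesgue" for n by (simp add: X_def)
    have "emeasure lebesgue (\<Union>n. X n) \<le> (\<Sum>n. emeasure lebesgue (X n))"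
      using Xm by (intro emeasure_subadditive_countably) auto
    also have "\<dots> \<le> (\<Sum>n. ennreal C' * hausdorff_cost D (U n))" by (intro suminf_le mX) auto
    also have "\<dots> = ennreal C' * (\<Sum>n. hausdorff_cost D (U n))" by simp
    also have "\<dots> \<le> ennreal C' * ennreal (e / C')" using U(3) by (intro mult_left_mono) auto
    also have "\<dots> = ennreal e" using C' \<open>0 < e\<close> by (simp add: ennreal_mult[symmetric])
    finally have le: "emeasure lebesgue (\<Union>n. X n) \<le> ennreal e" .
    have "{x \<in> Q. \<phi> x \<in> S} \<subseteq> (\<Union>n. X n)"
    proof
      fix x assume x: "x \<in> {x \<in> Q. \<phi> x \<in> S}"
      then obtain n where "\<phi> x \<in> U n" using U(1) by blast
      then show "x \<in> (\<Union>n. X n)" using x PX[of n] by (auto simp: P_def)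
    qed
    moreover have "(\<Union>n. X n) \<in> lmeasurable"
      using Xm le by (intro fmeasurableI) (auto intro: le_less_trans)
    moreover have "measure lebesgue (\<Union>n. X n) \<le> e"
      using le \<open>0 < e\<close> by (simp add: measure_def enn2real_leI)
    ultimately show "\<exists>T. {x \<in> Q. \<phi> x \<in> S} \<subseteq> T \<and> T \<in> lmeasurable \<and> measure lebesgue T \<le> e" by blast
  qed
qed

section \<open>Inserting zeros into binary expansions\<close>

text \<open>\<open>P\<close> is the set of (one-based) positions that receive a zero; \<open>insert_zeros P x t\<close> is the integer
  formed by the first \<open>t\<close> binary digits of \<open>cantor_map P x\<close>.\<close>

definition free_count :: "nat set \<Rightarrow> nat \<Rightarrow> nat" where
  "free_count P t = card ({1..t} - P)"

fun insert_zeros :: "nat set \<Rightarrow> real \<Rightarrow> nat \<Rightarrow> int" where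
  "insert_zeros P x 0 = 0"
| "insert_zeros P x (Suc t) = 2 * insert_zeros P x t +
     (if Suc t \<in> P then 0 else \<lfloor>2 ^ Suc (free_count P t) * x\<rfloor> - 2 * \<lfloor>2 ^ free_count P t * x\<rfloor>)"

definition cantor_map :: "nat set \<Rightarrow> real \<Rightarrow> real" where
  "cantor_map P x = (SUP t. insert_zeros P x t / 2 ^ t)"

lemma free_count_0 [simp]: "free_count P 0 = 0"
  by (simp add: free_count_def)

lemma free_count_Suc: "free_count P (Suc t) = free_count P t + (if Suc t \<in> P then 0 else 1)"
proof -
  have "{1..Suc t} - P = (if Suc t \<in> P then {1..t} - P else insert (Suc t) ({1..t} - P))"
    by (auto simp: le_Suc_eq)
  then show ?thesis by (simp add: free_count_def)
qed

lemma binary_digit: "\<lfloor>2 * y\<rfloor> - 2 * \<lfloor>y\<rfloor> \<in> {0, 1}" for y :: real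
proof -
  have "2 * \<lfloor>y\<rfloor> \<le> \<lfloor>2 * y\<rfloor>" "\<lfloor>2 * y\<rfloor> < 2 * \<lfloor>y\<rfloor> + 2" by linarith+
  then show ?thesis by auto
qed

lemma insert_zeros_step:
  "2 * insert_zeros P x t \<le> insert_zeros P x (Suc t)"
  "insert_zeros P x (Suc t) + 1 \<le> 2 * (insert_zeros P x t + 1)"
  using binary_digit[of "2 ^ free_count P t * x"] by (auto simp: mult.assoc)

lemma insert_zeros_lower: "insert_zeros P x t * 2 ^ k \<le> insert_zeros P x (t + k)"
proof (induction k)
  case (Suc k)
  then show ?case using insert_zeros_step(1)[of P x "t + k"] by simp
qed simp

lemma insert_zeros_upper: "insert_zeros P x (t + k) + 1 \<le> (insert_zeros P x t + 1) * 2 ^ k"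
proof (induction k)
  case (Suc k)
  then show ?case using insert_zeros_step(2)[of P x "t + k"] by (simp add: algebra_simps)
qed simp

lemma insert_zeros_div_lower: "t \<le> u \<Longrightarrow> insert_zeros P x t / 2 ^ t \<le> insert_zeros P x u / (2 ^ u :: real)"
proof -
  assume "t \<le> u"
  then obtain k where u: "u = t + k" using le_Suc_ex by blast
  have "real_of_int (insert_zeros P x t * 2 ^ k) \<le> insert_zeros P x (t + k)"
    using insert_zeros_lower by (subst of_int_le_iff)
  then show ?thesis by (simp add: u power_add field_simps)
qed

lemma insert_zeros_div_upper: "insert_zeros P x u / 2 ^ u \<le> (insert_zeros P x t + 1) / (2 ^ t :: real)"
proof (cases "t \<le> u")
  case True
  then obtain k where u: "u = t + k" using le_Suc_ex by blast
  have "real_of_int (insert_zeros P x (t + k) + 1) \<le> real_of_int ((insert_zeros P x t + 1) * 2 ^ k)"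
    using insert_zeros_upper by (subst of_int_le_iff)
  then have "insert_zeros P x u \<le> (real_of_int (insert_zeros P x t) + 1) * 2 ^ k"
    by (simp add: u)
  then show ?thesis by (simp add: u power_add field_simps)
next
  case False
  then have "insert_zeros P x u / 2 ^ u \<le> insert_zeros P x t / (2 ^ t :: real)"
    by (intro insert_zeros_div_lower) auto
  also have "\<dots> \<le> (insert_zeros P x t + 1) / 2 ^ t" by (simp add: divide_right_mono)
  finally show ?thesis .
qed

lemma cantor_map_lower: "insert_zeros P x t / 2 ^ t \<le> cantor_map P x"
  unfolding cantor_map_def
  by (intro cSUP_upper bdd_aboveI2[where M="(insert_zeros P x 0 + 1) / 2 ^ 0"] insert_zeros_div_upper) auto

lemma cantor_map_le: "cantor_map P x \<le> (insert_zeros P x t + 1) / 2 ^ t"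
  unfolding cantor_map_def by (intro cSUP_least insert_zeros_div_upper) auto

text \<open>Strictness excludes expansions ending in ones: a forced zero beyond position
  \<open>t\<close> leaves room below the right end point of the dyadic interval. This is what allows
  \<open>floor_cantor_map\<close> to read off the digits exactly.\<close>

lemma cantor_map_upper:
  assumes "infinite P"
  shows "cantor_map P x < (insert_zeros P x t + 1) / 2 ^ t"
proof -
  obtain u where u: "u \<in> P" "u > t" using assms by (meson infinite_nat_iff_unbounded)
  then obtain k where k: "u = Suc (t + k)" using less_imp_Suc_add by metis
  have "insert_zeros P x u + 1 < 2 * ((insert_zeros P x (t + k)) + 1)"
    using u by (simp add: k)
  also have "\<dots> \<le> 2 * ((insert_zeros P x t + 1) * 2 ^ k)" using insert_zeros_upper[of P x t k] by simp
  finally have "real_of_int (insert_zeros P x u + 1) < real_of_int (2 * ((insert_zeros P x t + 1) * 2 ^ k))"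
    by (subst of_int_less_iff)
  then have "real_of_int (insert_zeros P x u) + 1 < 2 * ((real_of_int (insert_zeros P x t) + 1) * 2 ^ k)"
    by (simp only: of_int_add of_int_mult of_int_power of_int_numeral of_int_1)
  then have "(real_of_int (insert_zeros P x u) + 1) / 2 ^ u < 2 * ((real_of_int (insert_zeros P x t) + 1) * 2 ^ k) / 2 ^ u"
    by (intro divide_strict_right_mono) simp_all
  also have "\<dots> = (insert_zeros P x t + 1) / (2 ^ t :: real)"
    by (simp add: k power_add del: insert_zeros.simps)
  finally have "(insert_zeros P x u + 1) / (2 ^ u :: real) < (insert_zeros P x t + 1) / 2 ^ t"
    by (simp del: insert_zeros.simps)
  with cantor_map_le[of P x u] show ?thesis by linarith
qed

lemma floor_cantor_map:
  assumes "infinite P"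
  shows "\<lfloor>2 ^ t * cantor_map P x\<rfloor> = insert_zeros P x t"
  using cantor_map_lower[of P x t] cantor_map_upper[OF assms, of x t]
  by (intro floor_unique) (simp_all add: field_simps)

lemma cantor_map_range:
  assumes "infinite P"
  shows "0 \<le> cantor_map P x" "cantor_map P x < 1"
  using cantor_map_lower[of P x 0] cantor_map_upper[OF assms, of x 0] by simp_all

lemma insert_zeros_forced:
  assumes "\<And>u. v < u \<Longrightarrow> u \<le> w \<Longrightarrow> u \<in> P" "v \<le> w"
  shows "insert_zeros P x w = 2 ^ (w - v) * insert_zeros P x v"
  using assms(2,1)
proof (induction w rule: dec_induct)
  case (step w)
  then show ?case by (simp add: Suc_diff_le)
qed simp

text \<open>Follow the difference of two prefixes digit by digit. At a free position both sides are
  doubled and receive the same difference of digits; at a forced position the left side stays while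
  the right side, nonnegative by induction, is doubled.\<close>

lemma insert_zeros_expands:
  assumes "0 \<le> x" "x < 1" "0 \<le> y" "y < 1" "\<lfloor>2 ^ free_count P t * x\<rfloor> \<le> \<lfloor>2 ^ free_count P t * y\<rfloor>"
  shows "\<lfloor>2 ^ free_count P t * y\<rfloor> - \<lfloor>2 ^ free_count P t * x\<rfloor> \<le> insert_zeros P y t - insert_zeros P x t"
  using assms(5)
proof (induction t)
  case 0
  then show ?case using assms(1-4) floor_unique[of 0 x] floor_unique[of 0 y] by simp
next
  case (Suc t)
  let ?X = "\<lfloor>2 ^ free_count P t * x\<rfloor>" and ?Y = "\<lfloor>2 ^ free_count P t * y\<rfloor>"
  show ?case
  proof (cases "Suc t \<in> P")
    case True
    then show ?thesis using Suc by (simp add: free_count_Suc)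
  next
    case False
    define a where "a = \<lfloor>2 ^ Suc (free_count P t) * x\<rfloor>"
    define b where "b = \<lfloor>2 ^ Suc (free_count P t) * y\<rfloor>"
    have ab: "a - 2 * ?X \<in> {0,1}" "b - 2 * ?Y \<in> {0,1}"
      using binary_digit[of "2 ^ free_count P t * x"] binary_digit[of "2 ^ free_count P t * y"]
      by (simp_all add: a_def b_def mult.assoc)
    have "a \<le> b" using Suc.prems False by (simp add: free_count_Suc a_def b_def)
    then have "?X \<le> ?Y" using ab by auto
    then have "?Y - ?X \<le> insert_zeros P y t - insert_zeros P x t" by (rule Suc.IH)
    then have "b - a \<le> insert_zeros P y (Suc t) - insert_zeros P x (Suc t)"
      using False by (simp add: a_def[symmetric] b_def[symmetric] del: power_Suc)
    then show ?thesis using False by (simp add: free_count_Suc a_def b_def)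
  qed
qed

text \<open>If the prefixes of \<open>x\<close> and \<open>y\<close> of length
  \<open>free_count P t\<close> were integers at least 2 apart, so would be the prefixes after
  insertion, and a full dyadic interval of length 2^(-t) would separate the images. Prefixes at most
  1 apart give a distance of at most two units.\<close>

lemma cantor_map_dist_step:
  assumes P: "infinite P" and xy: "0 \<le> x" "x < 1" "0 \<le> y" "y < 1"
    and d: "\<bar>cantor_map P x - cantor_map P y\<bar> < 1 / 2 ^ t"
  shows "\<bar>x - y\<bar> \<le> 2 / 2 ^ free_count P t"
proof -
  have *: "y - x \<le> 2 / 2 ^ free_count P t"
    if "0 \<le> x" "x < 1" "0 \<le> y" "y < 1" "\<bar>cantor_map P x - cantor_map P y\<bar> < 1 / 2 ^ t" for x y
  proof -
    have "\<lfloor>2 ^ free_count P t * y\<rfloor> \<le> \<lfloor>2 ^ free_count P t * x\<rfloor> + 1"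
    proof (rule ccontr)
      assume n: "\<not> ?thesis"
      then have "insert_zeros P x t + 2 \<le> insert_zeros P y t"
        using insert_zeros_expands[OF that(1-4), of P t] by linarith
      then have "real_of_int (insert_zeros P x t + 2) \<le> insert_zeros P y t" by (subst of_int_le_iff)
      then have "(insert_zeros P x t + 1) / 2 ^ t + 1 / 2 ^ t \<le> insert_zeros P y t / (2 ^ t :: real)"
        unfolding add_divide_distrib[symmetric] by (intro divide_right_mono) auto
      then show False
        using cantor_map_lower[of P y t] cantor_map_upper[OF P, of x t] that(5) by linarith
    qed
    then have "2 ^ free_count P t * y \<le> 2 ^ free_count P t * x + 2" by linarith
    then show ?thesis by (simp add: field_simps)
  qed
  from *[OF xy d] *[of y x] xy d show ?thesis by (simp add: abs_le_iff abs_minus_commute)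
qed

text \<open>For images at distance r > 0 take t with 2^(-t-1) \<le> r < 2^(-t); at least \<tau> t
  digits are free by then. The constant 4 is the 2 of \<open>cantor_map_dist_step\<close> times
  2^\<tau> \<le> 2 from rounding r to a power of two.\<close>

lemma cantor_map_expands:
  assumes P: "infinite P" and free: "\<And>t. \<tau> * real t \<le> real (free_count P t)" and \<tau>: "0 < \<tau>" "\<tau> \<le> 1"
    and xy: "0 \<le> x" "x < 1" "0 \<le> y" "y < 1"
  shows "\<bar>x - y\<bar> \<le> 4 * \<bar>cantor_map P x - cantor_map P y\<bar> powr \<tau>"
proof -
  define r where "r = \<bar>cantor_map P x - cantor_map P y\<bar>"
  have step: "\<bar>x - y\<bar> \<le> 2 * (1 / 2 ^ t) powr \<tau>" if "r < 1 / 2 ^ t" for t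
  proof -
    have "\<bar>x - y\<bar> \<le> 2 / 2 ^ free_count P t"
      using that by (intro cantor_map_dist_step[OF P xy]) (simp add: r_def)
    also have "\<dots> = 2 * 2 powr (- real (free_count P t))"
      by (simp add: powr_minus powr_realpow field_simps)
    also have "\<dots> \<le> 2 * 2 powr (- (\<tau> * real t))" using free[of t] by simp
    also have "2 powr (- (\<tau> * real t)) = (1 / 2 ^ t) powr \<tau>"
      by (simp add: powr_minus powr_realpow[symmetric] powr_divide powr_powr mult.commute field_simps)
    finally show ?thesis .
  qed
  show ?thesis
  proof (cases "r = 0")
    \<comment> \<open>Since \<open>0 powr \<tau> = 0\<close>, injectivity has to be proved here:
      every t is admissible, and t tends to infinity.\<close>
    case True
    have "(\<lambda>t. 2 * (1 / 2 ^ t) powr \<tau>) \<longlonglongrightarrow> 0" using \<tau>(1) by real_asymp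
    then have "\<bar>x - y\<bar> \<le> 0"
      using step True by (intro LIMSEQ_le_const[where X="\<lambda>t. 2 * (1 / 2 ^ t) powr \<tau>"]) auto
    then show ?thesis by simp
  next
    case False
    then have r: "0 < r" "r < 1"
      using cantor_map_range[OF P, of x] cantor_map_range[OF P, of y] by (auto simp: r_def)
    define n where "n = (LEAST n. 1 / 2 ^ n \<le> r)"
    have "\<exists>n. (1 / 2) ^ n < r" using r by (intro real_arch_pow_inv) auto
    then have "\<exists>n. 1 / 2 ^ n \<le> r" by (auto simp: power_divide intro: less_imp_le)
    then have n: "1 / 2 ^ n \<le> r" unfolding n_def by (rule LeastI_ex)
    then have "n \<noteq> 0" using r by (intro notI) simp
    then obtain t where t: "n = Suc t" using not0_implies_Suc by blast
    have "\<not> 1 / 2 ^ t \<le> r" using not_less_Least[of t "\<lambda>n. 1 / 2 ^ n \<le> r"] by (simp add: n_def[symmetric] t)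
    then have "\<bar>x - y\<bar> \<le> 2 * (1 / 2 ^ t) powr \<tau>" by (intro step) simp
    also have "\<dots> \<le> 2 * (2 * r) powr \<tau>"
      using n \<tau> by (intro mult_left_mono powr_mono2) (auto simp: t field_simps)
    also have "\<dots> \<le> 2 * (2 powr 1 * r powr \<tau>)"
    proof -
      have "2 powr \<tau> \<le> (2::real) powr 1" using \<tau> by (intro powr_mono) auto
      then show ?thesis using r by (simp add: powr_mult mult_right_mono)
    qed
    finally show ?thesis by (simp add: r_def)
  qed
qed

text \<open>Let p be the last forced position up to t and n its block. Counting everything up to
  \<open>w n\<close> as forced, at most w n + (p + h - v n) positions up to p are forced. The
  hypothesis on \<open>v\<close> together with p + h \<le> w (n + 1) leaves at least \<tau> p free
  ones, and all positions from p + 1 to t are free. The shift \<open>h\<close> stands for the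
  leading digits that fix the cube in which the construction is placed.\<close>

lemma free_count_lacunary:
  fixes w :: "nat \<Rightarrow> nat"
  assumes \<tau>: "0 \<le> \<tau>" "\<tau> \<le> 1" and w: "mono w"
    and v: "\<And>n. \<tau> * real (w (Suc n)) + real (w n) + real h \<le> real (v n)"
    and P: "P = {p. \<exists>n. v n < p + h \<and> p + h \<le> w (Suc n)}"
  shows "\<tau> * real t \<le> real (free_count P t)"
proof (cases "P \<inter> {1..t} = {}")
  case True
  then have "{1..t} - P = {1..t}" by auto
  then have "free_count P t = t" by (simp add: free_count_def)
  then show ?thesis using \<tau> by (simp add: mult_left_le_one_le)
next
  case False
  define p where "p = Max (P \<inter> {1..t})"
  have p: "p \<in> P" "1 \<le> p" "p \<le> t" using Max_in[of "P \<inter> {1..t}"] False by (auto simp: p_def)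
  have le_p: "p' \<le> p" if "p' \<in> P" "1 \<le> p'" "p' \<le> t" for p'
    using that unfolding p_def by (intro Max_ge) auto
  obtain n where n: "v n < p + h" "p + h \<le> w (Suc n)" using p P by blast
  have vw: "w n + h \<le> v n" for n
  proof -
    have "real (w n + h) \<le> real (v n)" using v[of n] \<tau> by (simp add: add.assoc) (smt (verit) mult_nonneg_nonneg of_nat_0_le_iff)
    then show ?thesis by linarith
  qed
  have "P \<inter> {1..t} \<subseteq> {1..w n} \<union> {Suc (v n - h)..p}"
  proof
    fix p' assume p': "p' \<in> P \<inter> {1..t}"
    then obtain n' where n': "v n' < p' + h" "p' + h \<le> w (Suc n')" using P by blast
    have "p' \<le> p" using le_p p' by auto
    consider "n' < n" | "n' = n" | "n < n'" by linarith
    then show "p' \<in> {1..w n} \<union> {Suc (v n - h)..p}"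
    proof cases
      case 1
      then have "w (Suc n') \<le> w n" using w by (simp add: monoD)
      then show ?thesis using n' p' by auto
    next
      case 2
      then show ?thesis using n' p' \<open>p' \<le> p\<close> by auto
    next
      case 3
      then have "w (Suc n) \<le> w n'" using w by (simp add: monoD)
      then show ?thesis using n' n vw[of n'] \<open>p' \<le> p\<close> by linarith
    qed
  qed
  then have "card (P \<inter> {1..t}) \<le> card ({1..w n} \<union> {Suc (v n - h)..p})"
    by (intro card_mono) auto
  also have "\<dots> \<le> w n + (p - (v n - h))"
    using card_Un_le[of "{1..w n}" "{Suc (v n - h)..p}"] by simp
  finally have c: "real (card (P \<inter> {1..t})) \<le> real (w n) + real p + real h - real (v n)"
    using n vw[of n] by linarith
  have "free_count P t = t - card (P \<inter> {1..t})"
    by (simp add: free_count_def card_Diff_subset_Int Int_commute)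
  moreover have "card (P \<inter> {1..t}) \<le> card {1..t}" by (intro card_mono) auto
  ultimately have "real (free_count P t) = real t - real (card (P \<inter> {1..t}))" by simp
  moreover have "\<tau> * real p \<le> \<tau> * real (w (Suc n))" using n \<tau> by (intro mult_left_mono) auto
  ultimately have "real t - real p + \<tau> * real p \<le> real (free_count P t)" using c v[of n] by linarith
  moreover have "(1 - \<tau>) * real p \<le> (1 - \<tau>) * real t" using p \<tau> by (intro mult_left_mono) auto
  ultimately show ?thesis by (simp add: algebra_simps)
qed

section \<open>Cantor sets of points close to dyadic corners along lacunary blocks of scales\<close>

lemma small_dyadic_cube:
  fixes B :: "(real ^ 'd::finite) set"
  assumes "open B" "B \<noteq> {}"
  obtains h :: nat and k :: "int ^ 'd" where
    "\<And>z. (\<And>c. 0 \<le> z $ c \<and> z $ c < 1) \<Longrightarrow> (\<chi> c. (real_of_int (k $ c) + z $ c) / 2 ^ h) \<in> B"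
proof -
  obtain b where "b \<in> B" using assms(2) by blast
  then obtain e where e: "0 < e" "ball b e \<subseteq> B" using assms(1) open_contains_ball by blast
  obtain h where h: "(1 / 2) ^ h < e / real CARD('d)"
    using real_arch_pow_inv[of "e / real CARD('d)" "1/2"] e by auto
  define k :: "int ^ 'd" where "k = (\<chi> c. \<lfloor>2 ^ h * b $ c\<rfloor>)"
  show thesis
  proof (rule that[of k h])
    fix z :: "real ^ 'd" assume z: "\<And>c. 0 \<le> z $ c \<and> z $ c < 1"
    let ?y = "\<chi> c. (real_of_int (k $ c) + z $ c) / 2 ^ h"
    have "\<bar>b $ c - ?y $ c\<bar> \<le> (1 / 2) ^ h" for c
    proof -
      have "\<bar>2 ^ h * b $ c - (real_of_int (k $ c) + z $ c)\<bar> \<le> 1"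
        using z[of c] unfolding k_def by (simp add: abs_le_iff) linarith
      moreover have "b $ c - ?y $ c = (2 ^ h * b $ c - (real_of_int (k $ c) + z $ c)) / 2 ^ h"
        by (simp add: diff_divide_distrib)
      ultimately show ?thesis by (simp add: power_divide divide_right_mono)
    qed
    then have "(\<Sum>c\<in>UNIV. \<bar>(b - ?y) $ c\<bar>) \<le> (\<Sum>c\<in>(UNIV::'d set). (1 / 2) ^ h)"
      by (intro sum_mono) auto
    then have "norm (b - ?y) \<le> real CARD('d) * (1 / 2) ^ h"
      using norm_le_l1_cart[of "b - ?y"] by simp
    also have "\<dots> < e" using h by (simp add: field_simps)
    finally show "?y \<in> B" using e by (auto simp: dist_norm)
  qed
qed

text \<open>With J = (n + 1) j, each of \<tau> T J, T j^2, T j and 1 is at most Y = T J^2 / (n + 1),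
  which gives the 4, and h \<le> h Y. Thus the width of a block and all that precedes it weigh only
  O(1/n) against T J^2.\<close>

lemma fact_block_bound:
  fixes T h n :: nat and \<tau> :: real
  assumes "1 \<le> T" "0 \<le> \<tau>" "\<tau> \<le> 1"
  defines "J \<equiv> fact (Suc n) :: nat" and "j \<equiv> fact n :: nat"
  shows "\<tau> * real (T * (J\<^sup>2 + J)) + 1 + real (T * (j\<^sup>2 + j)) + real h
    \<le> (\<tau> + (4 + real h) / real (Suc n)) * real (T * J\<^sup>2)"
proof -
  define Y where "Y = real (T * J\<^sup>2) / real (Suc n)"
  have Jj: "J = Suc n * j" by (simp add: J_def j_def)
  have j1: "1 \<le> j" by (simp add: j_def)
  have JY: "real (T * J\<^sup>2) = real (Suc n) * Y" by (simp add: Y_def)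
  have Y: "Y = real T * real (Suc n) * (real j)\<^sup>2"
    unfolding Y_def Jj by (simp add: power2_eq_square del: of_nat_Suc mult_Suc)
  have TJ: "real (T * J) \<le> Y"
  proof -
    have "real j \<le> (real j)\<^sup>2" using j1 by (simp add: power2_eq_square)
    then have "real T * real (Suc n) * real j \<le> real T * real (Suc n) * (real j)\<^sup>2"
      by (intro mult_left_mono) auto
    then show ?thesis unfolding Y Jj of_nat_mult by (simp only: mult.assoc)
  qed
  have Tj2: "real (T * j\<^sup>2) \<le> Y"
  proof -
    have "real T * (real j)\<^sup>2 * 1 \<le> real T * (real j)\<^sup>2 * real (Suc n)" by (intro mult_left_mono) auto
    then show ?thesis unfolding Y by (simp add: algebra_simps)
  qed
  have "j \<le> j\<^sup>2" using j1 by (simp add: power2_eq_square)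
  then have "T * j \<le> T * j\<^sup>2" by simp
  then have "real (T * j) \<le> real (T * j\<^sup>2)" by (rule of_nat_mono)
  then have Tj: "real (T * j) \<le> Y" using Tj2 by linarith
  have "1 * 1 \<le> T * j\<^sup>2" using assms(1) j1 by (intro mult_mono) (auto simp: power2_eq_square)
  then have "1 \<le> real (T * j\<^sup>2)" by linarith
  then have one: "1 \<le> Y" using Tj2 by linarith
  have "real h * 1 \<le> real h * Y" using one by (intro mult_left_mono) auto
  moreover have "\<tau> * real (T * J) \<le> 1 * Y" using TJ assms one by (intro mult_mono) auto
  moreover have "\<tau> * real (T * (J\<^sup>2 + J)) = \<tau> * real (T * J\<^sup>2) + \<tau> * real (T * J)"
    by (simp add: algebra_simps)
  moreover have "real (T * (j\<^sup>2 + j)) = real (T * j\<^sup>2) + real (T * j)" by (simp add: algebra_simps)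
  ultimately have "\<tau> * real (T * (J\<^sup>2 + J)) + 1 + real (T * (j\<^sup>2 + j)) + real h
      \<le> \<tau> * real (T * J\<^sup>2) + (4 + real h) * Y"
    using one Tj Tj2 by (simp add: algebra_simps)
  also have "\<dots> = (\<tau> + (4 + real h) / real (Suc n)) * real (T * J\<^sup>2)"
    by (simp add: Y_def algebra_simps)
  finally show ?thesis .
qed

text \<open>In each coordinate the first h fractional digits of the image select a dyadic cube
  inside \<open>B\<close>; the later ones are the digits of x with zeros inserted at the absolute
  places from v n + 1 to w (n + 1). As soon as v n \<le> T J^2 with J = (n + 1)!, these zeros span
  the scales T m with J^2 \<le> m < J^2 + J, and the cubes of these scales have corners in 2^(-v n)
  Z^d.\<close>

lemma dyadically_approximable_cantor_set:
  fixes B :: "(real ^ 'd::finite) set" and \<tau> :: real and T :: nat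
  assumes B: "open B" "B \<noteq> {}" and \<tau>: "0 \<le> \<tau>" "\<tau> < 1" and T: "1 \<le> T"
  defines "Q \<equiv> {x :: real ^ 'd. \<forall>c. 0 \<le> x $ c \<and> x $ c < 1}"
  shows "\<exists>(\<phi> :: real ^ 'd \<Rightarrow> real ^ 'd) C. 0 \<le> C \<and> \<phi> ` Q \<subseteq> B \<and>
    (\<forall>x\<in>Q. \<forall>y\<in>Q. \<forall>c. 0 < \<tau> \<longrightarrow> \<bar>x $ c - y $ c\<bar> \<le> C * dist (\<phi> x) (\<phi> y) powr \<tau>) \<and>
    (\<forall>x\<in>Q. \<forall>\<epsilon>>0. \<exists>\<^sub>F J in sequentially. \<exists>v. real v \<le> (\<tau> + \<epsilon>) * real (T * J\<^sup>2) \<and>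
      (\<forall>m. J\<^sup>2 \<le> m \<longrightarrow> m < J\<^sup>2 + J \<longrightarrow> v \<le> T * m \<and> (\<forall>c. 2 ^ (T * m - v) dvd \<lfloor>2 ^ (T * m) * \<phi> x $ c\<rfloor>)))"
proof -
  obtain h :: nat and k :: "int ^ 'd" where
    hk: "\<And>z. (\<And>c. 0 \<le> z $ c \<and> z $ c < 1) \<Longrightarrow> (\<chi> c. (real_of_int (k $ c) + z $ c) / 2 ^ h) \<in> B"
    using small_dyadic_cube[OF B] by blast
  define w where "w n = T * ((fact n)\<^sup>2 + fact n)" for n :: nat
  \<comment> \<open>Up to rounding, this is the earliest start of the zeros that
    \<open>free_count_lacunary\<close> permits.\<close>
  define v where "v n = nat \<lceil>\<tau> * real (w (Suc n))\<rceil> + w n + h" for n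
  define P where "P = {p. \<exists>n. v n < p + h \<and> p + h \<le> w (Suc n)}"
  have v_le: "real (v n) \<le> (\<tau> + (4 + real h) / real (Suc n)) * real (T * (fact (Suc n))\<^sup>2)" for n
  proof -
    have "real (nat \<lceil>\<tau> * real (w (Suc n))\<rceil>) \<le> \<tau> * real (w (Suc n)) + 1"
      using \<tau> by (simp add: of_nat_nat)
    then have "real (v n) \<le> \<tau> * real (w (Suc n)) + 1 + real (w n) + real h"
      by (simp add: v_def)
    also have "\<dots> \<le> (\<tau> + (4 + real h) / real (Suc n)) * real (T * (fact (Suc n))\<^sup>2)"
      unfolding w_def using fact_block_bound[OF T \<tau>(1) less_imp_le[OF \<tau>(2)], of n h] by simp
    finally show ?thesis .
  qed
  have lim: "(\<lambda>n. (4 + real h) / real (Suc n)) \<longlonglongrightarrow> 0" by real_asymp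
  have v_eps: "\<forall>\<^sub>F n in sequentially. real (v n) \<le> (\<tau> + \<epsilon>) * real (T * (fact (Suc n))\<^sup>2)" if "0 < \<epsilon>" for \<epsilon>
    using order_tendstoD(2)[OF lim that]
  proof eventually_elim
    case (elim n)
    have "(\<tau> + (4 + real h) / real (Suc n)) * real (T * (fact (Suc n))\<^sup>2) \<le> (\<tau> + \<epsilon>) * real (T * (fact (Suc n))\<^sup>2)"
      using elim by (intro mult_right_mono) auto
    then show ?case using v_le[of n] by linarith
  qed
  \<comment> \<open>Here \<tau> < 1 enters: with \<epsilon> = 1 - \<tau> the zeros start no later
    than the first scale of the block.\<close>
  have v_small: "\<forall>\<^sub>F n in sequentially. v n \<le> T * (fact (Suc n))\<^sup>2"
    using v_eps[of "1 - \<tau>"] \<tau>(2) by (auto elim!: eventually_mono simp del: of_nat_mult of_nat_fact of_nat_power)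
  have n_le_w: "n \<le> w n" for n
  proof -
    have "n \<le> fact n" by (rule fact_ge_self)
    also have "\<dots> \<le> 1 * ((fact n)\<^sup>2 + fact n)" by simp
    also have "\<dots> \<le> w n" unfolding w_def using T by (intro mult_le_mono1) auto
    finally show ?thesis .
  qed
  have vw: "T * (fact (Suc n))\<^sup>2 < w (Suc n)" for n using T by (simp add: w_def)
  have infP: "infinite P"
    unfolding infinite_nat_iff_unbounded_le
  proof
    fix m
    obtain n where n: "n \<ge> m + h" "v n \<le> T * (fact (Suc n))\<^sup>2"
      using v_small unfolding eventually_sequentially by (meson nle_le)
    have "Suc n \<le> w (Suc n)" by (rule n_le_w)
    then have "w (Suc n) - h \<in> P" "m \<le> w (Suc n) - h"
      using n vw[of n] by (auto simp: P_def intro!: exI[of _ n])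
    then show "\<exists>n\<ge>m. n \<in> P" by blast
  qed
  have monow: "mono w"
    unfolding w_def by (intro monoI mult_le_mono2 add_mono power_mono fact_mono) auto
  have free: "\<tau> * real t \<le> real (free_count P t)" for t
  proof (rule free_count_lacunary[OF \<tau>(1) less_imp_le[OF \<tau>(2)] monow _ P_def])
    fix n
    have "\<tau> * real (w (Suc n)) \<le> real (nat \<lceil>\<tau> * real (w (Suc n))\<rceil>)" by (rule real_nat_ceiling_ge)
    then show "\<tau> * real (w (Suc n)) + real (w n) + real h \<le> real (v n)" by (simp add: v_def)
  qed
  define \<rho> where "\<rho> = cantor_map P"
  define \<phi> :: "real ^ 'd \<Rightarrow> real ^ 'd" where "\<phi> x = (\<chi> c. (real_of_int (k $ c) + \<rho> (x $ c)) / 2 ^ h)" for x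
  have \<rho>: "0 \<le> \<rho> t" "\<rho> t < 1" for t
    using cantor_map_range[OF infP] by (simp_all add: \<rho>_def)
  show ?thesis
  proof (intro exI[of _ \<phi>] exI[of _ "4 * (2 ^ h) powr \<tau>"] conjI ballI allI impI)
    show "\<phi> ` Q \<subseteq> B" using hk[of "\<chi> c. \<rho> (x $ c)" for x :: "real ^ 'd"] \<rho> by (auto simp: \<phi>_def)
  next
    fix x y c assume xy: "x \<in> Q" "y \<in> Q" and "0 < \<tau>"
    then have "\<bar>x $ c - y $ c\<bar> \<le> 4 * \<bar>\<rho> (x $ c) - \<rho> (y $ c)\<bar> powr \<tau>"
      using \<tau> unfolding \<rho>_def by (intro cantor_map_expands[OF infP free]) (auto simp: Q_def)
    also have "\<bar>\<rho> (x $ c) - \<rho> (y $ c)\<bar> = 2 ^ h * \<bar>\<phi> x $ c - \<phi> y $ c\<bar>"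
      by (simp add: \<phi>_def diff_divide_distrib[symmetric])
    also have "4 * (2 ^ h * \<bar>\<phi> x $ c - \<phi> y $ c\<bar>) powr \<tau> \<le> 4 * (2 ^ h * dist (\<phi> x) (\<phi> y)) powr \<tau>"
      using \<tau> component_le_norm_cart[of "\<phi> x - \<phi> y" c]
      by (intro mult_left_mono powr_mono2) (auto simp: dist_norm)
    finally show "\<bar>x $ c - y $ c\<bar> \<le> 4 * (2 ^ h) powr \<tau> * dist (\<phi> x) (\<phi> y) powr \<tau>"
      by (simp add: powr_mult)
  next
    fix x and \<epsilon> :: real assume "x \<in> Q" "0 < \<epsilon>"
    have "\<forall>\<^sub>F n in sequentially. real (v n) \<le> (\<tau> + \<epsilon>) * real (T * (fact (Suc n))\<^sup>2) \<and> v n \<le> T * (fact (Suc n))\<^sup>2"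
      using v_eps[OF \<open>0 < \<epsilon>\<close>] v_small by (rule eventually_conj)
    then obtain n0 where n0: "\<And>n. n \<ge> n0 \<Longrightarrow> real (v n) \<le> (\<tau> + \<epsilon>) * real (T * (fact (Suc n))\<^sup>2) \<and> v n \<le> T * (fact (Suc n))\<^sup>2"
      unfolding eventually_sequentially by blast
    show "\<exists>\<^sub>F J in sequentially. \<exists>v. real v \<le> (\<tau> + \<epsilon>) * real (T * J\<^sup>2) \<and>
        (\<forall>m. J\<^sup>2 \<le> m \<longrightarrow> m < J\<^sup>2 + J \<longrightarrow> v \<le> T * m \<and> (\<forall>c. 2 ^ (T * m - v) dvd \<lfloor>2 ^ (T * m) * \<phi> x $ c\<rfloor>))"
      unfolding frequently_sequentially
    proof
      fix N
      define n where "n = max N n0"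
      define J :: nat where "J = fact (Suc n)"
      have "Suc n \<le> J" unfolding J_def by (rule fact_ge_self)
      then have "N \<le> J" by (simp add: n_def)
      have vn: "real (v n) \<le> (\<tau> + \<epsilon>) * real (T * J\<^sup>2)" "v n \<le> T * J\<^sup>2"
        using n0[of n] by (auto simp: n_def J_def simp del: fact_Suc)
      have "v n \<le> T * m \<and> (\<forall>c. 2 ^ (T * m - v n) dvd \<lfloor>2 ^ (T * m) * \<phi> x $ c\<rfloor>)" if m: "J\<^sup>2 \<le> m" "m < J\<^sup>2 + J" for m
      proof (intro conjI allI)
        have "T * J\<^sup>2 \<le> T * m" using m by simp
        then show vm: "v n \<le> T * m" using vn by linarith
        have mw: "T * m \<le> w (Suc n)" using m unfolding w_def J_def by (intro mult_le_mono2) simp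
        have hv: "h \<le> v n" by (simp add: v_def)
        fix c
        let ?a = "v n - h" and ?b = "T * m - h"
        have "insert_zeros P (x $ c) ?b = 2 ^ (?b - ?a) * insert_zeros P (x $ c) ?a"
        proof (rule insert_zeros_forced)
          fix u assume "v n - h < u" "u \<le> T * m - h"
          then show "u \<in> P" using mw vm hv unfolding P_def by (intro CollectI exI[of _ n]) linarith
        qed (use vm in simp)
        moreover have "?b - ?a = T * m - v n" using hv vm by linarith
        ultimately have "2 ^ (T * m - v n) dvd insert_zeros P (x $ c) ?b" by simp
        moreover have "2 ^ (T * m - v n) dvd (2 ^ ?b :: int)" using hv by (intro le_imp_power_dvd) linarith
        moreover have "\<lfloor>2 ^ (T * m) * \<phi> x $ c\<rfloor> = 2 ^ ?b * k $ c + insert_zeros P (x $ c) ?b"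
        proof -
          have "(2::real) ^ (T * m) = 2 ^ ?b * 2 ^ h" using hv vm by (simp add: power_add[symmetric])
          then have "2 ^ (T * m) * \<phi> x $ c = of_int (2 ^ ?b * k $ c) + 2 ^ ?b * \<rho> (x $ c)"
            by (simp add: \<phi>_def) (simp add: algebra_simps)
          then show ?thesis using floor_cantor_map[OF infP, of ?b "x $ c"]
            by (simp only: \<rho>_def int_add_floor[symmetric])
        qed
        ultimately show "2 ^ (T * m - v n) dvd \<lfloor>2 ^ (T * m) * \<phi> x $ c\<rfloor>" by simp
      qed
      then show "\<exists>J\<ge>N. \<exists>v. real v \<le> (\<tau> + \<epsilon>) * real (T * J\<^sup>2) \<and>
        (\<forall>m. J\<^sup>2 \<le> m \<longrightarrow> m < J\<^sup>2 + J \<longrightarrow> v \<le> T * m \<and> (\<forall>c. 2 ^ (T * m - v) dvd \<lfloor>2 ^ (T * m) * \<phi> x $ c\<rfloor>))"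
        using \<open>N \<le> J\<close> vn by blast
    qed
  qed simp
qed

section \<open>The sequence space and its topology\<close>

text \<open>The inner norm over positions and the outer norm over scales are both instances, so the
  quasi-norm facts are proved once, including infinite exponents.\<close>

definition ell_finite :: "ereal \<Rightarrow> ('a \<Rightarrow> real) \<Rightarrow> bool" where
  "ell_finite r f \<longleftrightarrow> (if r = \<infinity> then bdd_above (range f) else (\<lambda>x. f x powr real_of_ereal r) summable_on UNIV)"

definition ell_norm :: "ereal \<Rightarrow> ('a \<Rightarrow> real) \<Rightarrow> real" where
  "ell_norm r f = (if r = \<infinity> then (SUP x. f x)
     else infsum (\<lambda>x. f x powr real_of_ereal r) UNIV powr (1 / real_of_ereal r))"

lemma real_of_ereal_pos_finite:
  assumes "0 < r" "r \<noteq> \<infinity>"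
  shows "0 < real_of_ereal r"
  using assms by (cases r) auto

lemma le_ell_norm:
  assumes "0 < r" "ell_finite r f" "\<And>x. 0 \<le> f x"
  shows "f x \<le> ell_norm r f"
proof (cases "r = \<infinity>")
  case True
  then show ?thesis using assms by (auto simp: ell_finite_def ell_norm_def intro: cSUP_upper)
next
  case False
  let ?r = "real_of_ereal r"
  have r: "0 < ?r" using assms(1) False by (rule real_of_ereal_pos_finite)
  have "(\<Sum>x\<in>{x}. f x powr ?r) \<le> infsum (\<lambda>x. f x powr ?r) UNIV"
    using assms False by (intro finite_sum_le_infsum) (auto simp: ell_finite_def)
  then have "(f x powr ?r) powr (1 / ?r) \<le> infsum (\<lambda>x. f x powr ?r) UNIV powr (1 / ?r)"
    using r by (intro powr_mono2) auto
  then show ?thesis using r assms(3)[of x] False by (simp add: powr_powr ell_norm_def)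
qed

lemma ell_norm_nonneg: "(\<And>x. 0 \<le> f x) \<Longrightarrow> ell_finite r f \<Longrightarrow> 0 \<le> ell_norm r f"
  by (auto simp: ell_norm_def ell_finite_def intro: cSUP_upper2)

text \<open>For exponents below 1 there is only a quasi-triangle inequality, and a crude one
  suffices: (a + b)^t \<le> 2^t (a^t + b^t) is applied with t = r and with t = 1/r. At r =
  \<infinity> the power of 2 is 2^0, because \<open>1 / real_of_ereal \<infinity> = 0\<close>. The
  function \<open>h\<close> is only dominated by a multiple of the sum because layers of a sum are
  themselves only quasi-subadditive.\<close>

lemma ell_finite_quasi_add:
  assumes r: "0 < r" and fg: "ell_finite r f" "ell_finite r g" "\<And>x. 0 \<le> f x" "\<And>x. 0 \<le> g x"
    and h: "\<And>x. 0 \<le> h x" "\<And>x. h x \<le> K * (f x + g x)" and K: "0 \<le> K"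
  shows "ell_finite r h"
    and "ell_norm r h \<le> 2 * K * 2 powr (1 / real_of_ereal r) * (ell_norm r f + ell_norm r g)"
proof -
  let ?r = "real_of_ereal r"
  have "ell_finite r h \<and> ell_norm r h \<le> 2 * K * 2 powr (1 / ?r) * (ell_norm r f + ell_norm r g)"
  proof (cases "r = \<infinity>")
    case True
    have hb: "h x \<le> K * (ell_norm r f + ell_norm r g)" for x
    proof -
      have "h x \<le> K * (f x + g x)" by (rule h)
      also have "\<dots> \<le> K * (ell_norm r f + ell_norm r g)"
        using fg r K by (intro mult_left_mono add_mono le_ell_norm) auto
      finally show ?thesis .
    qed
    moreover have "0 \<le> K * (ell_norm r f + ell_norm r g)"
      using K fg by (intro mult_nonneg_nonneg add_nonneg_nonneg ell_norm_nonneg)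
    ultimately have "h x \<le> 2 * K * (ell_norm r f + ell_norm r g)" for x
      using hb[of x] unfolding mult.assoc by linarith
    then show ?thesis using True
      by (auto simp: ell_finite_def ell_norm_def intro!: bdd_aboveI2 cSUP_least)
  next
    case False
    have r': "0 < ?r" using r False by (rule real_of_ereal_pos_finite)
    have sf: "(\<lambda>x. f x powr ?r) summable_on UNIV" "(\<lambda>x. g x powr ?r) summable_on UNIV"
      using fg False by (auto simp: ell_finite_def)
    define Sf Sg where "Sf = infsum (\<lambda>x. f x powr ?r) UNIV" and "Sg = infsum (\<lambda>x. g x powr ?r) UNIV"
    have S0: "0 \<le> Sf" "0 \<le> Sg" by (auto simp: Sf_def Sg_def intro!: infsum_nonneg)
    have sumpow: "(a + b) powr t \<le> 2 powr t * (a powr t + b powr t)" if "0 \<le> a" "0 \<le> b" "0 < t" for a b t :: real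
    proof -
      have "(a + b) powr t \<le> (2 * max a b) powr t" using that by (intro powr_mono2) auto
      also have "\<dots> = 2 powr t * max a b powr t" using that by (simp add: powr_mult)
      also have "max a b powr t \<le> a powr t + b powr t" by (auto simp: max_def)
      finally show ?thesis by simp
    qed
    have hle: "h x powr ?r \<le> (2 * K) powr ?r * (f x powr ?r + g x powr ?r)" for x
    proof -
      have "h x powr ?r \<le> (K * (f x + g x)) powr ?r" using h r' by (intro powr_mono2) auto
      also have "\<dots> = K powr ?r * (f x + g x) powr ?r" using K fg by (simp add: powr_mult)
      also have "\<dots> \<le> K powr ?r * (2 powr ?r * (f x powr ?r + g x powr ?r))"
        using fg r' by (intro mult_left_mono sumpow) auto
      finally show ?thesis using K by (simp add: powr_mult mult_ac)
    qed
    have sfg: "(\<lambda>x. (2 * K) powr ?r * (f x powr ?r + g x powr ?r)) summable_on UNIV"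
      using sf by (intro summable_on_cmult_right summable_on_add)
    have sh: "(\<lambda>x. h x powr ?r) summable_on UNIV"
      by (rule summable_on_comparison_test[OF sfg]) (use hle in auto)
    have "infsum (\<lambda>x. h x powr ?r) UNIV \<le> infsum (\<lambda>x. (2 * K) powr ?r * (f x powr ?r + g x powr ?r)) UNIV"
      by (intro infsum_mono sh sfg hle)
    also have "\<dots> = (2 * K) powr ?r * (Sf + Sg)"
      using sf by (simp add: infsum_cmult_right' infsum_add Sf_def Sg_def)
    finally have "infsum (\<lambda>x. h x powr ?r) UNIV powr (1 / ?r) \<le> ((2 * K) powr ?r * (Sf + Sg)) powr (1 / ?r)"
      using r' by (intro powr_mono2 infsum_nonneg) auto
    also have "\<dots> = 2 * K * (Sf + Sg) powr (1 / ?r)"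
      using K S0 r' by (simp add: powr_mult powr_powr)
    also have "\<dots> \<le> 2 * K * (2 powr (1 / ?r) * (Sf powr (1 / ?r) + Sg powr (1 / ?r)))"
      using K S0 r' by (intro mult_left_mono sumpow) auto
    finally show ?thesis using False sh
      by (simp add: ell_finite_def ell_norm_def Sf_def Sg_def mult_ac)
  qed
  then show "ell_finite r h" "ell_norm r h \<le> 2 * K * 2 powr (1 / ?r) * (ell_norm r f + ell_norm r g)"
    by auto
qed

lemma ell_finite_zero: "ell_finite r (\<lambda>_. 0)"
  by (simp add: ell_finite_def)

lemma ell_norm_zero: "ell_norm r (\<lambda>_. 0) = 0"
  by (simp add: ell_norm_def)

lemma ell_finite_scaled:
  assumes "0 < r" "ell_finite r f" "\<And>x. 0 \<le> f x" "\<And>x. 0 \<le> h x" "\<And>x. h x \<le> K * f x" "0 \<le> K"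
  shows "ell_finite r h"
    and "ell_norm r h \<le> 2 * K * 2 powr (1 / real_of_ereal r) * ell_norm r f"
  using ell_finite_quasi_add[OF assms(1,2) ell_finite_zero assms(3) _ assms(4), where K=K] assms(5,6)
  by (simp_all add: ell_norm_zero)

abbreviation scale_coeff :: "ereal \<Rightarrow> real \<Rightarrow> ('i::finite \<Rightarrow> nat \<Rightarrow> int ^ 'd::finite \<Rightarrow> complex) \<Rightarrow> nat \<Rightarrow> 'i \<times> (int ^ 'd) \<Rightarrow> real" where
  "scale_coeff p s c j \<equiv> (\<lambda>ik. norm (c (fst ik) j (snd ik)) * 2 powr ((s - d_over_p TYPE('d) p) * real j))"

lemma layer_eq_ell_norm: "layer p s c j = ell_norm p (scale_coeff p s c j)"
  unfolding layer_def ell_norm_def by (simp add: norm_mult norm_powr_real_powr d_over_p_def)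

lemma besov_norm_eq_ell_norm:
  assumes "0 < q" "ell_finite q (layer p s c)"
  shows "besov_norm p q s c = ell_norm q (layer p s c)"
proof (cases "q = \<infinity>")
  case False
  then have "(\<lambda>j. layer p s c j powr real_of_ereal q) summable_on UNIV" using assms by (simp add: ell_finite_def)
  then have "(\<lambda>j. layer p s c j powr real_of_ereal q) sums infsum (\<lambda>j. layer p s c j powr real_of_ereal q) UNIV"
    by (intro has_sum_imp_sums) auto
  then show ?thesis using False by (simp add: besov_norm_def ell_norm_def sums_iff)
qed (simp add: besov_norm_def ell_norm_def)

lemma ell_finite_scale_coeff_iff:
  assumes "0 < p"
  shows "ell_finite p (scale_coeff p s c j) \<longleftrightarrow>
    (if p = \<infinity> then bdd_above ((\<lambda>ik :: 'i \<times> (int ^ 'd). norm (c (fst ik) j (snd ik))) ` UNIV)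
     else (\<lambda>ik :: 'i::finite \<times> (int ^ 'd::finite). norm (c (fst ik) j (snd ik)) powr real_of_ereal p) summable_on UNIV)"
proof -
  let ?f = "\<lambda>ik :: 'i \<times> (int ^ 'd). norm (c (fst ik) j (snd ik))"
  define K where "K = 2 powr ((s - d_over_p TYPE('d) p) * real j)"
  have K: "0 < K" by (simp add: K_def)
  have "ell_finite p (\<lambda>ik. ?f ik * K) \<longleftrightarrow> ell_finite p ?f"
  proof
    assume "ell_finite p (\<lambda>ik. ?f ik * K)"
    then show "ell_finite p ?f"
      using K by (rule_tac ell_finite_scaled(1)[OF assms, of "\<lambda>ik. ?f ik * K" _ "1 / K"]) auto
  next
    assume "ell_finite p ?f"
    then show "ell_finite p (\<lambda>ik. ?f ik * K)"
      using K by (rule_tac ell_finite_scaled(1)[OF assms, of ?f _ K]) auto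
  qed
  then show ?thesis unfolding K_def[symmetric] by (simp add: ell_finite_def)
qed

lemma mem_besov_seq_iff:
  assumes "0 < p"
  shows "c \<in> besov_seq p q s \<longleftrightarrow> (\<forall>j. ell_finite p (scale_coeff p s c j)) \<and> ell_finite q (layer p s c)"
proof -
  have "ell_finite q (layer p s c) \<longleftrightarrow> (if q = \<infinity> then bdd_above (range (layer p s c))
      else summable (\<lambda>j. layer p s c j powr real_of_ereal q))"
    by (simp add: ell_finite_def summable_on_UNIV_nonneg_real_iff)
  then show ?thesis
    unfolding besov_seq_def in_besov_seq_def ell_finite_scale_coeff_iff[OF assms] by simp
qed

lemma layer_nonneg:
  assumes "0 < p" "c \<in> besov_seq p q s"
  shows "0 \<le> layer p s c j"
  using assms unfolding mem_besov_seq_iff[OF assms(1)] layer_eq_ell_norm by (intro ell_norm_nonneg) auto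

lemma coeff_le_layer:
  fixes c :: "'i::finite \<Rightarrow> nat \<Rightarrow> int ^ 'd::finite \<Rightarrow> complex"
  assumes "0 < p" "c \<in> besov_seq p q s"
  shows "norm (c i j k) * 2 powr ((s - d_over_p TYPE('d) p) * real j) \<le> layer p s c j"
  using le_ell_norm[of p "scale_coeff p s c j" "(i, k)"] assms
  by (simp add: mem_besov_seq_iff layer_eq_ell_norm)

lemma coeff_le_besov_norm:
  fixes c :: "'i::finite \<Rightarrow> nat \<Rightarrow> int ^ 'd::finite \<Rightarrow> complex"
  assumes "0 < p" "0 < q" "c \<in> besov_seq p q s"
  shows "norm (c i j k) * 2 powr ((s - d_over_p TYPE('d) p) * real j) \<le> besov_norm p q s c"
proof -
  have fin: "ell_finite q (layer p s c)" using assms by (simp add: mem_besov_seq_iff)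
  have "layer p s c j \<le> besov_norm p q s c"
    unfolding besov_norm_eq_ell_norm[OF assms(2) fin]
    using assms by (intro le_ell_norm fin layer_nonneg[OF assms(1,3)])
  then show ?thesis using coeff_le_layer[OF assms(1,3), of i j k] by linarith
qed

lemma besov_seq_diff:
  fixes c c' :: "'i::finite \<Rightarrow> nat \<Rightarrow> int ^ 'd::finite \<Rightarrow> complex"
  assumes "0 < p" "0 < q" "c \<in> besov_seq p q s" "c' \<in> besov_seq p q s"
  shows "c - c' \<in> besov_seq p q s"
proof -
  have c: "ell_finite p (scale_coeff p s c j)" "ell_finite p (scale_coeff p s c' j)" for j
    using assms by (simp_all add: mem_besov_seq_iff)
  have le: "scale_coeff p s (c - c') j ik \<le> 1 * (scale_coeff p s c j ik + scale_coeff p s c' j ik)" for j ik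
    by (simp add: distrib_right[symmetric] norm_triangle_ineq4)
  have fin: "ell_finite p (scale_coeff p s (c - c') j)" for j
    by (rule ell_finite_quasi_add(1)[OF assms(1) c _ _ _ le]) auto
  have lay: "layer p s (c - c') j \<le> 2 * 1 * 2 powr (1 / real_of_ereal p) * (layer p s c j + layer p s c' j)" for j
    unfolding layer_eq_ell_norm by (rule ell_finite_quasi_add(2)[OF assms(1) c _ _ _ le]) auto
  have nn: "0 \<le> layer p s (c - c') j" for j
    unfolding layer_eq_ell_norm using fin by (intro ell_norm_nonneg) auto
  have "ell_finite q (layer p s (c - c'))"
    using assms by (intro ell_finite_quasi_add(1)[OF assms(2) _ _ _ _ nn lay] layer_nonneg[of p _ q])
      (auto simp: mem_besov_seq_iff)
  then show ?thesis using fin assms(1) by (simp add: mem_besov_seq_iff)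
qed

lemma besov_layer_bounded:
  assumes "0 < p" "0 < q" "c \<in> besov_seq p q s"
  obtains M where "0 < M" "\<And>j. layer p s c j \<le> M"
proof (rule that[of "max 1 (ell_norm q (layer p s c))"])
  fix j show "layer p s c j \<le> max 1 (ell_norm q (layer p s c))"
    using assms le_ell_norm[of q "layer p s c" j] layer_nonneg[OF assms(1,3)]
    by (auto simp: mem_besov_seq_iff le_max_iff_disj)
qed simp

section \<open>Open sets, continuity of the coefficients, and Borel sets\<close>

text \<open>\<open>topology\<close> returns the intended open sets only after the defining predicate
  is known to be stable under finite intersections and arbitrary unions.\<close>

lemma openin_besov_topology:
  fixes U :: "('a::finite \<Rightarrow> nat \<Rightarrow> int ^ 'b::finite \<Rightarrow> complex) set"
  shows "openin (besov_topology p q s) U \<longleftrightarrow> U \<subseteq> besov_seq p q s \<and>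
     (\<forall>x\<in>U. \<exists>e>0. \<forall>y\<in>besov_seq p q s. besov_norm p q s (y - x) < e \<longrightarrow> y \<in> U)"
proof -
  have "istopology (\<lambda>U :: ('a \<Rightarrow> nat \<Rightarrow> int ^ 'b \<Rightarrow> complex) set. U \<subseteq> besov_seq p q s \<and>
      (\<forall>x\<in>U. \<exists>e>0. \<forall>y\<in>besov_seq p q s. besov_norm p q s (y - x) < e \<longrightarrow> y \<in> U))"
    unfolding istopology_def
  proof (intro conjI allI impI)
    fix U V :: "('a \<Rightarrow> nat \<Rightarrow> int ^ 'b \<Rightarrow> complex) set"
    assume U: "U \<subseteq> besov_seq p q s \<and> (\<forall>x\<in>U. \<exists>e>0. \<forall>y\<in>besov_seq p q s. besov_norm p q s (y - x) < e \<longrightarrow> y \<in> U)"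
      and V: "V \<subseteq> besov_seq p q s \<and> (\<forall>x\<in>V. \<exists>e>0. \<forall>y\<in>besov_seq p q s. besov_norm p q s (y - x) < e \<longrightarrow> y \<in> V)"
    show "U \<inter> V \<subseteq> besov_seq p q s" using U by blast
    show "\<forall>x\<in>U \<inter> V. \<exists>e>0. \<forall>y\<in>besov_seq p q s. besov_norm p q s (y - x) < e \<longrightarrow> y \<in> U \<inter> V"
    proof
      fix x assume "x \<in> U \<inter> V"
      then obtain e1 e2 where "e1 > 0" "e2 > 0"
        "\<forall>y\<in>besov_seq p q s. besov_norm p q s (y - x) < e1 \<longrightarrow> y \<in> U"
        "\<forall>y\<in>besov_seq p q s. besov_norm p q s (y - x) < e2 \<longrightarrow> y \<in> V" using U V by blast
      then show "\<exists>e>0. \<forall>y\<in>besov_seq p q s. besov_norm p q s (y - x) < e \<longrightarrow> y \<in> U \<inter> V"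
        by (intro exI[of _ "min e1 e2"]) auto
    qed
  next
    fix K :: "('a \<Rightarrow> nat \<Rightarrow> int ^ 'b \<Rightarrow> complex) set set"
    assume K: "\<forall>U\<in>K. U \<subseteq> besov_seq p q s \<and> (\<forall>x\<in>U. \<exists>e>0. \<forall>y\<in>besov_seq p q s. besov_norm p q s (y - x) < e \<longrightarrow> y \<in> U)"
    show "\<Union> K \<subseteq> besov_seq p q s" using K by blast
    show "\<forall>x\<in>\<Union> K. \<exists>e>0. \<forall>y\<in>besov_seq p q s. besov_norm p q s (y - x) < e \<longrightarrow> y \<in> \<Union> K"
      using K by (meson UnionE UnionI)
  qed
  then show ?thesis unfolding besov_topology_def by (simp add: topology_inverse')
qed

lemma topspace_besov_topology [simp]: "topspace (besov_topology p q s) = besov_seq p q s"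
proof -
  have "openin (besov_topology p q s) (besov_seq p q s)"
    unfolding openin_besov_topology by (auto intro: exI[of _ 1])
  then show ?thesis
    by (meson openin_besov_topology openin_subset openin_topspace subset_antisym)
qed

lemma openin_besov_coeff_preimage:
  fixes i :: "'i::finite" and k :: "int ^ 'd::finite"
  assumes "0 < p" "0 < q" "open V"
  shows "openin (besov_topology p q s) {c \<in> besov_seq p q s. c i j k \<in> V}"
  unfolding openin_besov_topology
proof (intro conjI ballI)
  fix x assume x: "x \<in> {c \<in> besov_seq p q s. c i j k \<in> V}"
  then obtain e where e: "0 < e" "\<And>z. dist z (x i j k) < e \<Longrightarrow> z \<in> V"
    using assms(3) unfolding open_dist by blast
  define K where "K = 2 powr ((s - d_over_p TYPE('d) p) * real j)"
  have K: "0 < K" by (simp add: K_def)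
  show "\<exists>e>0. \<forall>y\<in>besov_seq p q s. besov_norm p q s (y - x) < e \<longrightarrow> y \<in> {c \<in> besov_seq p q s. c i j k \<in> V}"
  proof (intro exI[of _ "e * K"] conjI ballI impI)
    fix y assume y: "y \<in> besov_seq p q s" "besov_norm p q s (y - x) < e * K"
    have "y - x \<in> besov_seq p q s" using besov_seq_diff[OF assms(1,2) y(1)] x by blast
    then have "norm ((y - x) i j k) * K \<le> besov_norm p q s (y - x)"
      unfolding K_def by (rule coeff_le_besov_norm[OF assms(1,2)])
    then have "norm (y i j k - x i j k) * K < e * K" using y(2) by simp
    then have "y i j k \<in> V" using K e(2) by (simp add: dist_norm)
    then show "y \<in> {c \<in> besov_seq p q s. c i j k \<in> V}" using y(1) by simp
  qed (use e K in simp)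
qed auto

text \<open>Distinct sequences are separated by a single coefficient. The property makes the compact
  support of the probe measure closed, hence Borel.\<close>

lemma Hausdorff_besov_topology:
  assumes "0 < p" "0 < q"
  shows "Hausdorff_space (besov_topology p q s)"
  unfolding Hausdorff_space_def
proof (intro allI impI)
  fix x y :: "'a \<Rightarrow> nat \<Rightarrow> int ^ 'b \<Rightarrow> complex"
  assume xy: "x \<in> topspace (besov_topology p q s) \<and> y \<in> topspace (besov_topology p q s) \<and> x \<noteq> y"
  then obtain i j k where "x i j k \<noteq> y i j k" by (metis ext)
  then obtain U V where "open U" "open V" "x i j k \<in> U" "y i j k \<in> V" "U \<inter> V = {}"
    using hausdorff by metis
  then show "\<exists>U V. openin (besov_topology p q s) U \<and> openin (besov_topology p q s) V \<and> x \<in> U \<and> y \<in> V \<and> disjnt U V"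
    using xy openin_besov_coeff_preimage[OF assms, of U s i j k] openin_besov_coeff_preimage[OF assms, of V s i j k]
    by (intro exI[of _ "{c \<in> besov_seq p q s. c i j k \<in> U}"] exI[of _ "{c \<in> besov_seq p q s. c i j k \<in> V}"])
       (auto simp: disjnt_def)
qed

lemma sigma_algebra_borel_sets_of: "sigma_algebra (topspace X) (borel_sets_of X)"
  unfolding borel_sets_of_def by (intro sigma_algebra_sigma_sets) (auto dest: openin_subset)

lemma borel_sets_of_coeff_ge:
  fixes i :: "'i::finite" and k :: "int ^ 'd::finite"
  assumes "0 < p" "0 < q"
  shows "{c \<in> besov_seq p q s. a \<le> norm (c i j k)} \<in> borel_sets_of (besov_topology p q s)"
proof -
  interpret sigma_algebra "besov_seq p q s" "borel_sets_of (besov_topology p q s)"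
    using sigma_algebra_borel_sets_of[of "besov_topology p q s"] by simp
  have "open {z::complex. norm z < a}" by (intro open_Collect_less continuous_intros)
  then have "{c \<in> besov_seq p q s. c i j k \<in> {z. norm z < a}} \<in> borel_sets_of (besov_topology p q s)"
    unfolding borel_sets_of_def using openin_besov_coeff_preimage[OF assms] by (intro sigma_sets.Basic) blast
  then have "besov_seq p q s - {c \<in> besov_seq p q s. c i j k \<in> {z. norm z < a}} \<in> borel_sets_of (besov_topology p q s)"
    by (rule compl_sets)
  also have "besov_seq p q s - {c \<in> besov_seq p q s. c i j k \<in> {z. norm z < a}} = {c \<in> besov_seq p q s. a \<le> norm (c i j k)}"
    by auto
  finally show ?thesis .
qed

section \<open>Upper bounds for the divergence exponent\<close>

lemma fast_decaying_uniform:
  fixes \<psi> :: "'i::finite \<Rightarrow> real ^ 'd::finite \<Rightarrow> complex"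
  assumes "\<And>i. fast_decaying (\<psi> i)"
  obtains C where "0 < C" "\<And>i x. norm (\<psi> i x) * (1 + norm x) ^ n \<le> C"
proof -
  have "\<forall>i. \<exists>C. \<forall>x. norm (\<psi> i x) \<le> C * (1 + norm x) powr (- real n)"
    using assms unfolding fast_decaying_def by blast
  then obtain C where C: "\<And>i x. norm (\<psi> i x) \<le> C i * (1 + norm x) powr (- real n)"
    by metis
  show thesis
  proof (rule that[of "1 + (\<Sum>i\<in>UNIV. \<bar>C i\<bar>)"])
    fix i and x :: "real ^ 'd"
    have "(1 + norm x) powr (- real n) * (1 + norm x) ^ n = 1"
    proof -
      have "0 < 1 + norm x" by (simp add: add_pos_nonneg)
      then show ?thesis by (simp add: powr_minus powr_realpow)
    qed
    then have "norm (\<psi> i x) * (1 + norm x) ^ n \<le> C i"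
      using mult_right_mono[OF C[of i x], of "(1 + norm x) ^ n"] by (simp add: mult.assoc)
    also have "\<dots> \<le> (\<Sum>i\<in>UNIV. \<bar>C i\<bar>)"
      by (rule order_trans[OF abs_ge_self]) (intro member_le_sum; simp)
    finally show "norm (\<psi> i x) * (1 + norm x) ^ n \<le> 1 + (\<Sum>i\<in>UNIV. \<bar>C i\<bar>)" by simp
  qed (simp add: add_pos_nonneg sum_nonneg)
qed

lemma besov_coeff_bound:
  fixes c :: "'i::finite \<Rightarrow> nat \<Rightarrow> int ^ 'd::finite \<Rightarrow> complex"
  assumes "0 < p" "0 < q" "c \<in> besov_seq p q s"
  obtains M where "0 < M" "\<And>i j k. norm (c i j k) \<le> M * 2 powr ((d_over_p TYPE('d) p - s) * real j)"
    "\<And>j. layer p s c j \<le> M"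
proof -
  obtain M where M: "0 < M" "\<And>j. layer p s c j \<le> M" using besov_layer_bounded[OF assms] by blast
  show thesis
  proof (rule that[OF M(1) _ M(2)])
    fix i j k
    let ?e = "(s - d_over_p TYPE('d) p) * real j"
    have "norm (c i j k) * 2 powr ?e \<le> M"
      using coeff_le_layer[OF assms(1,3), of i j k] M(2)[of j] by linarith
    then have "norm (c i j k) * 2 powr ?e * 2 powr (- ?e) \<le> M * 2 powr (- ?e)"
      by (intro mult_right_mono) auto
    moreover have "norm (c i j k) * 2 powr ?e * 2 powr (- ?e) = norm (c i j k)"
      by (simp add: mult.assoc powr_add[symmetric])
    moreover have "- ?e = (d_over_p TYPE('d) p - s) * real j" by (simp add: algebra_simps)
    ultimately show "norm (c i j k) \<le> M * 2 powr ((d_over_p TYPE('d) p - s) * real j)"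
      by (simp only:)
  qed
qed

lemma divergence_exponent_le:
  fixes \<psi> :: "'i::finite \<Rightarrow> real ^ 'd::finite \<Rightarrow> complex"
  assumes "0 < p" "0 < q" "c \<in> besov_seq p q s" "\<And>i. fast_decaying (\<psi> i)"
  shows "divergence_exponent \<psi> c x \<le> ereal (d_over_p TYPE('d) p - s)"
  unfolding divergence_exponent_def
proof (rule Sup_least, clarify, unfold ereal_less_eq)
  fix \<gamma> C :: real and i j k
  assume C: "0 < C" and j: "filterlim j at_top sequentially"
    and le: "\<forall>n. C * 2 powr (\<gamma> * real (j n)) \<le> norm (c (i n) (j n) (k n) * wavelet \<psi> (i n) (j n) (k n) x)"
  obtain M where M: "0 < M" "\<And>i j k. norm (c i j k) \<le> M * 2 powr ((d_over_p TYPE('d) p - s) * real j)"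
    using besov_coeff_bound[OF assms(1-3)] by metis
  obtain C' where C': "0 < C'" "\<And>i x. norm (\<psi> i x) * (1 + norm x) ^ 0 \<le> C'"
    by (rule fast_decaying_uniform[of \<psi> 0, OF assms(4)]) auto
  let ?g = "\<gamma> - (d_over_p TYPE('d) p - s)"
  show "\<gamma> \<le> d_over_p TYPE('d) p - s"
  proof (rule ccontr)
    assume "\<not> ?thesis"
    then have g: "0 < ?g" by simp
    have "filterlim (\<lambda>j. 2 powr (?g * real j)) at_top at_top" using g by real_asymp
    then have "filterlim (\<lambda>n. 2 powr (?g * real (j n))) at_top sequentially"
      using j by (rule filterlim_compose)
    then have "\<exists>n. M * C' / C < 2 powr (?g * real (j n))"
      unfolding filterlim_at_top_dense by (auto dest: eventually_happens'[OF sequentially_bot])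
    then obtain n where n: "M * C' < C * 2 powr (?g * real (j n))"
      using C by (auto simp: field_simps)
    let ?e = "2 powr ((d_over_p TYPE('d) p - s) * real (j n))"
    have "C * 2 powr (\<gamma> * real (j n)) \<le> norm (c (i n) (j n) (k n)) * norm (wavelet \<psi> (i n) (j n) (k n) x)"
      using le by (simp add: norm_mult)
    also have "\<dots> \<le> (M * ?e) * C'"
      using M C' by (intro mult_mono) (auto simp: wavelet_def)
    finally have "C * 2 powr (\<gamma> * real (j n)) \<le> M * C' * ?e" by (simp add: mult_ac)
    moreover have "2 powr (\<gamma> * real (j n)) = 2 powr (?g * real (j n)) * ?e"
      by (simp add: powr_add[symmetric] algebra_simps)
    moreover have "0 < ?e" by simp
    ultimately have "C * 2 powr (?g * real (j n)) * ?e \<le> M * C' * ?e" by (simp add: mult_ac)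
    then have "C * 2 powr (?g * real (j n)) \<le> M * C'" using \<open>0 < ?e\<close> by (rule mult_right_le_imp_le)
    then show False using n by simp
  qed
qed

text \<open>The gap between \<gamma> and an exponent \<gamma>1 > \<gamma> attained by x gives a
  factor 2^((\<gamma>1 - \<gamma>) j) that absorbs the constant C; hence the constant 1 in the
  conclusion.\<close>

lemma divergence_exponent_gt_imp_frequently:
  assumes "ereal \<gamma> < divergence_exponent \<psi> c x"
  shows "\<exists>\<^sub>F j in sequentially. \<exists>i k. 2 powr (\<gamma> * real j) \<le> norm (c i j k * wavelet \<psi> i j k x)"
proof -
  from assms obtain \<gamma>1 C i j k where \<gamma>1: "\<gamma> < \<gamma>1" and C: "0 < C" and j: "filterlim j at_top sequentially"
    and le: "\<And>n. C * 2 powr (\<gamma>1 * real (j n)) \<le> norm (c (i n) (j n) (k n) * wavelet \<psi> (i n) (j n) (k n) x)"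
  proof -
    from assms obtain y where y: "ereal \<gamma> < y" "y \<in> ereal ` {\<gamma>. \<exists>C>0. \<exists>i j k. filterlim j at_top sequentially \<and>
        (\<forall>n. C * 2 powr (\<gamma> * real (j n)) \<le> norm (c (i n) (j n) (k n) * wavelet \<psi> (i n) (j n) (k n) x))}"
      unfolding divergence_exponent_def less_Sup_iff by blast
    from y(2) obtain \<gamma>1 where \<gamma>1: "y = ereal \<gamma>1" "\<exists>C>0. \<exists>i j k. filterlim j at_top sequentially \<and>
        (\<forall>n. C * 2 powr (\<gamma>1 * real (j n)) \<le> norm (c (i n) (j n) (k n) * wavelet \<psi> (i n) (j n) (k n) x))"
      by (elim imageE CollectE)
    have "\<gamma> < \<gamma>1" using y(1) \<gamma>1(1) by simp
    then show thesis using that \<gamma>1(2) by blast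
  qed
  have "filterlim (\<lambda>j. C * 2 powr ((\<gamma>1 - \<gamma>) * real j)) at_top at_top" using \<gamma>1 C by real_asymp
  then have "filterlim (\<lambda>n. C * 2 powr ((\<gamma>1 - \<gamma>) * real (j n))) at_top sequentially"
    using j by (rule filterlim_compose)
  then have ev: "\<forall>\<^sub>F n in sequentially. 1 \<le> C * 2 powr ((\<gamma>1 - \<gamma>) * real (j n))"
    unfolding filterlim_at_top by blast
  show ?thesis unfolding frequently_sequentially
  proof
    fix N
    have "\<forall>\<^sub>F n in sequentially. N \<le> j n" using j unfolding filterlim_at_top by blast
    with ev obtain n where n: "1 \<le> C * 2 powr ((\<gamma>1 - \<gamma>) * real (j n))" "N \<le> j n"
      using eventually_happens'[OF sequentially_bot eventually_conj[OF ev]] by blast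
    have "2 powr (\<gamma> * real (j n)) * 1 \<le> 2 powr (\<gamma> * real (j n)) * (C * 2 powr ((\<gamma>1 - \<gamma>) * real (j n)))"
      using n by (intro mult_left_mono) auto
    also have "\<dots> = C * 2 powr (\<gamma>1 * real (j n))"
      by (simp add: powr_add[symmetric] algebra_simps)
    finally show "\<exists>j\<ge>N. \<exists>i k. 2 powr (\<gamma> * real j) \<le> norm (c i j k * wavelet \<psi> i j k x)"
      using le[of n] n(2) by (intro exI[of _ "j n"]) (auto intro: order_trans)
  qed
qed

text \<open>Chebyshev's inequality in one layer: each member of \<open>F\<close> contributes at
  least (t 2^((s - d/p) j))^p to a sum bounded by M^p. Finiteness of \<open>F\<close> comes out of
  the same bound, applied to its finite subsets.\<close>

lemma large_coeff_count:
  fixes c :: "'i::finite \<Rightarrow> nat \<Rightarrow> int ^ 'd::finite \<Rightarrow> complex"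
  assumes p: "0 < p" "p \<noteq> \<infinity>" and c: "c \<in> besov_seq p q s" and M: "layer p s c j \<le> M" and t: "0 < t"
  defines "F \<equiv> {ik :: 'i \<times> (int ^ 'd). t \<le> norm (c (fst ik) j (snd ik))}"
  shows "finite F" "real (card F) \<le> (M / t) powr real_of_ereal p * 2 powr ((real CARD('d) - s * real_of_ereal p) * real j)"
proof -
  let ?p = "real_of_ereal p" and ?e = "2 powr ((s - d_over_p TYPE('d) p) * real j)"
  let ?f = "\<lambda>ik. scale_coeff p s c j ik powr ?p"
  define B where "B = (M / t) powr ?p * 2 powr ((real CARD('d) - s * ?p) * real j)"
  have p': "0 < ?p" using p by (rule real_of_ereal_pos_finite)
  have sf: "?f summable_on UNIV" using c p by (simp add: mem_besov_seq_iff ell_finite_def)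
  have M0: "0 \<le> M" using layer_nonneg[OF p(1) c, of j] M by linarith
  have I: "infsum ?f UNIV \<le> M powr ?p"
  proof -
    have "infsum ?f UNIV = layer p s c j powr ?p"
      using p p' by (simp add: layer_eq_ell_norm ell_norm_def powr_powr infsum_nonneg)
    also have "\<dots> \<le> M powr ?p" using p' M layer_nonneg[OF p(1) c] by (intro powr_mono2) auto
    finally show ?thesis .
  qed
  have *: "card G \<le> nat \<lfloor>B\<rfloor>" if G: "G \<subseteq> F" "finite G" for G
  proof -
    have "real (card G) * (t * ?e) powr ?p = (\<Sum>ik\<in>G. (t * ?e) powr ?p)" by simp
    also have "\<dots> \<le> (\<Sum>ik\<in>G. ?f ik)"
      using G p' t by (intro sum_mono powr_mono2 mult_right_mono) (auto simp: F_def)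
    also have "\<dots> \<le> infsum ?f UNIV" using G sf by (intro finite_sum_le_infsum) auto
    finally have "real (card G) * (t * ?e) powr ?p \<le> M powr ?p" using I by linarith
    then have "real (card G) \<le> M powr ?p / (t * ?e) powr ?p"
      using t by (simp add: field_simps)
    also have "\<dots> = B"
    proof -
      have "?e powr ?p = 2 powr (- ((real CARD('d) - s * ?p) * real j))"
      proof -
        have "(s - d_over_p TYPE('d) p) * ?p = s * ?p - real CARD('d)"
          using p p' by (simp add: d_over_p_def left_diff_distrib)
        then have "(s - d_over_p TYPE('d) p) * real j * ?p = - ((real CARD('d) - s * ?p) * real j)"
          by (metis (no_types, opaque_lifting) minus_diff_eq minus_mult_left mult.assoc mult.commute)
        then show ?thesis by (simp only: powr_powr)
      qed
      then show ?thesis using t M0 unfolding B_def by (simp add: powr_mult powr_divide powr_minus divide_simps mult.commute)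
    qed
    finally show ?thesis by linarith
  qed
  show fin: "finite F" using finite_if_finite_subsets_card_bdd[of F, OF *] by blast
  have "0 \<le> B" by (simp add: B_def)
  then show "real (card F) \<le> (M / t) powr ?p * 2 powr ((real CARD('d) - s * ?p) * real j)"
    using *[OF subset_refl fin] unfolding B_def[symmetric] by linarith
qed

text \<open>Points with \<delta> > \<gamma> are infinitely often close to positions whose
  coefficient is at least of order 2^(\<gamma> j). With g = d/p - s - \<gamma> there are about 2^(p
  g j) such positions, and by fast decay each acts only within distance of order 2^(-(1 - g/n) j).
  For large n this is nearly 2^(-j), and p g is the dimension bound.\<close>

lemma hausdorff_measure_divergence_superlevel:
  fixes \<psi> :: "'i::finite \<Rightarrow> real ^ 'd::finite \<Rightarrow> complex"
  assumes p: "0 < p" "p \<noteq> \<infinity>" and q: "0 < q" and c: "c \<in> besov_seq p q s" and \<psi>: "\<And>i. fast_decaying (\<psi> i)"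
    and \<alpha>: "0 < \<alpha>" "real CARD('d) - s * real_of_ereal p - \<gamma> * real_of_ereal p < \<alpha>"
  shows "hausdorff_measure \<alpha> {x. ereal \<gamma> < divergence_exponent \<psi> c x} = 0"
proof -
  let ?p = "real_of_ereal p"
  have p': "0 < ?p" using p by (rule real_of_ereal_pos_finite)
  define g where "g = d_over_p TYPE('d) p - s - \<gamma>"
  have pg: "?p * g = real CARD('d) - s * ?p - \<gamma> * ?p"
    using p p' by (simp add: g_def d_over_p_def field_simps)
  have "(\<lambda>n. g / real n) \<longlonglongrightarrow> 0" "(\<lambda>n. \<alpha> * (1 - g / real n)) \<longlonglongrightarrow> \<alpha>" by real_asymp+
  \<comment> \<open>The decay order n is chosen so large that the geometric ratio 2^(p g - \<alpha>
    (1 - g/n)) is below 1 and the radii still tend to 0.\<close>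
  then have "\<forall>\<^sub>F n in sequentially. g / real n < 1 \<and> ?p * g < \<alpha> * (1 - g / real n) \<and> 1 \<le> n"
    using \<alpha> unfolding pg[symmetric] by (intro eventually_conj order_tendstoD eventually_ge_at_top) auto
  then obtain n where n: "g / real n < 1" "?p * g < \<alpha> * (1 - g / real n)" "1 \<le> n"
    using eventually_happens'[OF sequentially_bot] by blast
  obtain M where M: "0 < M" "\<And>i j k. norm (c i j k) \<le> M * 2 powr ((d_over_p TYPE('d) p - s) * real j)"
    "\<And>j. layer p s c j \<le> M"
    using besov_coeff_bound[OF p(1) q c] by metis
  obtain C where C: "0 < C" "\<And>i x. norm (\<psi> i x) * (1 + norm x) ^ n \<le> C"
    by (rule fast_decaying_uniform[of \<psi> n, OF \<psi>], rule that)
  define F where "F j = {ik :: 'i \<times> (int ^ 'd). 2 powr (\<gamma> * real j) / C \<le> norm (c (fst ik) j (snd ik))}" for j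
  \<comment> \<open>Solve 2^(\<gamma> j) (1 + |y|)^n \<le> C M 2^((d/p - s) j) for |y|, where y =
    2^j x - k, and rescale by 2^(-j).\<close>
  define \<rho> where "\<rho> j = (C * M) powr (1 / real n) * 2 powr (- (1 - g / real n) * real j)" for j
  define ctr where "ctr j ik = (1 / 2 ^ j) *\<^sub>R vec_of_int (snd ik)" for j and ik :: "'i \<times> (int ^ 'd)"
  note cnt = large_coeff_count[OF p c M(3), of "2 powr (\<gamma> * real j) / C" j for j, folded F_def]
  define A where "A = (C * M) powr ?p * ((C * M) powr (1 / real n)) powr \<alpha>"
  have bound: "real (card (F j)) * \<rho> j powr \<alpha> \<le> A * (2 powr (?p * g - \<alpha> * (1 - g / real n))) ^ j" for j
  proof -
    have "real (card (F j)) \<le> (M / (2 powr (\<gamma> * real j) / C)) powr ?p * 2 powr ((real CARD('d) - s * ?p) * real j)"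
      using C by (intro cnt(2)) auto
    also have "\<dots> = (C * M) powr ?p * 2 powr (?p * g * real j)"
    proof -
      have "M / (2 powr (\<gamma> * real j) / C) = (C * M) * 2 powr (- (\<gamma> * real j))"
        using C by (simp add: powr_minus field_simps)
      moreover have "2 powr (- (\<gamma> * real j) * ?p) * 2 powr ((real CARD('d) - s * ?p) * real j) = 2 powr (?p * g * real j)"
        unfolding powr_add[symmetric] pg by (intro arg_cong[where f="\<lambda>x. 2 powr x"]) (simp add: algebra_simps)
      ultimately show ?thesis using C M by (simp add: powr_mult powr_powr)
    qed
    finally have "real (card (F j)) * \<rho> j powr \<alpha> \<le> ((C * M) powr ?p * 2 powr (?p * g * real j)) * \<rho> j powr \<alpha>"
      by (intro mult_right_mono) auto
    also have \<rho>\<alpha>: "\<rho> j powr \<alpha> = ((C * M) powr (1 / real n)) powr \<alpha> * 2 powr (- \<alpha> * (1 - g / real n) * real j)"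
      using C M by (simp add: \<rho>_def powr_mult powr_powr algebra_simps)
    also have "(C * M) powr ?p * 2 powr (?p * g * real j) * (((C * M) powr (1 / real n)) powr \<alpha> * 2 powr (- \<alpha> * (1 - g / real n) * real j))
        = A * 2 powr ((?p * g - \<alpha> * (1 - g / real n)) * real j)"
    proof -
      have "2 powr ((?p * g - \<alpha> * (1 - g / real n)) * real j) = 2 powr (?p * g * real j) * 2 powr (- \<alpha> * (1 - g / real n) * real j)"
        unfolding powr_add[symmetric] by (intro arg_cong[where f="\<lambda>x. 2 powr x"]) (simp add: left_diff_distrib)
      then show ?thesis by (simp add: A_def mult_ac)
    qed
    also have "2 powr ((?p * g - \<alpha> * (1 - g / real n)) * real j) = (2 powr (?p * g - \<alpha> * (1 - g / real n))) ^ j"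
      by (simp add: powr_powr[symmetric] powr_realpow)
    finally show ?thesis unfolding \<rho>\<alpha> .
  qed
  have ratio: "2 powr (?p * g - \<alpha> * (1 - g / real n)) < 1"
    using n(2) by (intro powr_less_one) auto
  show ?thesis
  proof (rule hausdorff_measure_limsup_balls[of F \<rho> \<alpha> _ ctr])
    show "finite (F j)" for j using C by (intro cnt(1)) auto
    show "0 \<le> \<rho> j" for j by (simp add: \<rho>_def)
    have lim: "(\<lambda>j. K * 2 powr (- a * real j)) \<longlonglongrightarrow> 0" if "0 < a" for K a :: real
    proof -
      have "(\<lambda>j. 2 powr (- a * real j)) \<longlonglongrightarrow> 0" using that by real_asymp
      then show ?thesis by (rule tendsto_mult_right_zero)
    qed
    show "\<rho> \<longlonglongrightarrow> 0" unfolding \<rho>_def[abs_def] by (rule lim) (use n(1) in simp)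
    show "0 < \<alpha>" by fact
    show "summable (\<lambda>j. real (card (F j)) * \<rho> j powr \<alpha>)"
    proof (rule summable_comparison_test')
      show "summable (\<lambda>j. A * (2 powr (?p * g - \<alpha> * (1 - g / real n))) ^ j)"
        using ratio by (intro summable_mult summable_geometric) auto
      show "norm (real (card (F j)) * \<rho> j powr \<alpha>) \<le> A * (2 powr (?p * g - \<alpha> * (1 - g / real n))) ^ j" if "0 \<le> j" for j
        using bound[of j] by simp
    qed
  next
    fix x assume "x \<in> {x. ereal \<gamma> < divergence_exponent \<psi> c x}"
    then have "\<exists>\<^sub>F j in sequentially. \<exists>i k. 2 powr (\<gamma> * real j) \<le> norm (c i j k * wavelet \<psi> i j k x)"
      by (intro divergence_exponent_gt_imp_frequently) simp
    then show "\<exists>\<^sub>F j in sequentially. \<exists>b\<in>F j. x \<in> cball (ctr j b) (\<rho> j)"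
    proof (rule frequently_elim1)
      fix j assume "\<exists>i k. 2 powr (\<gamma> * real j) \<le> norm (c i j k * wavelet \<psi> i j k x)"
      then obtain i k where ik: "2 powr (\<gamma> * real j) \<le> norm (c i j k) * norm (wavelet \<psi> i j k x)"
        by (auto simp: norm_mult)
      define y where "y = (2::real) ^ j *\<^sub>R x - vec_of_int k"
      have y1: "1 \<le> (1 + norm y) ^ n" by (rule one_le_power) simp
      have "2 powr (\<gamma> * real j) * (1 + norm y) ^ n \<le> norm (c i j k) * (norm (\<psi> i y) * (1 + norm y) ^ n)"
        using mult_right_mono[OF ik, of "(1 + norm y) ^ n"] by (simp add: wavelet_def y_def mult.assoc)
      also have "\<dots> \<le> norm (c i j k) * C" using C by (intro mult_left_mono) auto
      finally have key: "2 powr (\<gamma> * real j) * (1 + norm y) ^ n \<le> norm (c i j k) * C" .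
      have "2 powr (\<gamma> * real j) * 1 \<le> 2 powr (\<gamma> * real j) * (1 + norm y) ^ n" using y1 by (intro mult_left_mono) auto
      then have "2 powr (\<gamma> * real j) \<le> norm (c i j k) * C" using key by linarith
      then have "(i, k) \<in> F j" using C(1) by (simp add: F_def pos_divide_le_eq)
      have "2 powr (\<gamma> * real j) * (1 + norm y) ^ n \<le> M * 2 powr ((d_over_p TYPE('d) p - s) * real j) * C"
        using key mult_right_mono[OF M(2)[of i j k], of C] C by linarith
      also have "2 powr ((d_over_p TYPE('d) p - s) * real j) = 2 powr (\<gamma> * real j) * 2 powr (g * real j)"
        by (simp add: powr_add[symmetric] g_def algebra_simps)
      finally have "2 powr (\<gamma> * real j) * (1 + norm y) ^ n \<le> 2 powr (\<gamma> * real j) * (C * M * 2 powr (g * real j))"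
        by (simp add: mult_ac)
      then have "(1 + norm y) ^ n \<le> C * M * 2 powr (g * real j)" by (rule mult_left_le_imp_le) simp
      then have "(1 + norm y) powr real n \<le> C * M * 2 powr (g * real j)"
        by (subst powr_realpow) (auto simp: add_pos_nonneg)
      then have "((1 + norm y) powr real n) powr (1 / real n) \<le> (C * M * 2 powr (g * real j)) powr (1 / real n)"
        by (intro powr_mono2) auto
      then have "1 + norm y \<le> (C * M) powr (1 / real n) * 2 powr (g / real n * real j)"
        using n(3) C M by (simp add: powr_powr powr_mult)
      then have ny: "norm y \<le> (C * M) powr (1 / real n) * 2 powr (g / real n * real j)" by linarith
      have "ctr j (i, k) - x = - ((1 / 2 ^ j) *\<^sub>R y)"
        by (simp add: ctr_def y_def scaleR_diff_right)
      then have "dist (ctr j (i, k)) x = norm y / 2 ^ j" by (simp add: dist_norm)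
      also have "\<dots> \<le> (C * M) powr (1 / real n) * 2 powr (g / real n * real j) / 2 ^ j"
        using ny by (intro divide_right_mono) auto
      also have "\<dots> = \<rho> j"
      proof -
        have "2 powr (- (1 - g / real n) * real j) = 2 powr (g / real n * real j) / 2 powr real j"
          unfolding powr_diff[symmetric] by (intro arg_cong[where f="\<lambda>x. 2 powr x"]) (simp add: left_diff_distrib)
        then show ?thesis by (simp add: \<rho>_def powr_realpow)
      qed
      finally show "\<exists>b\<in>F j. x \<in> cball (ctr j b) (\<rho> j)" using \<open>(i, k) \<in> F j\<close> by (intro bexI[of _ "(i, k)"]) auto
    qed
  qed
qed

text \<open>The strict inequality is a countable union of superlevel sets at \<gamma> + 1/(n + 1),
  whose bounds lie strictly below the exponent in question. At the top value of \<gamma> that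
  exponent is 0, and the set is empty.\<close>

lemma hausdorff_measure_divergence_superlevel_critical:
  fixes \<psi> :: "'i::finite \<Rightarrow> real ^ 'd::finite \<Rightarrow> complex"
  assumes p: "0 < p" "p \<noteq> \<infinity>" and q: "0 < q" and c: "c \<in> besov_seq p q s" and \<psi>: "\<And>i. fast_decaying (\<psi> i)"
    and \<gamma>: "\<gamma> \<le> d_over_p TYPE('d) p - s"
  shows "hausdorff_measure (real CARD('d) - s * real_of_ereal p - \<gamma> * real_of_ereal p)
           {x. ereal \<gamma> < divergence_exponent \<psi> c x} = 0"
proof (cases "\<gamma> = d_over_p TYPE('d) p - s")
  case True
  then have "{x. ereal \<gamma> < divergence_exponent \<psi> c x} = {}"
    using divergence_exponent_le[OF p(1) q c \<psi>] by (auto simp: not_less)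
  then have "\<exists>U::nat \<Rightarrow> nat \<Rightarrow> (real ^ 'd) set. {x. ereal \<gamma> < divergence_exponent \<psi> c x} \<subseteq> (\<Union>m n. U m n) \<and>
     (\<forall>m n. bounded (U m n) \<and> diameter (U m n) \<le> \<delta>) \<and> (\<Sum>m n. hausdorff_cost \<alpha> (U m n)) \<le> ennreal \<epsilon>"
    if "0 < \<delta>" for \<alpha> \<delta> \<epsilon>
    using that by (intro exI[of _ "\<lambda>m n. {}"]) simp
  then show ?thesis by (intro hausdorff_measure_zeroI) blast
next
  case False
  let ?p = "real_of_ereal p"
  have p': "0 < ?p" using p by (rule real_of_ereal_pos_finite)
  define \<alpha> where "\<alpha> = real CARD('d) - s * ?p - \<gamma> * ?p"
  have "\<alpha> = ?p * (d_over_p TYPE('d) p - s - \<gamma>)"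
    using p p' by (simp add: \<alpha>_def d_over_p_def field_simps)
  then have \<alpha>: "0 < \<alpha>" using False \<gamma> p' by simp
  have "hausdorff_measure \<alpha> (\<Union>n. {x. ereal (\<gamma> + 1 / real (Suc n)) < divergence_exponent \<psi> c x}) = 0"
    using \<alpha> p' by (intro hausdorff_measure_zero_UN hausdorff_measure_divergence_superlevel[OF p q c \<psi>])
      (simp_all add: \<alpha>_def algebra_simps add_pos_nonneg del: of_nat_Suc)
  moreover have "{x. ereal \<gamma> < divergence_exponent \<psi> c x} \<subseteq> (\<Union>n. {x. ereal (\<gamma> + 1 / real (Suc n)) < divergence_exponent \<psi> c x})"
  proof
    fix x assume "x \<in> {x. ereal \<gamma> < divergence_exponent \<psi> c x}"
    then obtain \<gamma>' where \<gamma>': "ereal \<gamma> < ereal \<gamma>'" "ereal \<gamma>' < divergence_exponent \<psi> c x"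
      using ereal_dense2 by blast
    then obtain n where "1 / real (Suc n) < \<gamma>' - \<gamma>"
      using reals_Archimedean[of "\<gamma>' - \<gamma>"] by (auto simp: inverse_eq_divide)
    then have "ereal (\<gamma> + 1 / real (Suc n)) < ereal \<gamma>'" by simp
    then have "ereal (\<gamma> + 1 / real (Suc n)) < divergence_exponent \<psi> c x" using \<gamma>'(2) by (rule less_trans)
    then show "x \<in> (\<Union>n. {x. ereal (\<gamma> + 1 / real (Suc n)) < divergence_exponent \<psi> c x})" by blast
  qed
  ultimately show ?thesis unfolding \<alpha>_def by (rule hausdorff_measure_zero_subset)
qed

text \<open>At \<gamma> = -s the critical exponent is d, and the identity map, with Hoelder exponent
  1, turns a Hausdorff null set into a Lebesgue null set.\<close>

lemma divergence_exponent_AE_le: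
  fixes \<psi> :: "'i::finite \<Rightarrow> real ^ 'd::finite \<Rightarrow> complex"
  assumes p: "0 < p" "p \<noteq> \<infinity>" and q: "0 < q" and c: "c \<in> besov_seq p q s" and \<psi>: "\<And>i. fast_decaying (\<psi> i)"
  shows "AE x in lborel. divergence_exponent \<psi> c x \<le> ereal (- s)"
proof -
  have "0 < real_of_ereal p" using p by (rule real_of_ereal_pos_finite)
  then have "- s \<le> d_over_p TYPE('d) p - s" by (simp add: d_over_p_def)
  from hausdorff_measure_divergence_superlevel_critical[OF p q c \<psi> this]
  have H: "hausdorff_measure (real CARD('d) * 1) {x. ereal (- s) < divergence_exponent \<psi> c x} = 0"
    by simp
  have le: "\<bar>x $ c - y $ c\<bar> \<le> 1 * dist x y powr 1" for x y :: "real ^ 'd" and c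
    using component_le_norm_cart[of "x - y" c] by (simp add: dist_norm)
  have "negligible {x \<in> UNIV. x \<in> {x. ereal (- s) < divergence_exponent \<psi> c x}}"
    by (rule negligible_inverse_Hoelder_preimage[OF le _ _ H]) auto
  then have "AE x in lebesgue. x \<notin> {x. ereal (- s) < divergence_exponent \<psi> c x}"
    unfolding negligible_iff_null_sets by (intro AE_not_in) simp
  then show ?thesis by (simp add: AE_completion_iff not_less)
qed

section \<open>The saturating probe\<close>

lemma vec_box_card:
  fixes S :: "'d::finite \<Rightarrow> 'a set"
  assumes "\<And>c. finite (S c)"
  shows "finite {h :: 'a ^ 'd. \<forall>c. h $ c \<in> S c}" "card {h :: 'a ^ 'd. \<forall>c. h $ c \<in> S c} \<le> (\<Prod>c\<in>UNIV. card (S c))"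
proof -
  have eq: "{h :: 'a ^ 'd. \<forall>c. h $ c \<in> S c} = vec_lambda ` (PiE UNIV S)"
  proof
    show "{h :: 'a ^ 'd. \<forall>c. h $ c \<in> S c} \<subseteq> vec_lambda ` (PiE UNIV S)"
    proof
      fix h :: "'a ^ 'd" assume "h \<in> {h. \<forall>c. h $ c \<in> S c}"
      then show "h \<in> vec_lambda ` (PiE UNIV S)"
        by (intro image_eqI[of _ _ "vec_nth h"]) (auto simp: vec_nth_inverse)
    qed
  qed auto
  have fin: "finite (PiE UNIV S)" using assms by (intro finite_PiE) auto
  show "finite {h :: 'a ^ 'd. \<forall>c. h $ c \<in> S c}" unfolding eq using fin by blast
  have "card (vec_lambda ` (PiE UNIV S) :: ('a ^ 'd) set) \<le> card (PiE UNIV S)" using fin by (rule card_image_le)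
  also have "\<dots> = (\<Prod>c\<in>UNIV. card (S c))" by (simp add: card_PiE)
  finally show "card {h :: 'a ^ 'd. \<forall>c. h $ c \<in> S c} \<le> (\<Prod>c\<in>UNIV. card (S c))" unfolding eq .
qed

lemma int_box_card:
  fixes M :: nat
  shows "finite {h :: int ^ 'd::finite. \<forall>c. \<bar>h $ c\<bar> \<le> int M}"
    "card {h :: int ^ 'd::finite. \<forall>c. \<bar>h $ c\<bar> \<le> int M} \<le> (2 * M + 1) ^ CARD('d)"
proof -
  have eq: "{h :: int ^ 'd. \<forall>c. \<bar>h $ c\<bar> \<le> int M} = {h. \<forall>c. h $ c \<in> {- int M .. int M}}"
    by (auto simp: abs_le_iff minus_le_iff)
  show "finite {h :: int ^ 'd. \<forall>c. \<bar>h $ c\<bar> \<le> int M}" unfolding eq by (rule vec_box_card) auto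
  show "card {h :: int ^ 'd. \<forall>c. \<bar>h $ c\<bar> \<le> int M} \<le> (2 * M + 1) ^ CARD('d)"
    unfolding eq using vec_box_card(2)[of "\<lambda>_::'d. {- int M .. int M}"] by (simp add: nat_add_distrib nat_mult_distrib)
qed

text \<open>This index satisfies 2^l (2^j x - k) - b = 2^(j+l) x - (2^l k + b), so it transports a
  covering triplet of the unit cube to the cube \<open>k\<close>. The vector \<open>b\<close> is
  arbitrary, and the resulting position may lie outside that cube.\<close>

definition subcube :: "nat \<Rightarrow> int ^ 'd \<Rightarrow> int ^ 'd \<Rightarrow> int ^ 'd::finite" where
  "subcube l k b = (\<chi> c. 2 ^ l * k $ c + b $ c)"

locale wavelet_probe =
  fixes L :: "('i::finite \<times> nat \<times> (int ^ 'd::finite)) set" and T :: nat and p q :: ereal and s :: real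
  assumes finite_L: "finite L" and T_pos: "1 \<le> T"
    and L_bounds: "\<And>i l b. (i, l, b) \<in> L \<Longrightarrow> 1 \<le> l \<and> l \<le> T"
    and p_pos: "0 < p" and q_pos: "0 < q"
begin

text \<open>The shift by one matches offsets running from 1 to \<open>T\<close>. Scale 0 is sent to
  0 by truncated subtraction, but the probe has no coefficient there.\<close>

definition coarse :: "nat \<Rightarrow> nat" where
  "coarse j = (j - 1) div T"

text \<open>For \<open>1 \<le> l \<le> T\<close> the scale \<open>j = T m + l\<close> determines \<open>m = coarse j\<close>. The set \<open>grid j v\<close> contains the
  positions at scale \<open>j\<close> attached to cubes of scale \<open>T m\<close> with corner in \<open>2^(-v) Z^d\<close> and in \<open>[-m, m]^d\<close>.\<close>

definition grid :: "nat \<Rightarrow> nat \<Rightarrow> (int ^ 'd) set" where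
  "grid j v = {k'. \<exists>(i, l, b)\<in>L. \<exists>k m. j = T * m + l \<and> v \<le> T * m \<and> k' = subcube l k b \<and>
     (\<forall>c. 2 ^ (T * m - v) dvd k $ c \<and> \<bar>k $ c\<bar> \<le> int (m * 2 ^ (T * m)))}"

text \<open>Where nonzero, this is comparable to 2^(-d v) for the least v with
  \<open>k \<in> grid j v\<close>. A sum instead of a minimum lets the total over all positions be
  bounded one v at a time.\<close>

definition level_sum :: "nat \<Rightarrow> int ^ 'd \<Rightarrow> real" where
  "level_sum j k = (\<Sum>v\<le>j. if k \<in> grid j v then 2 powr (- (real CARD('d) * real v)) else 0)"

text \<open>The outer exponent is \<open>1/p\<close>. For \<open>p = \<infinity>\<close> it is 0 and, since \<open>0 powr 0 = 0\<close>, the factor becomes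
  the indicator function of the support. The factor \<open>2^(- sqrt j)\<close> puts \<open>probe\<close> in the space for every \<open>q\<close>.\<close>

definition probe :: "nat \<Rightarrow> int ^ 'd \<Rightarrow> real" where
  "probe j k = 2 powr (- sqrt (real j) + (d_over_p TYPE('d) p - s) * real j) * level_sum j k powr (d_over_p TYPE('d) p / real CARD('d))"

lemma coarse_add: "1 \<le> l \<Longrightarrow> l \<le> T \<Longrightarrow> coarse (T * m + l) = m"
proof -
  assume l: "1 \<le> l" "l \<le> T"
  then obtain r where r: "l = Suc r" "r < T" by (cases l) auto
  then show ?thesis by (simp add: coarse_def)
qed

text \<open>A corner k divisible by 2^(T m - v) is 2^(T m - v) h with |h| \<le> m 2^v in each
  coordinate, so that each triplet of \<open>L\<close> has at most (2 m 2^v + 1)^d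
  positions.\<close>

lemma grid_card:
  shows "finite (grid j v)" "card (grid j v) \<le> card L * ((2 * j + 1) * 2 ^ v) ^ CARD('d)"
proof -
  define m where "m = coarse j"
  define R where "R = {h :: int ^ 'd. \<forall>c. \<bar>h $ c\<bar> \<le> int (m * 2 ^ v)}"
  define f where "f = (\<lambda>(x :: 'i \<times> nat \<times> (int ^ 'd), h :: int ^ 'd). subcube (fst (snd x)) (\<chi> c. 2 ^ (T * m - v) * h $ c) (snd (snd x)))"
  have sub: "grid j v \<subseteq> f ` (L \<times> R)"
  proof
    fix k' assume "k' \<in> grid j v"
    then obtain i l b k m' where *: "(i, l, b) \<in> L" "j = T * m' + l" "v \<le> T * m'" "k' = subcube l k b"
      "\<And>c. 2 ^ (T * m' - v) dvd k $ c" "\<And>c. \<bar>k $ c\<bar> \<le> int (m' * 2 ^ (T * m'))"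
      unfolding grid_def by blast
    have m': "m' = m" using *(1,2) L_bounds coarse_add unfolding m_def by metis
    define h :: "int ^ 'd" where "h = (\<chi> c. k $ c div 2 ^ (T * m - v))"
    have kh: "2 ^ (T * m - v) * h $ c = k $ c" for c using *(5)[of c] by (simp add: h_def m')
    have "h \<in> R" unfolding R_def
    proof safe
      fix c
      have "2 ^ (T * m - v) * \<bar>h $ c\<bar> = \<bar>k $ c\<bar>" using kh[of c, symmetric] by (simp add: abs_mult)
      also have "\<dots> \<le> int m * 2 ^ (T * m)" using *(6)[of c] by (simp add: m')
      also have "(2::int) ^ (T * m) = 2 ^ (T * m - v) * 2 ^ v" using *(3) by (simp add: m' power_add[symmetric])
      finally have "2 ^ (T * m - v) * \<bar>h $ c\<bar> \<le> 2 ^ (T * m - v) * (int m * 2 ^ v)" by (simp add: mult_ac)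
      then show "\<bar>h $ c\<bar> \<le> int (m * 2 ^ v)" by simp
    qed
    moreover have "k' = f ((i, l, b), h)" using *(4) kh by (simp add: f_def vec_nth_inverse)
    ultimately show "k' \<in> f ` (L \<times> R)" using *(1) by blast
  qed
  have R: "finite R" "card R \<le> (2 * (m * 2 ^ v) + 1) ^ CARD('d)"
    unfolding R_def by (rule int_box_card)+
  show "finite (grid j v)" using sub finite_L R by (meson finite_SigmaI finite_imageI finite_subset)
  have "card (grid j v) \<le> card (f ` (L \<times> R))" using sub finite_L R by (intro card_mono) auto
  also have "\<dots> \<le> card (L \<times> R)" using finite_L R by (intro card_image_le) auto
  also have "\<dots> = card L * card R" by (simp add: card_cartesian_product)
  also have "\<dots> \<le> card L * ((2 * j + 1) * 2 ^ v) ^ CARD('d)"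
  proof (intro mult_le_mono2)
    have "m \<le> j" unfolding m_def coarse_def by (meson diff_le_self div_le_dividend le_trans)
    then have "m * 2 ^ v \<le> j * 2 ^ v" by simp
    moreover have "1 \<le> (2::nat) ^ v" by simp
    ultimately have "2 * (m * 2 ^ v) + 1 \<le> (2 * j + 1) * 2 ^ v"
      unfolding add_mult_distrib mult.assoc mult_1 by linarith
    then have "(2 * (m * 2 ^ v) + 1) ^ CARD('d) \<le> ((2 * j + 1) * 2 ^ v) ^ CARD('d)" by (intro power_mono) auto
    then show "card R \<le> ((2 * j + 1) * 2 ^ v) ^ CARD('d)" using R(2) by linarith
  qed
  finally show "card (grid j v) \<le> card L * ((2 * j + 1) * 2 ^ v) ^ CARD('d)" .
qed

lemma level_sum_nonneg: "0 \<le> level_sum j k"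
  unfolding level_sum_def by (intro sum_nonneg) auto

lemma probe_nonneg: "0 \<le> probe j k"
  by (simp add: probe_def)

lemma level_sum_ge:
  assumes "k \<in> grid j v"
  shows "2 powr (- (real CARD('d) * real v)) \<le> level_sum j k"
proof -
  have "v \<le> j" using assms unfolding grid_def by auto
  then have "(if k \<in> grid j v then 2 powr (- (real CARD('d) * real v)) else 0) \<le> level_sum j k"
    unfolding level_sum_def by (intro member_le_sum[where f="\<lambda>v. if k \<in> grid j v then 2 powr (- (real CARD('d) * real v)) else 0"]) auto
  then show ?thesis using assms by simp
qed

lemma d_over_p_nonneg: "0 \<le> d_over_p TYPE('d) p"
  using p_pos by (cases p) (auto simp: d_over_p_def)

lemma probe_ge:
  assumes "k \<in> grid j v"
  shows "2 powr (- sqrt (real j) + (d_over_p TYPE('d) p - s) * real j - d_over_p TYPE('d) p * real v) \<le> probe j k"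
proof -
  have "(2 powr (- (real CARD('d) * real v))) powr (d_over_p TYPE('d) p / real CARD('d)) \<le> level_sum j k powr (d_over_p TYPE('d) p / real CARD('d))"
    using level_sum_ge[OF assms] d_over_p_nonneg by (intro powr_mono2) auto
  also have "(2 powr (- (real CARD('d) * real v))) powr (d_over_p TYPE('d) p / real CARD('d)) = 2 powr (- (d_over_p TYPE('d) p * real v))"
    by (simp add: powr_powr mult.commute)
  finally have "2 powr (- sqrt (real j) + (d_over_p TYPE('d) p - s) * real j) * 2 powr (- (d_over_p TYPE('d) p * real v)) \<le> probe j k"
    unfolding probe_def by (intro mult_left_mono) auto
  then show ?thesis by (simp add: powr_add[symmetric])
qed

lemma level_sum_support: "finite {k. level_sum j k \<noteq> 0}" "{k. level_sum j k \<noteq> 0} \<subseteq> (\<Union>v\<le>j. grid j v)"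
proof -
  show sub: "{k. level_sum j k \<noteq> 0} \<subseteq> (\<Union>v\<le>j. grid j v)"
    unfolding level_sum_def by (auto elim!: sum.not_neutral_contains_not_neutral split: if_splits)
  show "finite {k. level_sum j k \<noteq> 0}" using grid_card(1) by (intro finite_subset[OF sub]) auto
qed

text \<open>The weight 2^(-d v) cancels the 2^(d v) in the number of grid positions, so each of the
  j + 1 values of v contributes only polynomially.\<close>

lemma sum_level_sum_le:
  assumes "finite K"
  shows "(\<Sum>k\<in>K. level_sum j k) \<le> real (card L) * (real j + 1) * (2 * real j + 1) ^ CARD('d)"
proof -
  have "(\<Sum>k\<in>K. level_sum j k) = (\<Sum>v\<le>j. \<Sum>k\<in>K. if k \<in> grid j v then 2 powr (- (real CARD('d) * real v)) else 0)"
    unfolding level_sum_def by (rule sum.swap)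
  also have "\<dots> \<le> (\<Sum>v\<le>j. real (card L) * (2 * real j + 1) ^ CARD('d))"
  proof (rule sum_mono)
    fix v
    have e: "2 powr (- (real CARD('d) * real v)) = 1 / (2 ^ v) ^ CARD('d)"
      by (simp add: powr_minus powr_realpow[symmetric] powr_powr field_simps)
    have "(\<Sum>k\<in>K. if k \<in> grid j v then 2 powr (- (real CARD('d) * real v)) else 0)
        = real (card (K \<inter> grid j v)) * 2 powr (- (real CARD('d) * real v))"
      using assms by (simp add: sum.If_cases)
    also have "\<dots> \<le> real (card (grid j v)) * 2 powr (- (real CARD('d) * real v))"
      using grid_card(1) by (intro mult_right_mono of_nat_mono card_mono) auto
    also have "\<dots> \<le> real (card L * ((2 * j + 1) * 2 ^ v) ^ CARD('d)) * 2 powr (- (real CARD('d) * real v))"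
      by (intro mult_right_mono of_nat_mono grid_card) auto
    also have "\<dots> = real (card L) * (2 * real j + 1) ^ CARD('d)"
      unfolding e of_nat_mult of_nat_power power_mult_distrib by (simp add: add.commute)
    finally show "(\<Sum>k\<in>K. if k \<in> grid j v then 2 powr (- (real CARD('d) * real v)) else 0) \<le> real (card L) * (2 * real j + 1) ^ CARD('d)" .
  qed
  also have "\<dots> = real (card L) * (real j + 1) * (2 * real j + 1) ^ CARD('d)" by simp
  finally show ?thesis .
qed

definition probe_seq :: "'i \<Rightarrow> nat \<Rightarrow> int ^ 'd \<Rightarrow> complex" where
  "probe_seq i j k = of_real (probe j k)"

text \<open>The added 1 keeps the base positive, so that at p = \<infinity>, where the exponent
  reads 0, the value is 1 and not \<open>0 powr 0 = 0\<close>.\<close>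

definition layer_bound :: "nat \<Rightarrow> real" where
  "layer_bound j = (real CARD('i) * (real (card L) * (real j + 1) * (2 * real j + 1) ^ CARD('d)) + 1) powr (1 / real_of_ereal p)"

lemma scale_coeff_probe_seq:
  "scale_coeff p s probe_seq j (i, k) = 2 powr (- sqrt (real j)) * level_sum j k powr (d_over_p TYPE('d) p / real CARD('d))"
proof -
  have "2 powr (- sqrt (real j) + (d_over_p TYPE('d) p - s) * real j) * 2 powr ((s - d_over_p TYPE('d) p) * real j) = 2 powr (- sqrt (real j))"
    unfolding powr_add[symmetric] by (simp add: algebra_simps)
  moreover have "scale_coeff p s probe_seq j (i, k) = probe j k * 2 powr ((s - d_over_p TYPE('d) p) * real j)"
    using probe_nonneg[of j k] by (simp add: probe_seq_def)
  moreover have "probe j k * 2 powr ((s - d_over_p TYPE('d) p) * real j)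
      = (2 powr (- sqrt (real j) + (d_over_p TYPE('d) p - s) * real j) * 2 powr ((s - d_over_p TYPE('d) p) * real j)) *
        level_sum j k powr (d_over_p TYPE('d) p / real CARD('d))"
    by (simp only: probe_def mult_ac)
  ultimately show ?thesis by (simp only:)
qed

lemma probe_seq_layer:
  shows "ell_finite p (scale_coeff p s probe_seq j)"
    and "layer p s probe_seq j \<le> 2 powr (- sqrt (real j)) * layer_bound j"
proof -
  have "ell_finite p (scale_coeff p s probe_seq j) \<and> ell_norm p (scale_coeff p s probe_seq j) \<le> 2 powr (- sqrt (real j)) * layer_bound j"
  proof (cases "p = \<infinity>")
    case True
    have "scale_coeff p s probe_seq j ik \<le> 2 powr (- sqrt (real j))" for ik
      using scale_coeff_probe_seq[where j=j and i="fst ik" and k="snd ik"] True by (simp add: d_over_p_def)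
    moreover have "0 < real CARD('i) * (real (card L) * (real j + 1) * (2 * real j + 1) ^ CARD('d)) + 1"
      by (intro add_nonneg_pos) auto
    then have "layer_bound j = 1" unfolding layer_bound_def using True by simp
    ultimately show ?thesis using True
      by (auto simp: ell_finite_def ell_norm_def intro!: bdd_aboveI2 cSUP_least)
  next
    case False
    let ?p = "real_of_ereal p"
    have p': "0 < ?p" using p_pos False by (rule real_of_ereal_pos_finite)
    define f where "f ik = scale_coeff p s probe_seq j ik powr ?p" for ik :: "'i \<times> (int ^ 'd)"
    \<comment> \<open>The power p undoes the exponent 1/p of \<open>level_sum\<close>; the p-th
      power of the layer norm becomes a plain sum of level sums.\<close>
    have f: "f (i, k) = 2 powr (- (sqrt (real j) * ?p)) * level_sum j k" for i k
      unfolding f_def scale_coeff_probe_seq using False p' level_sum_nonneg[of j k]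
      by (simp add: powr_mult powr_powr d_over_p_def)
    define K where "K = {k. level_sum j k \<noteq> 0}"
    have K: "finite K" unfolding K_def by (rule level_sum_support)
    have supp: "f ik = 0" if "snd ik \<notin> K" for ik
      using that f[of "fst ik" "snd ik"] by (simp add: K_def)
    have sf: "f summable_on UNIV"
    proof (rule finite_nonzero_values_imp_summable_on)
      have "{x \<in> UNIV. f x \<noteq> 0} \<subseteq> UNIV \<times> K"
      proof
        fix x assume "x \<in> {x \<in> UNIV. f x \<noteq> 0}"
        then have "f x \<noteq> 0" by simp
        then have "snd x \<in> K" using supp[of x] by blast
        then show "x \<in> UNIV \<times> K" by (simp add: mem_Times_iff)
      qed
      then show "finite {x \<in> UNIV. f x \<noteq> 0}" by (rule finite_subset) (use K in simp)
    qed
    have I: "infsum f UNIV \<le> 2 powr (- (sqrt (real j) * ?p)) * (real CARD('i) * (real (card L) * (real j + 1) * (2 * real j + 1) ^ CARD('d)) + 1)"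
    proof -
      have "infsum f UNIV = infsum f (UNIV \<times> K)" by (rule infsum_cong_neutral) (simp_all add: supp mem_Times_iff)
      also have "\<dots> = (\<Sum>ik\<in>UNIV \<times> K. f ik)" using K by simp
      also have "\<dots> = (\<Sum>i\<in>(UNIV::'i set). \<Sum>k\<in>K. f (i, k))" using K by (simp add: sum.cartesian_product)
      also have "\<dots> = 2 powr (- (sqrt (real j) * ?p)) * (real CARD('i) * (\<Sum>k\<in>K. level_sum j k))"
        unfolding f sum_distrib_left[symmetric] by simp
      also have "\<dots> \<le> 2 powr (- (sqrt (real j) * ?p)) * (real CARD('i) * (real (card L) * (real j + 1) * (2 * real j + 1) ^ CARD('d)) + 1)"
        proof (rule mult_left_mono)
          show "real CARD('i) * (\<Sum>k\<in>K. level_sum j k) \<le> real CARD('i) * (real (card L) * (real j + 1) * (2 * real j + 1) ^ CARD('d)) + 1"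
            using mult_left_mono[OF sum_level_sum_le[OF K, of j], of "real CARD('i)"] by linarith
        qed simp
      finally show ?thesis .
    qed
    have "0 \<le> infsum f UNIV" by (rule infsum_nonneg) (simp add: f_def)
    then have "infsum f UNIV powr (1 / ?p) \<le> (2 powr (- (sqrt (real j) * ?p)) * (real CARD('i) * (real (card L) * (real j + 1) * (2 * real j + 1) ^ CARD('d)) + 1)) powr (1 / ?p)"
      by (rule powr_mono2[rotated, OF _ I]) (use p' in simp)
    also have "\<dots> = 2 powr (- sqrt (real j)) * layer_bound j"
      using p' by (simp add: powr_mult powr_powr layer_bound_def)
    finally have norm_le: "infsum f UNIV powr (1 / ?p) \<le> 2 powr (- sqrt (real j)) * layer_bound j" .
    have f_eq: "f = (\<lambda>ik. scale_coeff p s probe_seq j ik powr ?p)" by (rule ext) (rule f_def)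
    show ?thesis using False sf norm_le unfolding ell_finite_def ell_norm_def f_eq by simp
  qed
  then show "ell_finite p (scale_coeff p s probe_seq j)"
    "layer p s probe_seq j \<le> 2 powr (- sqrt (real j)) * layer_bound j"
    by (simp_all add: layer_eq_ell_norm)
qed

lemma layer_probe_seq_nonneg: "0 \<le> layer p s probe_seq j"
  unfolding layer_eq_ell_norm using probe_seq_layer(1) by (intro ell_norm_nonneg) auto

text \<open>Half of the damping 2^(-sqrt j) pays for the weight. The other half still dominates the
  polynomial growth of the layer bound, which gives summability for every q.\<close>

lemma probe_seq_weighted_finite:
  "ell_finite q (\<lambda>j. 2 powr (sqrt (real j) / 2) * layer p s probe_seq j)"
proof -
  define b where "b = 1 / real_of_ereal p"
  define A where "A = real CARD('i) * real (card L) + 1"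
  define K where "K = A powr b"
  define E where "E = (real CARD('d) + 1) * b"
  define u where "u j = 2 powr (- sqrt (real j) / 2) * (K * (2 * real j + 1) powr E)" for j
  have A: "1 \<le> A" by (simp add: A_def)
  then have K: "0 < K" by (simp add: K_def)
  have b: "0 \<le> b" using p_pos by (cases p) (auto simp: b_def)
  have layer_bound_le: "layer_bound j \<le> K * (2 * real j + 1) powr E" for j
  proof -
    define x where "x = 2 * real j + 1"
    have x: "1 \<le> x" "real j + 1 \<le> x" by (simp_all add: x_def)
    have "(real j + 1) * x ^ CARD('d) \<le> x * x ^ CARD('d)" using x by (intro mult_right_mono) auto
    then have "(A - 1) * ((real j + 1) * x ^ CARD('d)) \<le> (A - 1) * x ^ (CARD('d) + 1)"
      using A by (intro mult_left_mono) auto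
    moreover have "1 \<le> x ^ (CARD('d) + 1)" using x by (intro one_le_power)
    ultimately have "(A - 1) * ((real j + 1) * x ^ CARD('d)) + 1 \<le> A * x ^ (CARD('d) + 1)"
      unfolding left_diff_distrib by linarith
    moreover have "0 \<le> (A - 1) * ((real j + 1) * x ^ CARD('d)) + 1" using A x by (intro add_nonneg_nonneg mult_nonneg_nonneg) auto
    ultimately have "((A - 1) * ((real j + 1) * x ^ CARD('d)) + 1) powr b \<le> (A * x ^ (CARD('d) + 1)) powr b"
      using b by (intro powr_mono2) auto
    also have "\<dots> = K * (x ^ (CARD('d) + 1)) powr b" using A x by (simp add: powr_mult K_def)
    also have "(x ^ (CARD('d) + 1)) powr b = x powr E"
      using x by (simp add: E_def powr_powr[symmetric] powr_realpow[symmetric] add.commute del: power_Suc)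
    finally show ?thesis by (simp add: layer_bound_def A_def x_def b_def mult_ac)
  qed
  have le: "2 powr (sqrt (real j) / 2) * layer p s probe_seq j \<le> 1 * u j" for j
  proof -
    have "2 powr (sqrt (real j) / 2) * layer p s probe_seq j \<le> 2 powr (sqrt (real j) / 2) * (2 powr (- sqrt (real j)) * layer_bound j)"
      by (intro mult_left_mono probe_seq_layer) auto
    also have "\<dots> = (2 powr (sqrt (real j) / 2) * 2 powr (- sqrt (real j))) * layer_bound j" by (rule mult.assoc[symmetric])
    also have "2 powr (sqrt (real j) / 2) * 2 powr (- sqrt (real j)) = 2 powr (- sqrt (real j) / 2)"
      unfolding powr_add[symmetric] by simp
    also have "2 powr (- sqrt (real j) / 2) * layer_bound j \<le> u j"
      unfolding u_def by (intro mult_left_mono layer_bound_le) auto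
    finally show ?thesis by simp
  qed
  have u0: "0 \<le> u j" for j using K by (simp add: u_def)
  have "(\<lambda>j. 2 powr (- sqrt (real j) / 2) * (K * (2 * real j + 1) powr E)) \<longlonglongrightarrow> 0"
    using K by real_asymp
  then have lim: "u \<longlonglongrightarrow> 0" unfolding u_def[abs_def] .
  have "ell_finite q u"
  proof (cases "q = \<infinity>")
    case True
    have "Bseq u" using lim by (intro convergent_imp_Bseq) (auto simp: convergent_def)
    then obtain K where "\<And>n. \<bar>u n\<bar> \<le> K" by (auto simp: Bseq_def)
    then have "u n \<le> K" for n using abs_le_D1 by blast
    then show ?thesis using True unfolding ell_finite_def by (auto intro!: bdd_aboveI2[where M=K])
  next
    case False
    define r where "r = real_of_ereal q"
    have r: "0 < r" unfolding r_def using q_pos False by (rule real_of_ereal_pos_finite)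
    have "(\<lambda>j. (2 powr (- sqrt (real j) / 2) * (K * (2 * real j + 1) powr E)) powr r) \<in> O(\<lambda>j. 1 / real j ^ 2)"
      using K r by real_asymp
    then have O: "(\<lambda>j. u j powr r) \<in> O(\<lambda>j. 1 / real j ^ 2)" unfolding u_def .
    have "summable (\<lambda>j. u j powr r)"
      using inverse_power_summable[of 2, where 'a=real]
      by (intro summable_comparison_test_bigo[OF _ O]) (simp add: inverse_eq_divide)
    then show ?thesis using False by (simp add: ell_finite_def summable_on_UNIV_nonneg_real_iff r_def)
  qed
  then show ?thesis
    by (rule ell_finite_scaled(1)[OF q_pos _ u0 _ le]) (auto simp: layer_probe_seq_nonneg)
qed

text \<open>Allowing multipliers that grow like \<open>2^(sqrt j / 2)\<close> reduces the continuity of \<open>\<omega> \<mapsto> \<omega> g\<close> to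
  finitely many coordinates, whatever \<open>q\<close> is.\<close>

lemma multiplied_probe_norm:
  "\<exists>K\<ge>0. \<forall>\<theta> B. 0 \<le> B \<longrightarrow> (\<forall>j. \<bar>\<theta> j\<bar> \<le> B * 2 powr (sqrt (real j) / 2)) \<longrightarrow>
     (\<lambda>(i::'i) j k. of_real (\<theta> j * probe j k)) \<in> besov_seq p q s \<and>
     besov_norm p q s (\<lambda>(i::'i) j k. of_real (\<theta> j * probe j k)) \<le> K * B"
proof -
  define w where "w j = 2 powr (sqrt (real j) / 2) * layer p s probe_seq j" for j
  have w0: "0 \<le> w j" for j by (simp add: w_def layer_probe_seq_nonneg)
  have w: "ell_finite q w" unfolding w_def by (rule probe_seq_weighted_finite)
  define R where "R = 2 * 2 powr (1 / real_of_ereal p)"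
  have R0: "0 \<le> R" by (simp add: R_def)
  define K where "K = 2 * R * 2 powr (1 / real_of_ereal q) * ell_norm q w"
  have "0 \<le> K" using ell_norm_nonneg[OF w0 w] R0 by (simp add: K_def)
  moreover have "(\<lambda>(i::'i) j k. of_real (\<theta> j * probe j k)) \<in> besov_seq p q s \<and>
     besov_norm p q s (\<lambda>(i::'i) j k. of_real (\<theta> j * probe j k)) \<le> K * B"
    if B: "0 \<le> B" and \<theta>: "\<forall>j. \<bar>\<theta> j\<bar> \<le> B * 2 powr (sqrt (real j) / 2)" for \<theta> B
  proof -
    define c where "c = (\<lambda>(i::'i) j k. of_real (\<theta> j * probe j k) :: complex)"
    have sc: "scale_coeff p s c j ik \<le> \<bar>\<theta> j\<bar> * scale_coeff p s probe_seq j ik" for j ik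
      by (simp add: c_def probe_seq_def norm_mult abs_mult mult.assoc)
    have fin: "ell_finite p (scale_coeff p s c j)" for j
      by (rule ell_finite_scaled(1)[OF p_pos probe_seq_layer(1) _ _ sc]) auto
    have lay: "layer p s c j \<le> R * \<bar>\<theta> j\<bar> * layer p s probe_seq j" for j
      using ell_finite_scaled(2)[OF p_pos probe_seq_layer(1) _ _ sc[where j=j]]
      by (simp add: layer_eq_ell_norm R_def mult_ac)
    have lay2: "layer p s c j \<le> (R * B) * w j" for j
    proof -
      have "R * \<bar>\<theta> j\<bar> * layer p s probe_seq j \<le> R * (B * 2 powr (sqrt (real j) / 2)) * layer p s probe_seq j"
        using \<theta> R0 layer_probe_seq_nonneg by (intro mult_right_mono mult_left_mono) auto
      then show ?thesis using lay[of j] by (simp add: w_def mult_ac)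
    qed
    have nn: "0 \<le> layer p s c j" for j unfolding layer_eq_ell_norm using fin by (intro ell_norm_nonneg) auto
    have RB: "0 \<le> R * B" using R0 B by simp
    note q_fin = ell_finite_scaled[OF q_pos w w0 nn lay2 RB]
    have "c \<in> besov_seq p q s" using fin q_fin(1) p_pos by (simp add: mem_besov_seq_iff)
    moreover have "besov_norm p q s c \<le> K * B"
      unfolding besov_norm_eq_ell_norm[OF q_pos q_fin(1)] using q_fin(2) by (simp add: K_def mult_ac)
    ultimately show "(\<lambda>(i::'i) j k. of_real (\<theta> j * probe j k)) \<in> besov_seq p q s \<and>
     besov_norm p q s (\<lambda>(i::'i) j k. of_real (\<theta> j * probe j k)) \<le> K * B" unfolding c_def by blast
  qed
  ultimately show ?thesis by blast
qed

end

section \<open>Random multiples of the probe\<close>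

text \<open>Clamping defines the random sequence on all real sequences without enlarging its range,
  so no restriction to the compact cube is carried along.\<close>

definition clamp01 :: "real \<Rightarrow> real" where
  "clamp01 u = min 1 (max 0 u)"

lemma clamp01_id: "0 \<le> u \<Longrightarrow> u \<le> 1 \<Longrightarrow> clamp01 u = u"
  by (simp add: clamp01_def)

lemma clamp01_bounds: "0 \<le> clamp01 u" "clamp01 u \<le> 1"
  by (auto simp: clamp01_def)

lemma clamp01_diff: "\<bar>clamp01 u - clamp01 v\<bar> \<le> \<bar>u - v\<bar>"
  by (auto simp: clamp01_def)

definition random_sequences :: "(nat \<Rightarrow> real) measure" where
  "random_sequences = PiM UNIV (\<lambda>_. uniform_measure lborel {0..1})"

lemma prob_space_uniform01: "prob_space (uniform_measure lborel {0..1::real})"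
  by (intro prob_space_uniform_measure) auto

lemma prob_space_random_sequences: "prob_space random_sequences"
  unfolding random_sequences_def by (intro prob_space_PiM prob_space_uniform01)

lemma sets_random_sequences: "sets random_sequences = sets borel"
proof -
  have "sets random_sequences = sets (PiM UNIV (\<lambda>_. borel))"
    unfolding random_sequences_def by (intro sets_PiM_cong) auto
  then show ?thesis by (simp add: sets_PiM_equal_borel)
qed

lemma space_random_sequences: "space random_sequences = UNIV"
  by (simp add: random_sequences_def space_PiM PiE_UNIV_domain)

lemma random_sequences_block:
  assumes "\<And>r. r < n \<Longrightarrow> B r \<in> sets borel"
  shows "{a. \<forall>r<n. a (N + r) \<in> B r} \<in> sets random_sequences"
    and "emeasure random_sequences {a. \<forall>r<n. a (N + r) \<in> B r} = (\<Prod>r<n. emeasure lborel ({0..1} \<inter> B r))"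
proof -
  let ?M = "\<lambda>_::nat. uniform_measure lborel {0..1::real}"
  define J where "J = (\<lambda>r. N + r) ` {..<n}"
  define C where "C i = B (i - N)" for i
  have C: "C i \<in> sets (?M i)" if "i \<in> J" for i
    using that assms by (auto simp: J_def C_def)
  have eq: "{a. \<forall>r<n. a (N + r) \<in> B r} = prod_emb UNIV ?M J (PiE J C)"
    by (auto simp: prod_emb_def J_def C_def PiE_iff space_PiM extensional_def)
  show "{a. \<forall>r<n. a (N + r) \<in> B r} \<in> sets random_sequences"
    unfolding eq random_sequences_def using C by (intro sets_PiM_I) (auto simp: J_def)
  have "emeasure random_sequences {a. \<forall>r<n. a (N + r) \<in> B r} = (\<Prod>i\<in>J. emeasure (?M i) (C i))"
    unfolding eq random_sequences_def using C prob_space_uniform01 by (intro emeasure_PiM_emb) (auto simp: J_def)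
  also have "\<dots> = (\<Prod>r<n. emeasure (uniform_measure lborel {0..1::real}) (B r))"
    unfolding J_def by (subst prod.reindex) (auto simp: C_def)
  also have "\<dots> = (\<Prod>r<n. emeasure lborel ({0..1} \<inter> B r))"
    using assms by (intro prod.cong) (auto simp: divide_ennreal_def)
  finally show "emeasure random_sequences {a. \<forall>r<n. a (N + r) \<in> B r} = (\<Prod>r<n. emeasure lborel ({0..1} \<inter> B r))" .
qed

text \<open>Taking real parts leaves an interval of length 2 \<epsilon> for u, whatever z and g > 0
  are. For g = 0 the strict inequality is never satisfied.\<close>

lemma emeasure_near_zero_of_affine:
  fixes z :: complex and g \<epsilon> :: real
  assumes "0 \<le> g" "0 \<le> \<epsilon>"
  shows "emeasure lborel {u. norm (of_real (u * g) - z) < \<epsilon> * g} \<le> ennreal (2 * \<epsilon>)"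
proof (cases "g = 0")
  case True
  then show ?thesis by simp
next
  case False
  then have g: "0 < g" using assms by simp
  have "{u. norm (of_real (u * g) - z) < \<epsilon> * g} \<subseteq> {Re z / g - \<epsilon> .. Re z / g + \<epsilon>}"
  proof
    fix u assume "u \<in> {u. norm (of_real (u * g) - z) < \<epsilon> * g}"
    then have "\<bar>u * g - Re z\<bar> < \<epsilon> * g"
      using abs_Re_le_cmod[of "of_real (u * g) - z"] by simp
    then show "u \<in> {Re z / g - \<epsilon> .. Re z / g + \<epsilon>}" using g by (auto simp: field_simps abs_less_iff)
  qed
  then have "emeasure lborel {u. norm (of_real (u * g) - z) < \<epsilon> * g} \<le> emeasure lborel {Re z / g - \<epsilon> .. Re z / g + \<epsilon>}"
    by (intro emeasure_mono) auto
  also have "\<dots> = ennreal (2 * \<epsilon>)" using assms by simp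
  finally show ?thesis .
qed

context wavelet_probe
begin

definition random_seq :: "(nat \<Rightarrow> real) \<Rightarrow> 'i \<Rightarrow> nat \<Rightarrow> int ^ 'd \<Rightarrow> complex" where
  "random_seq a i j k = of_real (clamp01 (a (coarse j)) * probe j k)"

lemma random_seq_in_besov: "random_seq a \<in> besov_seq p q s"
proof -
  obtain K where K: "0 \<le> K" "\<forall>\<theta> B. 0 \<le> B \<longrightarrow> (\<forall>j. \<bar>\<theta> j\<bar> \<le> B * 2 powr (sqrt (real j) / 2)) \<longrightarrow>
     (\<lambda>(i::'i) j k. of_real (\<theta> j * probe j k)) \<in> besov_seq p q s \<and>
     besov_norm p q s (\<lambda>(i::'i) j k. of_real (\<theta> j * probe j k)) \<le> K * B"
    using multiplied_probe_norm by blast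
  have bound: "\<bar>clamp01 (a (coarse j))\<bar> \<le> 1 * 2 powr (sqrt (real j) / 2)" for j
  proof -
    have "(1::real) \<le> 2 powr (sqrt (real j) / 2)" by (intro ge_one_powr_ge_zero) auto
    then show ?thesis using clamp01_bounds[of "a (coarse j)"] by linarith
  qed
  have "(\<lambda>(i::'i) j k. of_real (clamp01 (a (coarse j)) * probe j k)) \<in> besov_seq p q s"
    using K(2)[rule_format, OF zero_le_one bound] by blast
  moreover have "random_seq a = (\<lambda>i j k. of_real (clamp01 (a (coarse j)) * probe j k))"
    by (intro ext) (simp add: random_seq_def)
  ultimately show ?thesis by simp
qed

lemma random_seq_continuous: "continuous_map euclidean (besov_topology p q s) random_seq"
  unfolding continuous_map_def
proof (intro conjI allI impI)
  show "random_seq \<in> topspace euclidean \<rightarrow> topspace (besov_topology p q s)"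
    using random_seq_in_besov by auto
next
  fix U :: "('i \<Rightarrow> nat \<Rightarrow> int ^ 'd \<Rightarrow> complex) set" assume U: "openin (besov_topology p q s) U"
  obtain K where K: "0 \<le> K" "\<forall>\<theta> B. 0 \<le> B \<longrightarrow> (\<forall>j. \<bar>\<theta> j\<bar> \<le> B * 2 powr (sqrt (real j) / 2)) \<longrightarrow>
     (\<lambda>(i::'i) j k. of_real (\<theta> j * probe j k)) \<in> besov_seq p q s \<and>
     besov_norm p q s (\<lambda>(i::'i) j k. of_real (\<theta> j * probe j k)) \<le> K * B"
    using multiplied_probe_norm by blast
  have "open {a. random_seq a \<in> U}"
  proof (subst open_subopen, intro ballI)
    fix a assume "a \<in> {a. random_seq a \<in> U}"
    then obtain e where e: "0 < e" "\<And>y. y \<in> besov_seq p q s \<Longrightarrow> besov_norm p q s (y - random_seq a) < e \<Longrightarrow> y \<in> U"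
      using U unfolding openin_besov_topology by blast
    \<comment> \<open>Dividing by \<open>K + 1\<close> ensures \<open>K * B < e\<close> also when
      \<open>K = 0\<close>.\<close>
    define B where "B = e / (K + 1)"
    have B: "0 < B" using e K by (simp add: B_def add_nonneg_pos)
    have "K * B \<le> (K + 1) * B - B" by (simp add: algebra_simps)
    also have "(K + 1) * B = e" using K by (simp add: B_def)
    finally have KB: "K * B < e" using B by linarith
    have "filterlim (\<lambda>j. B * 2 powr (sqrt (real j) / 2)) at_top sequentially" using B by real_asymp
    then obtain j0 where j0: "\<And>j. j \<ge> j0 \<Longrightarrow> 1 \<le> B * 2 powr (sqrt (real j) / 2)"
      unfolding filterlim_at_top eventually_sequentially by blast
    \<comment> \<open>Scales from \<open>j0\<close> on need no control, since there the weight
      already exceeds the largest possible difference 1; below, \<open>coarse j \<le> j\<close>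
      means that only coordinates up to \<open>j0\<close> matter.\<close>
    define V where "V = (\<Inter>m\<in>{..j0}. {b. \<bar>b m - a m\<bar> < B})"
    have "open V" unfolding V_def
      by (intro open_INT ballI open_Collect_less continuous_intros continuous_on_product_coordinates) auto
    moreover have "a \<in> V" using B by (simp add: V_def)
    moreover have "V \<subseteq> {a. random_seq a \<in> U}"
    proof
      fix b assume b: "b \<in> V"
      define \<theta> where "\<theta> j = clamp01 (b (coarse j)) - clamp01 (a (coarse j))" for j
      have bound: "\<bar>\<theta> j\<bar> \<le> B * 2 powr (sqrt (real j) / 2)" for j
      proof (cases "j \<ge> j0")
        case True
        have "\<bar>\<theta> j\<bar> \<le> 1" using clamp01_bounds[of "b (coarse j)"] clamp01_bounds[of "a (coarse j)"]
          by (auto simp: \<theta>_def)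
        then show ?thesis using j0[OF True] by linarith
      next
        case False
        have "coarse j \<le> j" unfolding coarse_def by (meson diff_le_self div_le_dividend le_trans)
        then have "\<bar>b (coarse j) - a (coarse j)\<bar> < B" using b False by (simp add: V_def)
        then have "\<bar>\<theta> j\<bar> \<le> B * 1" using clamp01_diff[of "b (coarse j)" "a (coarse j)"] by (simp add: \<theta>_def)
        also have "B * 1 \<le> B * 2 powr (sqrt (real j) / 2)"
          using B by (intro mult_left_mono ge_one_powr_ge_zero) auto
        finally show ?thesis .
      qed
      have "besov_norm p q s (\<lambda>(i::'i) j k. of_real (\<theta> j * probe j k)) \<le> K * B"
        using K(2)[rule_format, OF less_imp_le[OF B] bound] by blast
      moreover have "random_seq b - random_seq a = (\<lambda>i j k. of_real (\<theta> j * probe j k))"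
        by (intro ext) (simp add: random_seq_def \<theta>_def left_diff_distrib)
      ultimately have "random_seq b \<in> U" using KB by (intro e(2) random_seq_in_besov) simp
      then show "b \<in> {a. random_seq a \<in> U}" by simp
    qed
    ultimately show "\<exists>T. open T \<and> a \<in> T \<and> T \<subseteq> {a. random_seq a \<in> U}" by blast
  qed
  then show "openin euclidean {a \<in> topspace euclidean. random_seq a \<in> U}" by simp
qed

section \<open>The image measure of the probe and a criterion for Haar-null Borel sets\<close>

definition besov_borel :: "('i \<Rightarrow> nat \<Rightarrow> int ^ 'd \<Rightarrow> complex) measure" where
  "besov_borel = sigma (besov_seq p q s) (Collect (openin (besov_topology p q s)))"

lemma openin_subset_Pow: "Collect (openin (besov_topology p q s)) \<subseteq> Pow (besov_seq p q s)"
  using openin_subset[of "besov_topology p q s"] by auto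

lemma space_besov_borel: "space besov_borel = besov_seq p q s"
  unfolding besov_borel_def by (rule space_measure_of[OF openin_subset_Pow])

lemma sets_besov_borel: "sets besov_borel = borel_sets_of (besov_topology p q s)"
  unfolding besov_borel_def borel_sets_of_def by (subst sets_measure_of[OF openin_subset_Pow]) simp

lemma random_seq_measurable: "random_seq \<in> measurable random_sequences besov_borel"
  unfolding besov_borel_def
proof (rule measurable_measure_of[OF openin_subset_Pow])
  show "random_seq \<in> space random_sequences \<rightarrow> besov_seq p q s" using random_seq_in_besov by auto
next
  fix U :: "('i \<Rightarrow> nat \<Rightarrow> int ^ 'd \<Rightarrow> complex) set" assume "U \<in> Collect (openin (besov_topology p q s))"
  then have "openin euclidean {a \<in> topspace euclidean. random_seq a \<in> U}"
    using random_seq_continuous unfolding continuous_map_def by blast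
  then have "open (random_seq -` U)" by (simp add: vimage_def)
  then show "random_seq -` U \<inter> space random_sequences \<in> sets random_sequences"
    by (simp add: space_random_sequences sets_random_sequences)
qed

text \<open>By clamping, the range is already attained on the cube of sequences in [0, 1], which is
  compact by Tychonoff's theorem.\<close>

lemma compact_range_random_seq: "compactin (besov_topology p q s) (range random_seq)"
proof -
  define \<Omega> where "\<Omega> = PiE (UNIV :: nat set) (\<lambda>_. {0..1::real})"
  have "compactin (product_topology (\<lambda>_::nat. euclidean) UNIV) \<Omega>"
    unfolding \<Omega>_def compactin_PiE by auto
  then have "compactin euclidean \<Omega>" by (simp add: euclidean_product_topology)
  then have "compactin (besov_topology p q s) (random_seq ` \<Omega>)"
    by (rule image_compactin[OF _ random_seq_continuous])
  moreover have "range random_seq = random_seq ` \<Omega>"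
  proof
    show "range random_seq \<subseteq> random_seq ` \<Omega>"
    proof
      fix c assume "c \<in> range random_seq"
      then obtain a where "c = random_seq a" by blast
      then have "c = random_seq (\<lambda>n. clamp01 (a n))"
        using clamp01_bounds by (simp add: random_seq_def[abs_def] clamp01_id)
      then show "c \<in> random_seq ` \<Omega>" using clamp01_bounds by (auto simp: \<Omega>_def)
    qed
  qed auto
  ultimately show ?thesis by simp
qed

text \<open>A random sequence lies in x + E exactly when subtracting x from it gives a member of E.
  The witness for the compact support is the full range of \<open>random_seq\<close>.\<close>

lemma haar_null_borelI:
  assumes E: "E \<in> borel_sets_of (besov_topology p q s)"
    and null: "\<And>x. x \<in> besov_seq p q s \<Longrightarrow> AE a in random_sequences. random_seq a - x \<notin> E"
  shows "haar_null_borel (besov_topology p q s) E"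
  unfolding haar_null_borel_def
proof (intro conjI exI[of _ "distr random_sequences besov_borel random_seq"])
  interpret \<nu>: prob_space random_sequences by (rule prob_space_random_sequences)
  let ?\<mu> = "distr random_sequences besov_borel random_seq"
  show "E \<in> borel_sets_of (besov_topology p q s)" by fact
  show "prob_space ?\<mu>" by (intro \<nu>.prob_space_distr random_seq_measurable)
  show "space ?\<mu> = topspace (besov_topology p q s)" by (simp add: space_besov_borel)
  show "sets ?\<mu> = borel_sets_of (besov_topology p q s)" by (simp add: sets_besov_borel)
  show "\<exists>K. compactin (besov_topology p q s) K \<and> K \<in> sets ?\<mu> \<and> emeasure ?\<mu> K = 1"
  proof (intro exI[of _ "range random_seq"] conjI compact_range_random_seq)
    interpret B: sigma_algebra "besov_seq p q s" "borel_sets_of (besov_topology p q s)"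
      using sigma_algebra_borel_sets_of[of "besov_topology p q s"] by simp
    have "closedin (besov_topology p q s) (range random_seq)"
      by (intro compactin_imp_closedin Hausdorff_besov_topology p_pos q_pos compact_range_random_seq)
    then have "openin (besov_topology p q s) (besov_seq p q s - range random_seq)" "range random_seq \<subseteq> besov_seq p q s"
      unfolding closedin_def by simp_all
    then have "besov_seq p q s - range random_seq \<in> borel_sets_of (besov_topology p q s)"
      unfolding borel_sets_of_def by (intro sigma_sets.Basic) simp
    then have "besov_seq p q s - (besov_seq p q s - range random_seq) \<in> borel_sets_of (besov_topology p q s)"
      by (rule B.compl_sets)
    also have "besov_seq p q s - (besov_seq p q s - range random_seq) = range random_seq"
      using \<open>range random_seq \<subseteq> besov_seq p q s\<close> by blast
    finally show K: "range random_seq \<in> sets ?\<mu>" by (simp add: sets_besov_borel)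
    have "emeasure ?\<mu> (range random_seq) = emeasure random_sequences (random_seq -` range random_seq \<inter> space random_sequences)"
      using K by (intro emeasure_distr random_seq_measurable) simp
    also have "random_seq -` range random_seq \<inter> space random_sequences = space random_sequences" by auto
    finally show "emeasure ?\<mu> (range random_seq) = 1" by (simp add: \<nu>.emeasure_space_1)
  qed
  show "\<forall>x\<in>topspace (besov_topology p q s). emeasure ?\<mu> ((\<lambda>a. x + a) ` E) = 0"
  proof
    fix x :: "'i \<Rightarrow> nat \<Rightarrow> int ^ 'd \<Rightarrow> complex"
    assume "x \<in> topspace (besov_topology p q s)"
    then have x: "x \<in> besov_seq p q s" by simp
    show "emeasure ?\<mu> ((\<lambda>a. x + a) ` E) = 0"
    \<comment> \<open>For a translate outside the sigma-algebra \<open>emeasure\<close> has the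
      default value 0, so only the measurable case needs an argument.\<close>
    proof (cases "(\<lambda>a. x + a) ` E \<in> sets ?\<mu>")
      case True
      then have "emeasure ?\<mu> ((\<lambda>a. x + a) ` E) = emeasure random_sequences (random_seq -` ((\<lambda>a. x + a) ` E) \<inter> space random_sequences)"
        by (intro emeasure_distr random_seq_measurable) simp
      also have "random_seq -` ((\<lambda>a. x + a) ` E) \<inter> space random_sequences
          = {a \<in> space random_sequences. random_seq a \<in> (\<lambda>a. x + a) ` E}" by blast
      also have "emeasure random_sequences \<dots> = 0"
      proof (rule emeasure_eq_0_AE)
        show "AE a in random_sequences. random_seq a \<notin> (\<lambda>a. x + a) ` E"
          using null[OF x]
        proof eventually_elim
          case (elim a)
          then show ?case by (auto simp: algebra_simps)
        qed
      qed
      finally show ?thesis .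
    qed (rule emeasure_notin_sets)
  qed
qed

end

section \<open>Borel-Cantelli: large coefficients at some ancestor of every cube\<close>

text \<open>Integer \<open>div\<close> rounds down, so this is the index of the enclosing dyadic
  cube also for negative coordinates.\<close>

definition ancestor :: "nat \<Rightarrow> int ^ 'd \<Rightarrow> int ^ 'd::finite" where
  "ancestor n K = (\<chi> c. K $ c div 2 ^ n)"

context wavelet_probe
begin

text \<open>\<open>K\<close> indexes a cube of scale \<open>T (J\<^sup>2 + J)\<close>, and \<open>r\<close> selects its ancestor of scale \<open>T (J\<^sup>2 + r)\<close>.\<close>

definition robust :: "('i \<Rightarrow> nat \<Rightarrow> int ^ 'd \<Rightarrow> complex) \<Rightarrow> nat \<Rightarrow> int ^ 'd \<Rightarrow> nat \<Rightarrow> bool" where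
  "robust c J K r \<longleftrightarrow> (\<forall>(i, l, b)\<in>L.
     2 powr (- (real (CARD('d) * T + 1) * real J)) * probe (T * (J\<^sup>2 + r) + l) (subcube l (ancestor (T * (J - r)) K) b)
       \<le> norm (c i (T * (J\<^sup>2 + r) + l) (subcube l (ancestor (T * (J - r)) K) b)))"

text \<open>These are the cubes of scale T (J^2 + J) with corners in [-J, J]^d. The box grows with
  J, so every point of the space is eventually inside.\<close>

definition index_box :: "nat \<Rightarrow> (int ^ 'd) set" where
  "index_box J = {K. \<forall>c. \<bar>K $ c\<bar> \<le> int (J * 2 ^ (T * (J\<^sup>2 + J)))}"

definition eventually_robust :: "('i \<Rightarrow> nat \<Rightarrow> int ^ 'd \<Rightarrow> complex) \<Rightarrow> bool" where
  "eventually_robust c \<longleftrightarrow> (\<exists>J0. \<forall>J\<ge>J0. \<forall>K\<in>index_box J. \<exists>r<J. robust c J K r)"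

lemma finite_index_box: "finite (index_box J)"
  unfolding index_box_def by (rule int_box_card)

lemma borel_eventually_robust:
  "{c \<in> besov_seq p q s. eventually_robust c} \<in> borel_sets_of (besov_topology p q s)"
proof -
  interpret B: sigma_algebra "besov_seq p q s :: ('i \<Rightarrow> nat \<Rightarrow> int ^ 'd \<Rightarrow> complex) set" "borel_sets_of (besov_topology p q s)"
    using sigma_algebra_borel_sets_of[of "besov_topology p q s"] by simp
  have rob: "{c \<in> besov_seq p q s. robust c J K r} \<in> borel_sets_of (besov_topology p q s)" for J K r
  proof -
    have "{c \<in> besov_seq p q s. \<forall>x\<in>L. 2 powr (- (real (CARD('d) * T + 1) * real J)) * probe (T * (J\<^sup>2 + r) + fst (snd x)) (subcube (fst (snd x)) (ancestor (T * (J - r)) K) (snd (snd x)))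
       \<le> norm (c (fst x) (T * (J\<^sup>2 + r) + fst (snd x)) (subcube (fst (snd x)) (ancestor (T * (J - r)) K) (snd (snd x))))} \<in> borel_sets_of (besov_topology p q s)"
      using finite_L by (intro B.sets_Collect_finite_All borel_sets_of_coeff_ge p_pos q_pos) auto
    then show ?thesis by (simp add: robust_def case_prod_beta)
  qed
  have "{c \<in> besov_seq p q s. \<exists>r\<in>{..<J}. robust c J K r} \<in> borel_sets_of (besov_topology p q s)" for J K
    using rob by (intro B.sets_Collect_finite_Ex) auto
  then have "{c \<in> besov_seq p q s. \<forall>K\<in>index_box J. \<exists>r\<in>{..<J}. robust c J K r} \<in> borel_sets_of (besov_topology p q s)" for J
    using finite_index_box by (intro B.sets_Collect_finite_All) auto
  then have "{c \<in> besov_seq p q s. \<exists>J0. \<forall>J. J0 \<le> J \<longrightarrow> (\<forall>K\<in>index_box J. \<exists>r\<in>{..<J}. robust c J K r)} \<in> borel_sets_of (besov_topology p q s)"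
    by (intro B.sets_Collect_countable_Ex B.sets_Collect_countable_All B.sets_Collect_imp B.sets_Collect_const)
  then show ?thesis by (simp add: eventually_robust_def Bex_def)
qed

text \<open>All positions attached to the ancestor number r have scales T (J^2 + r) + l with 1 \<le>
  l \<le> T, hence the same random coordinate J^2 + r. Failure at r is an event about this
  coordinate alone, of probability at most 2 \<epsilon> for each triplet, and the J failures are
  independent.\<close>

lemma random_seq_block_failure:
  fixes x :: "'i \<Rightarrow> nat \<Rightarrow> int ^ 'd \<Rightarrow> complex"
  shows "{a. \<forall>r<J. \<not> robust (random_seq a - x) J K r} \<in> sets random_sequences"
    and "emeasure random_sequences {a. \<forall>r<J. \<not> robust (random_seq a - x) J K r}
       \<le> ennreal ((real (card L) * (2 * 2 powr (- (real (CARD('d) * T + 1) * real J)))) ^ J)"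
proof -
  define \<epsilon> where "\<epsilon> = 2 powr (- (real (CARD('d) * T + 1) * real J))"
  have \<epsilon>: "0 \<le> \<epsilon>" by (simp add: \<epsilon>_def)
  define g where "g r y = probe (T * (J\<^sup>2 + r) + fst (snd y)) (subcube (fst (snd y)) (ancestor (T * (J - r)) K) (snd (snd y)))"
    for r and y :: "'i \<times> nat \<times> (int ^ 'd)"
  define z where "z r y = x (fst y) (T * (J\<^sup>2 + r) + fst (snd y)) (subcube (fst (snd y)) (ancestor (T * (J - r)) K) (snd (snd y)))"
    for r and y :: "'i \<times> nat \<times> (int ^ 'd)"
  define B where "B r = (\<Union>y\<in>L. {u. norm (of_real (clamp01 u * g r y) - z r y) < \<epsilon> * g r y})" for r
  have cont: "continuous_on UNIV clamp01" unfolding clamp01_def[abs_def] by (intro continuous_intros)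
  have "open {u. norm (of_real (clamp01 u * g r y) - z r y) < \<epsilon> * g r y}" for r y
    by (intro open_Collect_less continuous_intros cont)
  then have Bm: "B r \<in> sets borel" for r unfolding B_def by (intro borel_open open_UN) auto
  have eq: "\<not> robust (random_seq a - x) J K r \<longleftrightarrow> a (J\<^sup>2 + r) \<in> B r" for a r
  proof -
    have co: "coarse (T * (J\<^sup>2 + r) + fst (snd y)) = J\<^sup>2 + r" if "y \<in> L" for y
      using that L_bounds[of "fst y" "fst (snd y)" "snd (snd y)"] by (intro coarse_add) auto
    show ?thesis
      unfolding robust_def B_def case_prod_beta \<epsilon>_def[symmetric] g_def[symmetric]
      by (auto simp: not_le random_seq_def co g_def z_def)
  qed
  have sets: "{a. \<forall>r<J. \<not> robust (random_seq a - x) J K r} = {a. \<forall>r<J. a (J\<^sup>2 + r) \<in> B r}"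
    unfolding eq ..
  show "{a. \<forall>r<J. \<not> robust (random_seq a - x) J K r} \<in> sets random_sequences"
    unfolding sets using Bm by (intro random_sequences_block)
  have Ble: "emeasure lborel ({0..1} \<inter> B r) \<le> ennreal (real (card L) * (2 * \<epsilon>))" for r
  proof -
    have "{0..1} \<inter> B r \<subseteq> (\<Union>y\<in>L. {u. norm (of_real (u * g r y) - z r y) < \<epsilon> * g r y})"
      by (auto simp: B_def clamp01_id)
    moreover have op: "{u. norm (of_real (u * g r y) - z r y) < \<epsilon> * g r y} \<in> sets lborel" for y
      unfolding sets_lborel by (intro borel_open open_Collect_less continuous_intros)
    ultimately have "emeasure lborel ({0..1} \<inter> B r) \<le> emeasure lborel (\<Union>y\<in>L. {u. norm (of_real (u * g r y) - z r y) < \<epsilon> * g r y})"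
      using finite_L by (intro emeasure_mono sets.finite_UN) auto
    also have "\<dots> \<le> (\<Sum>y\<in>L. emeasure lborel {u. norm (of_real (u * g r y) - z r y) < \<epsilon> * g r y})"
      using finite_L op by (intro emeasure_subadditive_finite) auto
    also have "\<dots> \<le> (\<Sum>y\<in>L. ennreal (2 * \<epsilon>))"
      using \<epsilon> by (intro sum_mono emeasure_near_zero_of_affine) (auto simp: g_def probe_nonneg)
    also have "\<dots> = ennreal (real (card L) * (2 * \<epsilon>))"
      using \<epsilon> by (simp add: ennreal_mult' ennreal_of_nat_eq_real_of_nat)
    finally show ?thesis .
  qed
  have "emeasure random_sequences {a. \<forall>r<J. a (J\<^sup>2 + r) \<in> B r} = (\<Prod>r<J. emeasure lborel ({0..1} \<inter> B r))"
    using Bm by (intro random_sequences_block)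
  also have "\<dots> \<le> (\<Prod>r<J. ennreal (real (card L) * (2 * \<epsilon>)))" using Ble by (intro prod_mono_ennreal)
  also have "\<dots> = ennreal ((real (card L) * (2 * \<epsilon>)) ^ J)" using \<epsilon> by (simp add: ennreal_power)
  finally show "emeasure random_sequences {a. \<forall>r<J. \<not> robust (random_seq a - x) J K r}
       \<le> ennreal ((real (card L) * (2 * 2 powr (- (real (CARD('d) * T + 1) * real J)))) ^ J)"
    unfolding sets \<epsilon>_def .
qed

text \<open>The number of cubes contributes 2^(d T (J^2 + J)) and the J failures 2^(-(d T + 1) J^2).
  The surplus 1 in the constant leaves 2^(-J^2), against which the remaining factors, polynomial or
  of the form C^J, are negligible.\<close>

lemma AE_eventually_robust:
  fixes x :: "'i \<Rightarrow> nat \<Rightarrow> int ^ 'd \<Rightarrow> complex"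
  shows "AE a in random_sequences. eventually_robust (random_seq a - x)"
proof -
  interpret \<nu>: prob_space random_sequences by (rule prob_space_random_sequences)
  define D where "D = real CARD('d)"
  \<comment> \<open>The added 2 makes the base exceed 1 even if \<open>L\<close> is empty, as the
    asymptotic comparison requires.\<close>
  define C where "C = 2 * real (card L) * 2 powr (D * real T) + 2"
  have C: "2 \<le> C" by (simp add: C_def)
  define N where "N J = (\<Union>K\<in>index_box J. {a. \<forall>r<J. \<not> robust (random_seq a - x) J K r})" for J
  have Nm: "N J \<in> sets random_sequences" for J
    unfolding N_def using random_seq_block_failure(1) by (intro sets.finite_UN finite_index_box) auto
  have bound: "measure random_sequences (N J) \<le> (2 * real J + 1) powr D * C powr real J * 2 powr (- (real J)\<^sup>2)" for J
  proof -
    define \<eta> where "\<eta> = real (card L) * (2 * 2 powr (- (real (CARD('d) * T + 1) * real J)))"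
    have \<eta>: "0 \<le> \<eta>" by (simp add: \<eta>_def)
    have "emeasure random_sequences (N J) \<le> (\<Sum>K\<in>index_box J. emeasure random_sequences {a. \<forall>r<J. \<not> robust (random_seq a - x) J K r})"
      unfolding N_def using random_seq_block_failure(1) by (intro emeasure_subadditive_finite finite_index_box) auto
    also have "\<dots> \<le> (\<Sum>K\<in>index_box J. ennreal (\<eta> ^ J))"
      unfolding \<eta>_def by (intro sum_mono random_seq_block_failure)
    also have "\<dots> = ennreal (real (card (index_box J)) * \<eta> ^ J)"
      using \<eta> by (simp add: ennreal_mult' ennreal_of_nat_eq_real_of_nat)
    finally have "measure random_sequences (N J) \<le> real (card (index_box J)) * \<eta> ^ J"
      using \<eta> by (simp add: measure_def enn2real_leI)
    also have "\<dots> \<le> ((2 * real J + 1) * 2 ^ (T * (J\<^sup>2 + J))) ^ CARD('d) * \<eta> ^ J"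
    proof (rule mult_right_mono)
      have "card (index_box J) \<le> (2 * (J * 2 ^ (T * (J\<^sup>2 + J))) + 1) ^ CARD('d)"
        unfolding index_box_def by (rule int_box_card)
      also have "\<dots> \<le> ((2 * J + 1) * 2 ^ (T * (J\<^sup>2 + J))) ^ CARD('d)"
      proof (intro power_mono)
        have "1 \<le> (2::nat) ^ (T * (J\<^sup>2 + J))" by simp
        then show "2 * (J * 2 ^ (T * (J\<^sup>2 + J))) + 1 \<le> (2 * J + 1) * 2 ^ (T * (J\<^sup>2 + J))"
          unfolding add_mult_distrib mult.assoc mult_1 by linarith
      qed simp
      finally have "real (card (index_box J)) \<le> real (((2 * J + 1) * 2 ^ (T * (J\<^sup>2 + J))) ^ CARD('d))" by (rule of_nat_mono)
      then show "real (card (index_box J)) \<le> ((2 * real J + 1) * 2 ^ (T * (J\<^sup>2 + J))) ^ CARD('d)"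
        by (simp only: of_nat_power of_nat_mult of_nat_add of_nat_numeral of_nat_1)
    qed (use \<eta> in simp)
    also have "((2 * real J + 1) * 2 ^ (T * (J\<^sup>2 + J))) ^ CARD('d) = (2 * real J + 1) powr D * 2 powr (D * real T * ((real J)\<^sup>2 + real J))"
      by (simp add: power_mult_distrib D_def powr_realpow[symmetric] powr_powr mult_ac)
    also have "\<eta> ^ J = (2 * real (card L)) ^ J * 2 powr (- ((D * real T + 1) * (real J)\<^sup>2))"
      by (simp add: \<eta>_def power_mult_distrib D_def powr_realpow[symmetric] powr_powr power2_eq_square mult_ac add_ac)
    also have "(2 * real J + 1) powr D * 2 powr (D * real T * ((real J)\<^sup>2 + real J)) * ((2 * real (card L)) ^ J * 2 powr (- ((D * real T + 1) * (real J)\<^sup>2)))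
        = (2 * real J + 1) powr D * ((2 * real (card L)) ^ J * 2 powr (D * real T * real J)) * 2 powr (- (real J)\<^sup>2)"
    proof -
      have "2 powr (D * real T * ((real J)\<^sup>2 + real J)) * 2 powr (- ((D * real T + 1) * (real J)\<^sup>2)) = 2 powr (D * real T * real J) * 2 powr (- (real J)\<^sup>2)"
        unfolding powr_add[symmetric] by (intro arg_cong[where f="\<lambda>t. 2 powr t"]) (simp add: algebra_simps)
      then show ?thesis by (metis (no_types, opaque_lifting) mult.assoc mult.left_commute)
    qed
    also have "(2 * real (card L)) ^ J * 2 powr (D * real T * real J) = (C - 2) ^ J"
      by (simp add: C_def power_mult_distrib powr_realpow[symmetric] powr_powr)
    also have "(C - 2) ^ J \<le> C ^ J" using C by (intro power_mono) auto
    also have "C ^ J = C powr real J" using C by (simp add: powr_realpow)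
    finally show ?thesis by (simp add: mult_right_mono mult_left_mono)
  qed
  have robust: "eventually_robust (random_seq a - x)" if "eventually (\<lambda>J. a \<in> space random_sequences - N J) sequentially" for a
  proof -
    have "\<exists>J0. \<forall>J\<ge>J0. a \<in> space random_sequences - N J"
      using that by (simp only: eventually_sequentially)
    then obtain J0 where J0: "\<forall>J\<ge>J0. a \<in> space random_sequences - N J" ..
    have "\<exists>r<J. robust (random_seq a - x) J K r" if "J0 \<le> J" "K \<in> index_box J" for J K
    proof -
      have "a \<notin> N J" using J0 that by blast
      then have "a \<notin> {a. \<forall>r<J. \<not> robust (random_seq a - x) J K r}" using that unfolding N_def by blast
      then show ?thesis by blast
    qed
    then show ?thesis unfolding eventually_robust_def by blast
  qed
  have "AE a in random_sequences. eventually (\<lambda>J. a \<in> space random_sequences - N J) sequentially"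
  proof (rule borel_cantelli_AE1[OF Nm])
    have D: "0 < D" by (simp add: D_def)
    have "1 < C" using C by simp
    with D have O: "(\<lambda>J. (2 * real J + 1) powr D * C powr real J * 2 powr (- (real J)\<^sup>2)) \<in> O(\<lambda>J. 1 / real J ^ 2)"
      by real_asymp
    have sq: "summable (\<lambda>J. norm (1 / real J ^ 2))"
      using inverse_power_summable[of 2, where 'a=real] by (simp add: inverse_eq_divide)
    have "summable (\<lambda>J. (2 * real J + 1) powr D * C powr real J * 2 powr (- (real J)\<^sup>2))"
      by (rule summable_comparison_test_bigo[OF sq O])
    then show "summable (\<lambda>J. measure random_sequences (N J))"
      using bound by (rule_tac summable_comparison_test') auto
  qed (simp add: \<nu>.emeasure_eq_measure)
  then show ?thesis by (rule AE_mp) (rule AE_I2, rule impI, rule robust)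
qed

lemma haar_null_not_eventually_robust:
  "haar_null_borel (besov_topology p q s) (besov_seq p q s - {c. eventually_robust c})"
proof (rule haar_null_borelI)
  interpret B: sigma_algebra "besov_seq p q s :: ('i \<Rightarrow> nat \<Rightarrow> int ^ 'd \<Rightarrow> complex) set" "borel_sets_of (besov_topology p q s)"
    using sigma_algebra_borel_sets_of[of "besov_topology p q s"] by simp
  have "besov_seq p q s - {c \<in> besov_seq p q s. eventually_robust c} \<in> borel_sets_of (besov_topology p q s)"
    by (rule B.compl_sets[OF borel_eventually_robust])
  also have "besov_seq p q s - {c \<in> besov_seq p q s. eventually_robust c} = besov_seq p q s - {c. eventually_robust c}" by blast
  finally show "besov_seq p q s - {c. eventually_robust c} \<in> borel_sets_of (besov_topology p q s)" .
next
  fix x :: "'i \<Rightarrow> nat \<Rightarrow> int ^ 'd \<Rightarrow> complex"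
  show "AE a in random_sequences. random_seq a - x \<notin> besov_seq p q s - {c. eventually_robust c}"
    using AE_eventually_robust[of x] by eventually_elim simp
qed

end

section \<open>Lower bounds for the divergence exponent\<close>

lemma divergence_exponent_ge:
  fixes c :: "'i \<Rightarrow> nat \<Rightarrow> int ^ 'd \<Rightarrow> complex"
  assumes C: "0 < C" and large: "\<And>n. \<exists>i j k. n \<le> j \<and> C * 2 powr (\<gamma> * real j) \<le> norm (c i j k * wavelet \<psi> i j k x)"
  shows "ereal \<gamma> \<le> divergence_exponent \<psi> c x"
proof -
  obtain i j k where ijk: "\<And>n. n \<le> j n" "\<And>n. C * 2 powr (\<gamma> * real (j n)) \<le> norm (c (i n) (j n) (k n) * wavelet \<psi> (i n) (j n) (k n) x)"
    using large by metis
  have "filterlim j at_top sequentially"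
    using ijk(1) by (intro filterlim_at_top_mono[OF filterlim_ident] always_eventually) auto
  then show ?thesis unfolding divergence_exponent_def using C ijk(2) by (intro Sup_upper imageI CollectI exI[of _ C] conjI exI[of _ i] exI[of _ j] exI[of _ k] allI)
qed

lemma ereal_le_from_approx:
  assumes "\<And>\<epsilon>::real. 0 < \<epsilon> \<Longrightarrow> ereal (\<gamma> - K * \<epsilon>) \<le> x" "0 \<le> K"
  shows "ereal \<gamma> \<le> x"
proof (rule ccontr)
  assume "\<not> ereal \<gamma> \<le> x"
  then have "x < ereal \<gamma>" by simp
  then obtain z where z: "x < ereal z" "ereal z < ereal \<gamma>" using ereal_dense2 by blast
  define \<epsilon> where "\<epsilon> = (\<gamma> - z) / (K + 1)"
  have "0 < \<epsilon>" using z assms(2) by (simp add: \<epsilon>_def)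
  have "K * \<epsilon> \<le> (K + 1) * \<epsilon>" using \<open>0 < \<epsilon>\<close> by (simp add: algebra_simps)
  also have "\<dots> = \<gamma> - z" using assms(2) by (simp add: \<epsilon>_def)
  finally have "ereal z \<le> ereal (\<gamma> - K * \<epsilon>)" by simp
  also have "\<dots> \<le> x" by (rule assms(1)[OF \<open>0 < \<epsilon>\<close>])
  finally show False using z(1) by simp
qed

lemma floor_power_div:
  "a \<le> b \<Longrightarrow> \<lfloor>2 ^ b * (x::real)\<rfloor> div 2 ^ (b - a) = \<lfloor>2 ^ a * x\<rfloor>"
proof -
  assume "a \<le> b"
  then have "(2::real) ^ b = 2 ^ a * 2 ^ (b - a)" by (simp add: power_add[symmetric])
  then have "2 ^ a * x = 2 ^ b * x / real_of_int (2 ^ (b - a))" by simp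
  then show ?thesis using floor_divide_real_eq_div[of "2 ^ (b - a)" "2 ^ b * x"] by simp
qed

lemma abs_floor_power_le:
  fixes m n :: nat
  assumes "\<bar>x :: real\<bar> \<le> real m"
  shows "\<bar>\<lfloor>2 ^ n * x\<rfloor>\<bar> \<le> int (m * 2 ^ n)"
proof -
  have "\<bar>2 ^ n * x\<bar> \<le> 2 ^ n * real m" using assms by (simp add: abs_mult)
  then have "\<bar>2 ^ n * x\<bar> \<le> real_of_int (int (m * 2 ^ n))" by (simp add: mult.commute)
  then have "\<lfloor>2 ^ n * x\<rfloor> \<le> int (m * 2 ^ n)" "- int (m * 2 ^ n) \<le> \<lfloor>2 ^ n * x\<rfloor>" by linarith+
  then show ?thesis by linarith
qed

context wavelet_probe
begin

text \<open>Some ancestor of the cube of x is good; rescale that ancestor to the unit cube and apply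
  the covering to the image y of x. The triplet found there gives a wavelet at least C0 at x and a
  coefficient guaranteed by robustness. As m is dictated by the random choice, membership in the
  grid is asserted for every v that suits it.\<close>

lemma robust_large_coefficient:
  fixes x :: "real ^ 'd"
  assumes c: "eventually_robust c"
    and cover: "\<And>y :: real ^ 'd. (\<And>n. 0 \<le> y $ n \<and> y $ n < 1) \<Longrightarrow> \<exists>(i, l, b)\<in>L. C0 \<le> norm (\<psi> i (2 ^ l *\<^sub>R y - vec_of_int b))"
    and C0: "0 < C0"
  obtains J0 where "\<And>J. J \<ge> J0 \<Longrightarrow> \<exists>m i l k. J\<^sup>2 \<le> m \<and> m < J\<^sup>2 + J \<and> 1 \<le> l \<and> l \<le> T \<and>
      (\<forall>v\<le>T * m. (\<forall>n. 2 ^ (T * m - v) dvd \<lfloor>2 ^ (T * m) * x $ n\<rfloor>) \<longrightarrow> k \<in> grid (T * m + l) v) \<and>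
      C0 * 2 powr (- (real (CARD('d) * T + 1) * real J)) * probe (T * m + l) k
        \<le> norm (c i (T * m + l) k * wavelet \<psi> i (T * m + l) k x)"
proof -
  obtain J1 where J1: "\<And>J K. J \<ge> J1 \<Longrightarrow> K \<in> index_box J \<Longrightarrow> \<exists>r<J. robust c J K r"
    using c unfolding eventually_robust_def by blast
  obtain N :: nat where N: "norm x \<le> real N" using real_arch_simple by blast
  have xN: "\<bar>x $ n\<bar> \<le> real N" for n using component_le_norm_cart[of x n] N by linarith
  show thesis
  proof (rule that[of "max J1 N"])
    fix J assume J: "max J1 N \<le> J"
    define K :: "int ^ 'd" where "K = (\<chi> n. \<lfloor>2 ^ (T * (J\<^sup>2 + J)) * x $ n\<rfloor>)"
    have xJ: "\<bar>x $ n\<bar> \<le> real J" for n using xN[of n] J by linarith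
    then have "K \<in> index_box J" unfolding index_box_def K_def using abs_floor_power_le by simp
    then obtain r where r: "r < J" "robust c J K r" using J1 J by auto
    define m where "m = J\<^sup>2 + r"
    \<comment> \<open>Needed because \<open>grid\<close> only admits cubes with corners in
      [-m, m]^d, while x is known to lie in [-J, J]^d.\<close>
    have Jm: "J \<le> m" using r(1) by (cases J) (auto simp: m_def power2_eq_square)
    define k0 :: "int ^ 'd" where "k0 = (\<chi> n. \<lfloor>2 ^ (T * m) * x $ n\<rfloor>)"
    have anc: "ancestor (T * (J - r)) K = k0"
    proof -
      have "J\<^sup>2 + J - m = J - r" by (simp add: m_def)
      then have "T * (J - r) = T * (J\<^sup>2 + J) - T * m" by (metis diff_mult_distrib2)
      moreover have "T * m \<le> T * (J\<^sup>2 + J)" using r(1) by (intro mult_le_mono2) (simp add: m_def)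
      ultimately show ?thesis by (simp add: ancestor_def K_def k0_def floor_power_div)
    qed
    define y where "y = 2 ^ (T * m) *\<^sub>R x - vec_of_int k0"
    have "0 \<le> y $ n \<and> y $ n < 1" for n
      by (simp add: y_def k0_def vec_of_int_def) linarith
    then obtain i l b where ilb: "(i, l, b) \<in> L" "C0 \<le> norm (\<psi> i (2 ^ l *\<^sub>R y - vec_of_int b))"
      using cover[of y] by blast
    define k where "k = subcube l k0 b"
    have l: "1 \<le> l" "l \<le> T" using L_bounds[OF ilb(1)] by auto
    have "2 ^ l *\<^sub>R y - vec_of_int b = 2 ^ (T * m + l) *\<^sub>R x - vec_of_int k"
      by (simp add: vec_eq_iff y_def k_def subcube_def vec_of_int_def power_add algebra_simps)
    then have wav: "C0 \<le> norm (wavelet \<psi> i (T * m + l) k x)" using ilb(2) by (simp add: wavelet_def)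
    have "2 powr (- (real (CARD('d) * T + 1) * real J)) * probe (T * m + l) k \<le> norm (c i (T * m + l) k)"
      using r(2) ilb(1) unfolding robust_def anc m_def[symmetric] k_def by blast
    then have "C0 * (2 powr (- (real (CARD('d) * T + 1) * real J)) * probe (T * m + l) k)
        \<le> norm (wavelet \<psi> i (T * m + l) k x) * norm (c i (T * m + l) k)"
      using wav C0 probe_nonneg by (intro mult_mono) auto
    then have "C0 * 2 powr (- (real (CARD('d) * T + 1) * real J)) * probe (T * m + l) k
        \<le> norm (c i (T * m + l) k * wavelet \<psi> i (T * m + l) k x)"
      by (simp add: norm_mult mult_ac)
    moreover have "k \<in> grid (T * m + l) v" if "v \<le> T * m" "\<forall>n. 2 ^ (T * m - v) dvd \<lfloor>2 ^ (T * m) * x $ n\<rfloor>" for v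
    proof -
      have "\<bar>x $ n\<bar> \<le> real m" for n using xJ[of n] Jm by linarith
      then have "\<bar>k0 $ n\<bar> \<le> int (m * 2 ^ (T * m))" for n unfolding k0_def using abs_floor_power_le by simp
      moreover have "2 ^ (T * m - v) dvd k0 $ n" for n using that by (simp add: k0_def)
      ultimately show ?thesis unfolding grid_def k_def using ilb(1) that(1) by blast
    qed
    ultimately show "\<exists>m i l k. J\<^sup>2 \<le> m \<and> m < J\<^sup>2 + J \<and> 1 \<le> l \<and> l \<le> T \<and>
      (\<forall>v\<le>T * m. (\<forall>n. 2 ^ (T * m - v) dvd \<lfloor>2 ^ (T * m) * x $ n\<rfloor>) \<longrightarrow> k \<in> grid (T * m + l) v) \<and>
      C0 * 2 powr (- (real (CARD('d) * T + 1) * real J)) * probe (T * m + l) k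
        \<le> norm (c i (T * m + l) k * wavelet \<psi> i (T * m + l) k x)"
      using r(1) l by (intro exI[of _ m] exI[of _ i] exI[of _ l] exI[of _ k]) (simp add: m_def)
  qed
qed

text \<open>At scale j \<ge> J^2 the robustness loss 2^(-A J) and the damping 2^(-sqrt j) together
  cost at most 2^((A + 1) sqrt j), less than 2^(\<epsilon> j) for large j. The approximation is
  assumed at all m of a block because the good one is unknown.\<close>

lemma divergence_exponent_ge_of_robust:
  fixes x :: "real ^ 'd"
  assumes c: "eventually_robust c"
    and cover: "\<And>y :: real ^ 'd. (\<And>n. 0 \<le> y $ n \<and> y $ n < 1) \<Longrightarrow> \<exists>(i, l, b)\<in>L. C0 \<le> norm (\<psi> i (2 ^ l *\<^sub>R y - vec_of_int b))"
    and C0: "0 < C0" and \<gamma>: "\<gamma> \<le> d_over_p TYPE('d) p - s"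
    and approx: "\<exists>\<^sub>F J in sequentially. \<forall>m. J\<^sup>2 \<le> m \<longrightarrow> m < J\<^sup>2 + J \<longrightarrow> (\<exists>v\<le>T * m.
        (\<forall>n. 2 ^ (T * m - v) dvd \<lfloor>2 ^ (T * m) * x $ n\<rfloor>) \<and>
        d_over_p TYPE('d) p * real v \<le> (d_over_p TYPE('d) p - s - \<gamma>) * real (T * m))"
  shows "ereal \<gamma> \<le> divergence_exponent \<psi> c x"
proof (rule ereal_le_from_approx)
  fix \<epsilon> :: real assume \<epsilon>: "0 < \<epsilon>"
  define A where "A = real (CARD('d) * T + 1)"
  obtain J0 where J0: "\<And>J. J \<ge> J0 \<Longrightarrow> \<exists>m i l k. J\<^sup>2 \<le> m \<and> m < J\<^sup>2 + J \<and> 1 \<le> l \<and> l \<le> T \<and>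
      (\<forall>v\<le>T * m. (\<forall>n. 2 ^ (T * m - v) dvd \<lfloor>2 ^ (T * m) * x $ n\<rfloor>) \<longrightarrow> k \<in> grid (T * m + l) v) \<and>
      C0 * 2 powr (- (A * real J)) * probe (T * m + l) k
        \<le> norm (c i (T * m + l) k * wavelet \<psi> i (T * m + l) k x)"
    unfolding A_def using robust_large_coefficient[OF c cover C0, of x] by blast
  show "ereal (\<gamma> - 1 * \<epsilon>) \<le> divergence_exponent \<psi> c x"
  proof (rule divergence_exponent_ge[OF C0])
    fix n
    \<comment> \<open>This threshold ensures (A + 1) sqrt j \<le> \<epsilon> j.\<close>
    obtain J1 :: nat where J1: "(A + 1) / \<epsilon> \<le> real J1" using real_arch_simple by blast
    obtain J where J: "J \<ge> max (max J0 J1) n" and ap: "\<forall>m. J\<^sup>2 \<le> m \<longrightarrow> m < J\<^sup>2 + J \<longrightarrow> (\<exists>v\<le>T * m.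
        (\<forall>n. 2 ^ (T * m - v) dvd \<lfloor>2 ^ (T * m) * x $ n\<rfloor>) \<and>
        d_over_p TYPE('d) p * real v \<le> (d_over_p TYPE('d) p - s - \<gamma>) * real (T * m))"
      using approx unfolding frequently_sequentially by blast
    have JJ: "J0 \<le> J" "J1 \<le> J" "n \<le> J" using J by auto
    from J0[OF JJ(1)] obtain m i l k where m: "J\<^sup>2 \<le> m" "m < J\<^sup>2 + J" and l: "1 \<le> l" "l \<le> T"
      and gr: "\<And>v. v \<le> T * m \<Longrightarrow> (\<forall>n. 2 ^ (T * m - v) dvd \<lfloor>2 ^ (T * m) * x $ n\<rfloor>) \<Longrightarrow> k \<in> grid (T * m + l) v"
      and big: "C0 * 2 powr (- (A * real J)) * probe (T * m + l) k
        \<le> norm (c i (T * m + l) k * wavelet \<psi> i (T * m + l) k x)"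
      by blast
    from ap m obtain v where v: "v \<le> T * m" "\<forall>n. 2 ^ (T * m - v) dvd \<lfloor>2 ^ (T * m) * x $ n\<rfloor>"
      "d_over_p TYPE('d) p * real v \<le> (d_over_p TYPE('d) p - s - \<gamma>) * real (T * m)" by blast
    define j where "j = T * m + l"
    have "J\<^sup>2 \<le> 1 * m" using m(1) by simp
    also have "\<dots> \<le> T * m" using T_pos by (intro mult_le_mono1)
    finally have "J\<^sup>2 \<le> j" by (simp add: j_def)
    then have "(real J)\<^sup>2 \<le> real j" by (metis of_nat_le_iff of_nat_power)
    then have Jj: "real J \<le> sqrt (real j)" by (rule real_le_rsqrt)
    have "(A + 1) / \<epsilon> \<le> sqrt (real j)" using J1 JJ(2) Jj by linarith
    then have "(A + 1) * sqrt (real j) \<le> \<epsilon> * sqrt (real j) * sqrt (real j)"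
      using \<epsilon> by (intro mult_right_mono) (simp_all add: field_simps)
    then have "A * sqrt (real j) + sqrt (real j) \<le> \<epsilon> * real j" by (simp add: algebra_simps)
    moreover have "A * real J \<le> A * sqrt (real j)" using Jj by (intro mult_left_mono) (auto simp: A_def)
    ultimately have eps: "A * real J + sqrt (real j) \<le> \<epsilon> * real j" by linarith
    have "(d_over_p TYPE('d) p - s - \<gamma>) * real (T * m) \<le> (d_over_p TYPE('d) p - s - \<gamma>) * real j"
      using \<gamma> by (intro mult_left_mono) (auto simp: j_def)
    then have "\<gamma> * real j \<le> (d_over_p TYPE('d) p - s) * real j - d_over_p TYPE('d) p * real v"
      using v(3) by (simp add: left_diff_distrib)
    then have "(\<gamma> - \<epsilon>) * real j \<le> - (A * real J) + (- sqrt (real j) + (d_over_p TYPE('d) p - s) * real j - d_over_p TYPE('d) p * real v)"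
      using eps by (simp add: left_diff_distrib)
    then have "2 powr ((\<gamma> - \<epsilon>) * real j) \<le> 2 powr (- (A * real J) + (- sqrt (real j) + (d_over_p TYPE('d) p - s) * real j - d_over_p TYPE('d) p * real v))"
      by (intro powr_mono) auto
    also have "\<dots> = 2 powr (- (A * real J)) * 2 powr (- sqrt (real j) + (d_over_p TYPE('d) p - s) * real j - d_over_p TYPE('d) p * real v)"
      by (rule powr_add)
    also have "\<dots> \<le> 2 powr (- (A * real J)) * probe j k"
      unfolding j_def by (intro mult_left_mono probe_ge gr v) auto
    finally have "C0 * 2 powr ((\<gamma> - \<epsilon>) * real j) \<le> C0 * (2 powr (- (A * real J)) * probe j k)"
      using C0 by (intro mult_left_mono) auto
    then have "C0 * 2 powr ((\<gamma> - 1 * \<epsilon>) * real j) \<le> norm (c i j k * wavelet \<psi> i j k x)"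
      using big by (simp add: j_def mult.assoc)
    moreover have "n \<le> j"
    proof -
      have "J \<le> J\<^sup>2" by (simp add: power2_eq_square)
      then show ?thesis using JJ(3) \<open>J\<^sup>2 \<le> j\<close> by linarith
    qed
    ultimately show "\<exists>i j k. n \<le> j \<and> C0 * 2 powr ((\<gamma> - 1 * \<epsilon>) * real j) \<le> norm (c i j k * wavelet \<psi> i j k x)"
      by blast
  qed
qed simp

text \<open>Take v = T m: every dyadic cube of scale T m has its corner in 2^(-T m) Z^d, and the
  resulting loss d/p is exactly the distance from d/p - s to -s.\<close>

lemma divergence_exponent_ge_minus_s:
  fixes x :: "real ^ 'd"
  assumes c: "eventually_robust c"
    and cover: "\<And>y :: real ^ 'd. (\<And>n. 0 \<le> y $ n \<and> y $ n < 1) \<Longrightarrow> \<exists>(i, l, b)\<in>L. C0 \<le> norm (\<psi> i (2 ^ l *\<^sub>R y - vec_of_int b))"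
    and C0: "0 < C0"
  shows "ereal (- s) \<le> divergence_exponent \<psi> c x"
  using d_over_p_nonneg
  by (intro divergence_exponent_ge_of_robust[OF c cover C0] eventually_frequently always_eventually) auto

text \<open>If the level set were null, so would be its union with the superlevel set, and this
  union contains the image in \<open>B\<close> of the unit cube under the digit map, where \<delta>
  \<ge> \<gamma>. Pulling back would make the unit cube negligible. The construction requires \<tau>
  < 1; at \<gamma> = -s, where \<tau> = 1, the open set \<open>B\<close> itself takes the place of
  the image.\<close>

lemma hausdorff_measure_level_set_nonzero:
  fixes B :: "(real ^ 'd) set"
  assumes p: "p \<noteq> \<infinity>" and c: "eventually_robust c" "c \<in> besov_seq p q s"
    and cover: "\<And>y :: real ^ 'd. (\<And>n. 0 \<le> y $ n \<and> y $ n < 1) \<Longrightarrow> \<exists>(i, l, b)\<in>L. C0 \<le> norm (\<psi> i (2 ^ l *\<^sub>R y - vec_of_int b))"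
    and C0: "0 < C0" and \<psi>: "\<And>i. fast_decaying (\<psi> i)" and B: "open B" "B \<noteq> {}"
    and \<gamma>: "- s \<le> \<gamma>" "\<gamma> \<le> d_over_p TYPE('d) p - s"
  shows "hausdorff_measure (real CARD('d) - s * real_of_ereal p - \<gamma> * real_of_ereal p)
    {x \<in> B. divergence_exponent \<psi> c x = ereal \<gamma>} \<noteq> 0"
proof
  let ?p = "real_of_ereal p"
  define S where "S = {x \<in> B. divergence_exponent \<psi> c x = ereal \<gamma>}"
  define Z where "Z = {x. ereal \<gamma> < divergence_exponent \<psi> c x}"
  \<comment> \<open>Chosen so that d \<tau> is the claimed dimension; equivalently, the
    approximation loss \<tau> d/p is the distance from d/p - s down to \<gamma>.\<close>
  define \<tau> where "\<tau> = (d_over_p TYPE('d) p - s - \<gamma>) * ?p / real CARD('d)"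
  assume "hausdorff_measure (real CARD('d) - s * ?p - \<gamma> * ?p) {x \<in> B. divergence_exponent \<psi> c x = ereal \<gamma>} = 0"
  then have S0: "hausdorff_measure (real CARD('d) - s * ?p - \<gamma> * ?p) S = 0" by (simp add: S_def)
  have Z0: "hausdorff_measure (real CARD('d) - s * ?p - \<gamma> * ?p) Z = 0"
    unfolding Z_def by (rule hausdorff_measure_divergence_superlevel_critical[OF p_pos p q_pos c(2) \<psi> \<gamma>(2)])
  have p': "0 < ?p" using p_pos p by (rule real_of_ereal_pos_finite)
  have \<kappa>: "d_over_p TYPE('d) p = real CARD('d) / ?p" using p by (simp add: d_over_p_def)
  have D: "real CARD('d) - s * ?p - \<gamma> * ?p = real CARD('d) * \<tau>"
    using p' by (simp add: \<tau>_def \<kappa> field_simps)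
  have \<kappa>\<tau>: "d_over_p TYPE('d) p * \<tau> = d_over_p TYPE('d) p - s - \<gamma>"
    using p' by (simp add: \<tau>_def \<kappa>)
  have \<tau>0: "0 \<le> \<tau>" using \<gamma>(2) p' by (simp add: \<tau>_def)
  have "hausdorff_measure (real CARD('d) * \<tau>) (\<Union>n. if n = (0::nat) then S else Z) = 0"
    using S0 Z0 unfolding D by (intro hausdorff_measure_zero_UN) simp
  then have SZ: "hausdorff_measure (real CARD('d) * \<tau>) (S \<union> Z) = 0"
    by (rule hausdorff_measure_zero_subset) (auto intro: exI[of _ "1::nat"] split: if_splits)
  have mem: "x \<in> S \<union> Z" if "x \<in> B" "ereal \<gamma> \<le> divergence_exponent \<psi> c x" for x
    using that by (auto simp: S_def Z_def order.order_iff_strict)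
  show False
  proof (cases "\<gamma> = - s")
    case True
    then have "\<tau> = 1" using p' by (simp add: \<tau>_def \<kappa>)
    have le: "\<bar>x $ n - y $ n\<bar> \<le> 1 * dist x y powr \<tau>" for x y :: "real ^ 'd" and n
      using component_le_norm_cart[of "x - y" n] by (simp add: dist_norm \<open>\<tau> = 1\<close>)
    have "negligible {x \<in> B. x \<in> S \<union> Z}"
      by (rule negligible_inverse_Hoelder_preimage[OF le \<tau>0 _ SZ]) simp
    moreover have "{x \<in> B. x \<in> S \<union> Z} = B"
      using mem divergence_exponent_ge_minus_s[OF c(1) cover C0] True by blast
    ultimately show False using B open_not_negligible by metis
  next
    case False
    define Q where "Q = {x :: real ^ 'd. \<forall>n. 0 \<le> x $ n \<and> x $ n < 1}"
    have \<tau>1: "\<tau> < 1"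
    proof -
      have "d_over_p TYPE('d) p * \<tau> < d_over_p TYPE('d) p * 1" using False \<gamma>(1) by (simp add: \<kappa>\<tau>)
      moreover have "0 < d_over_p TYPE('d) p" using p' by (simp add: \<kappa>)
      ultimately show ?thesis by (simp only: mult_less_cancel_left_pos)
    qed
    obtain \<phi> :: "real ^ 'd \<Rightarrow> real ^ 'd" and C where \<phi>: "0 \<le> C" "\<phi> ` Q \<subseteq> B"
      "\<forall>x\<in>Q. \<forall>y\<in>Q. \<forall>n. 0 < \<tau> \<longrightarrow> \<bar>x $ n - y $ n\<bar> \<le> C * dist (\<phi> x) (\<phi> y) powr \<tau>"
      "\<forall>x\<in>Q. \<forall>\<epsilon>>0. \<exists>\<^sub>F J in sequentially. \<exists>v. real v \<le> (\<tau> + \<epsilon>) * real (T * J\<^sup>2) \<and>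
        (\<forall>m. J\<^sup>2 \<le> m \<longrightarrow> m < J\<^sup>2 + J \<longrightarrow> v \<le> T * m \<and> (\<forall>c. 2 ^ (T * m - v) dvd \<lfloor>2 ^ (T * m) * \<phi> x $ c\<rfloor>))"
      using dyadically_approximable_cantor_set[OF B \<tau>0 \<tau>1 T_pos] unfolding Q_def by blast
    have "ereal \<gamma> \<le> divergence_exponent \<psi> c (\<phi> x)" if x: "x \<in> Q" for x
    proof (rule ereal_le_from_approx[OF _ d_over_p_nonneg])
      fix \<epsilon> :: real assume \<epsilon>: "0 < \<epsilon>"
      show "ereal (\<gamma> - d_over_p TYPE('d) p * \<epsilon>) \<le> divergence_exponent \<psi> c (\<phi> x)"
      proof (rule divergence_exponent_ge_of_robust[OF c(1) cover C0])
        have "0 \<le> d_over_p TYPE('d) p * \<epsilon>" using \<epsilon> d_over_p_nonneg by simp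
        then show "\<gamma> - d_over_p TYPE('d) p * \<epsilon> \<le> d_over_p TYPE('d) p - s" using \<gamma>(2) by linarith
        show "\<exists>\<^sub>F J in sequentially. \<forall>m. J\<^sup>2 \<le> m \<longrightarrow> m < J\<^sup>2 + J \<longrightarrow> (\<exists>v\<le>T * m.
          (\<forall>n. 2 ^ (T * m - v) dvd \<lfloor>2 ^ (T * m) * \<phi> x $ n\<rfloor>) \<and>
          d_over_p TYPE('d) p * real v \<le> (d_over_p TYPE('d) p - s - (\<gamma> - d_over_p TYPE('d) p * \<epsilon>)) * real (T * m))"
          using \<phi>(4)[rule_format, OF x \<epsilon>]
        proof (rule frequently_elim1)
          fix J assume "\<exists>v. real v \<le> (\<tau> + \<epsilon>) * real (T * J\<^sup>2) \<and>
            (\<forall>m. J\<^sup>2 \<le> m \<longrightarrow> m < J\<^sup>2 + J \<longrightarrow> v \<le> T * m \<and> (\<forall>c. 2 ^ (T * m - v) dvd \<lfloor>2 ^ (T * m) * \<phi> x $ c\<rfloor>))"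
          then obtain v where v: "real v \<le> (\<tau> + \<epsilon>) * real (T * J\<^sup>2)"
            "\<And>m. J\<^sup>2 \<le> m \<Longrightarrow> m < J\<^sup>2 + J \<Longrightarrow> v \<le> T * m \<and> (\<forall>c. 2 ^ (T * m - v) dvd \<lfloor>2 ^ (T * m) * \<phi> x $ c\<rfloor>)" by blast
          have "d_over_p TYPE('d) p * real v \<le> (d_over_p TYPE('d) p - s - (\<gamma> - d_over_p TYPE('d) p * \<epsilon>)) * real (T * m)" if "J\<^sup>2 \<le> m" for m
          proof -
            have "T * J\<^sup>2 \<le> T * m" using that by simp
            then have "real (T * J\<^sup>2) \<le> real (T * m)" by (rule of_nat_mono)
            then have "(\<tau> + \<epsilon>) * real (T * J\<^sup>2) \<le> (\<tau> + \<epsilon>) * real (T * m)" using \<tau>0 \<epsilon> by (intro mult_left_mono) auto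
            then have "d_over_p TYPE('d) p * real v \<le> d_over_p TYPE('d) p * ((\<tau> + \<epsilon>) * real (T * m))"
              using v(1) d_over_p_nonneg by (intro mult_left_mono) auto
            also have "\<dots> = (d_over_p TYPE('d) p * \<tau> + d_over_p TYPE('d) p * \<epsilon>) * real (T * m)"
              by (simp add: distrib_left mult.assoc[symmetric])
            finally show ?thesis unfolding \<kappa>\<tau> by (simp add: algebra_simps)
          qed
          then show "\<forall>m. J\<^sup>2 \<le> m \<longrightarrow> m < J\<^sup>2 + J \<longrightarrow> (\<exists>v\<le>T * m.
            (\<forall>n. 2 ^ (T * m - v) dvd \<lfloor>2 ^ (T * m) * \<phi> x $ n\<rfloor>) \<and>
            d_over_p TYPE('d) p * real v \<le> (d_over_p TYPE('d) p - s - (\<gamma> - d_over_p TYPE('d) p * \<epsilon>)) * real (T * m))"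
            using v(2) by blast
        qed
      qed
    qed
    then have "{x \<in> Q. \<phi> x \<in> S \<union> Z} = Q" using mem \<phi>(2) by blast
    moreover have "negligible {x \<in> Q. \<phi> x \<in> S \<union> Z}"
      by (rule negligible_inverse_Hoelder_preimage[OF _ \<tau>0 \<phi>(1) SZ]) (use \<phi>(3) in blast)
    ultimately have "negligible Q" by simp
    moreover have "box 0 (1 :: real ^ 'd) \<subseteq> Q" by (auto simp: Q_def mem_box_cart intro: less_imp_le)
    ultimately have "negligible (box 0 (1 :: real ^ 'd))" by (rule negligible_subset)
    moreover have "(\<chi> n. 1 / 2) \<in> box 0 (1 :: real ^ 'd)" by (simp add: mem_box_cart)
    ultimately show False using open_not_negligible[OF open_box] by blast
  qed
qed

text \<open>The nonzero measure at exponent D bounds the dimension from below, by monotonicity of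
  nullity in the exponent. For the upper bound the level set is put into superlevel sets slightly
  below \<gamma>.\<close>

lemma hausdorff_dim_level_set:
  fixes B :: "(real ^ 'd) set"
  assumes p: "p \<noteq> \<infinity>" and c: "eventually_robust c" "c \<in> besov_seq p q s"
    and cover: "\<And>y :: real ^ 'd. (\<And>n. 0 \<le> y $ n \<and> y $ n < 1) \<Longrightarrow> \<exists>(i, l, b)\<in>L. C0 \<le> norm (\<psi> i (2 ^ l *\<^sub>R y - vec_of_int b))"
    and C0: "0 < C0" and \<psi>: "\<And>i. fast_decaying (\<psi> i)" and B: "open B" "B \<noteq> {}"
    and \<gamma>: "- s \<le> \<gamma>" "\<gamma> \<le> d_over_p TYPE('d) p - s"
  shows "hausdorff_dim {x \<in> B. divergence_exponent \<psi> c x = ereal \<gamma>}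
    = ereal (real CARD('d) - s * real_of_ereal p - \<gamma> * real_of_ereal p)"
proof -
  let ?p = "real_of_ereal p"
  define S where "S = {x \<in> B. divergence_exponent \<psi> c x = ereal \<gamma>}"
  define D where "D = real CARD('d) - s * ?p - \<gamma> * ?p"
  have p': "0 < ?p" using p_pos p by (rule real_of_ereal_pos_finite)
  have SD: "hausdorff_measure D S \<noteq> 0"
    unfolding S_def D_def by (rule hausdorff_measure_level_set_nonzero[OF p c cover C0 \<psi> B \<gamma>])
  have "D = ?p * (d_over_p TYPE('d) p - s - \<gamma>)"
    using p' p by (simp add: D_def d_over_p_def field_simps)
  then have D0: "0 \<le> D" using \<gamma>(2) p' by simp
  have sup: "hausdorff_measure \<alpha> {x. ereal \<gamma>' < divergence_exponent \<psi> c x} = 0"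
    if "0 < \<alpha>" "real CARD('d) - s * ?p - \<gamma>' * ?p < \<alpha>" for \<alpha> \<gamma>'
    by (rule hausdorff_measure_divergence_superlevel[OF p_pos p q_pos c(2) \<psi> that])
  have upper: "hausdorff_measure \<alpha> S = 0" if "D < \<alpha>" for \<alpha>
  proof (rule hausdorff_measure_zero_subset)
    \<comment> \<open>Lowering \<gamma> by this amount uses up half of the slack between D and
      \<alpha>.\<close>
    define \<gamma>' where "\<gamma>' = \<gamma> - (\<alpha> - D) / (2 * ?p)"
    have "\<gamma>' * ?p = \<gamma> * ?p - (\<alpha> - D) / 2" using p' unfolding \<gamma>'_def left_diff_distrib[of \<gamma>] by simp
    then have "real CARD('d) - s * ?p - \<gamma>' * ?p = D + (\<alpha> - D) / 2" unfolding D_def by linarith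
    then have "real CARD('d) - s * ?p - \<gamma>' * ?p < \<alpha>" using that by (simp add: field_simps)
    then show "hausdorff_measure \<alpha> {x. ereal \<gamma>' < divergence_exponent \<psi> c x} = 0"
      using that D0 by (intro sup) auto
    have "\<gamma>' < \<gamma>" using that p' by (simp add: \<gamma>'_def)
    then show "S \<subseteq> {x. ereal \<gamma>' < divergence_exponent \<psi> c x}" by (auto simp: S_def)
  qed
  \<comment> \<open>The empty set has dimension -\<infinity> by convention, so nonemptiness must be
    proved, also for D = 0.\<close>
  have "S \<noteq> {}"
  proof
    assume "S = {}"
    moreover have "hausdorff_measure D ({} :: (real ^ 'd) set) = 0"
      using upper[of "D + 1"] by (intro hausdorff_measure_zeroI exI[of _ "\<lambda>m n. {}"]) auto
    ultimately show False using SD by simp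
  qed
  have lower: "D \<le> \<alpha>" if "0 \<le> \<alpha>" "hausdorff_measure \<alpha> S = 0" for \<alpha>
    using hausdorff_measure_zero_mono_exponent[OF that(2,1), of D] SD by (meson linear)
  have "Inf (ereal ` {\<alpha>. 0 \<le> \<alpha> \<and> hausdorff_measure \<alpha> S = 0}) = ereal D"
  proof (rule antisym)
    show "ereal D \<le> Inf (ereal ` {\<alpha>. 0 \<le> \<alpha> \<and> hausdorff_measure \<alpha> S = 0})"
      using lower by (intro Inf_greatest) auto
    show "Inf (ereal ` {\<alpha>. 0 \<le> \<alpha> \<and> hausdorff_measure \<alpha> S = 0}) \<le> ereal D"
    proof (rule ereal_le_epsilon2)
      fix e :: real assume "0 < e"
      then have "D + e \<in> {\<alpha>. 0 \<le> \<alpha> \<and> hausdorff_measure \<alpha> S = 0}" using upper D0 by simp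
      then have "Inf (ereal ` {\<alpha>. 0 \<le> \<alpha> \<and> hausdorff_measure \<alpha> S = 0}) \<le> ereal (D + e)"
        by (intro Inf_lower imageI)
      then show "Inf (ereal ` {\<alpha>. 0 \<le> \<alpha> \<and> hausdorff_measure \<alpha> S = 0}) \<le> ereal D + ereal e" by simp
    qed
  qed
  then show ?thesis using \<open>S \<noteq> {}\<close> unfolding hausdorff_dim_def S_def[symmetric] D_def[symmetric] by simp
qed

lemma maximally_divergent_of_robust:
  assumes c: "eventually_robust c" "c \<in> besov_seq p q s"
    and cover: "\<And>y :: real ^ 'd. (\<And>n. 0 \<le> y $ n \<and> y $ n < 1) \<Longrightarrow> \<exists>(i, l, b)\<in>L. C0 \<le> norm (\<psi> i (2 ^ l *\<^sub>R y - vec_of_int b))"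
    and C0: "0 < C0" and \<psi>: "\<And>i. fast_decaying (\<psi> i)"
  shows "maximally_divergent \<psi> p s c UNIV"
  unfolding maximally_divergent_def
proof (intro conjI ballI impI allI)
  fix x :: "real ^ 'd"
  show ge: "ereal (- s) \<le> divergence_exponent \<psi> c x"
    by (rule divergence_exponent_ge_minus_s[OF c(1) cover C0])
  show "divergence_exponent \<psi> c x \<le> ereal (d_over_p TYPE('d) p - s)"
    by (rule divergence_exponent_le[OF p_pos q_pos c(2) \<psi>])
next
  have "AE x in lborel. divergence_exponent \<psi> c x \<le> ereal (- s)"
  proof (cases "p = \<infinity>")
    case True
    then show ?thesis using divergence_exponent_le[OF p_pos q_pos c(2) \<psi>] by (simp add: d_over_p_def)
  next
    case False
    then show ?thesis by (intro divergence_exponent_AE_le[OF p_pos _ q_pos c(2) \<psi>])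
  qed
  then show "AE x in lborel. x \<in> UNIV \<longrightarrow> divergence_exponent \<psi> c x = ereal (- s)"
  proof eventually_elim
    case (elim x)
    then show ?case using divergence_exponent_ge_minus_s[OF c(1) cover C0, of x] by (simp add: antisym)
  qed
next
  fix B :: "(real ^ 'd) set" and \<gamma>
  assume "p \<noteq> \<infinity>" "open B \<and> B \<noteq> {} \<and> B \<subseteq> UNIV" "- s \<le> \<gamma> \<and> \<gamma> \<le> d_over_p TYPE('d) p - s"
  then show "hausdorff_dim {x \<in> B. divergence_exponent \<psi> c x = ereal \<gamma>}
    = ereal (real CARD('d) - s * real_of_ereal p - \<gamma> * real_of_ereal p)"
    by (intro hausdorff_dim_level_set[OF _ c cover C0 \<psi>]) auto
qed

end

theorem mainTheorem11:
  fixes \<psi> :: "'i::finite \<Rightarrow> real ^ 'd::finite \<Rightarrow> complex"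
    and s :: real and p q :: ereal
  assumes "0 < p" and "0 < q"
    and "\<And>i. fast_decaying (\<psi> i)"
    and "dyadic_covering \<psi>"
  shows "prevalent (besov_topology p q s :: ('i \<Rightarrow> nat \<Rightarrow> int ^ 'd \<Rightarrow> complex) topology)
           {c \<in> besov_seq p q s. maximally_divergent \<psi> p s c UNIV}"
proof -
  from assms(4) obtain C0 and L :: "('i \<times> nat \<times> (int ^ 'd)) set" where C0: "0 < C0" and L: "finite L" "\<forall>(i, j, k)\<in>L. 1 \<le> j"
    and cover: "\<forall>x :: real ^ 'd. (\<forall>m. 0 \<le> x $ m \<and> x $ m < 1) \<longrightarrow>
            (\<exists>(i,j,k)\<in>L. norm (\<psi> i ((2::real) ^ j *\<^sub>R x - vec_of_int k)) \<ge> C0)"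
    unfolding dyadic_covering_def by blast
  \<comment> \<open>The sum dominates each scale of a triplet, and the successor gives 1 \<le> T
    even if \<open>L\<close> is empty.\<close>
  define T where "T = Suc (\<Sum>y\<in>L. fst (snd y))"
  interpret wavelet_probe L T p q s
  proof
    fix i l b assume y: "(i, l, b) \<in> L"
    have "fst (snd (i, l, b)) \<le> (\<Sum>y\<in>L. fst (snd y))"
      using y L(1) by (intro member_le_sum[of "(i, l, b)" L "\<lambda>y. fst (snd y)"]) auto
    then show "1 \<le> l \<and> l \<le> T" using y L(2) by (auto simp: T_def)
  qed (use L assms in \<open>auto simp: T_def\<close>)
  have "topspace (besov_topology p q s) - {c \<in> besov_seq p q s. maximally_divergent \<psi> p s c UNIV}
      \<subseteq> besov_seq p q s - {c. eventually_robust c}"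
    using maximally_divergent_of_robust[OF _ _ _ C0 assms(3)] cover by auto
  then show ?thesis
    unfolding prevalent_def haar_null_def using haar_null_not_eventually_robust by blast
qed

end
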